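(* Let $H\in\mathfrak t$ be a mass linear function on a simple polytope $\Delta\subset\mathfrak t^*$. Let $f$ be a symmetric face of $\Delta$. Then the restriction of $H$ to $f$ is mass linear, and the map $F\mapsto F\cap f$ induces a one-to-one correspondence between the asymmetric facets of $\Delta$ and the asymmetric facets of $f$. Moreover, for each asymmetric facet $F$ of $\Delta$, the coefficient of the support number of $F$ in $\langle H,c_\Delta\rangle$ is the coefficient of the support number of $F\cap f$ in $\langle H,c_f\rangle$.
   Context: Let $\mathfrak t$ be a finite-dimensional real vector space with dual $\mathfrak t^*$ and pairing $\langle\cdot,\cdot\rangle$. A polytope is a bounded set $\Delta=\bigcap_{i=1}^N\{x\in\mathfrak t^*\mid\langle\eta_i,x\rangle\le\kappa_i\}$ with outward conormals $\eta_i\in\mathfrak t$ and support numbers $\kappa_i\in\mathbb R$, where $\Delta$ affinely spans $\mathfrak t^*$ and each facet $F_i=\Delta\cap\{\langle\eta_i,x\rangle=\kappa_i\}$ affinely spans a hyperplane. It is simple if exactly $\dim\mathfrak t$ facets meet at each vertex. For $\kappa'\in\mathbb R^N$ let $\Delta(\kappa')=\bigcap_i\{\langle\eta_i,x\rangle\le\kappa'_i\}$. The chamber $\mathcal C_\Delta\subset\mathbb R^N$ is the connected component containing $\kappa$ of the set of $\kappa'$ for which $\Delta(\kappa')$ is a simple polytope (with $N$ facets, that is, $\Delta(\kappa')$ affinely spans $\mathfrak t^*$, each of the $N$ sets $\Delta(\kappa')\cap\{\langle\eta_i,x\rangle=\kappa'_i\}$ affinely spans a hyperplane, and exactly $\dim\mathfrak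 t$ of these $N$ facets meet at each vertex). $c_\Delta(\kappa')$ is the center of mass of $\Delta(\kappa')$. $H\in\mathfrak t$ is mass linear on $\Delta$ if $\langle H,c_\Delta(\kappa')\rangle=\sum_i\gamma_i\kappa'_i+C$ on $\mathcal C_\Delta$ for some real constants $\gamma_i,C$; $\gamma_i$ is called the coefficient of the support number of $F_i$. A facet $F_i$ is symmetric (with respect to $H$) if $\kappa'\mapsto\langle H,c_\Delta(\kappa')\rangle$ on $\mathcal C_\Delta$ does not depend on $\kappa'_i$, and asymmetric otherwise. A (nonempty) face is symmetric if it is the intersection of symmetric facets. A face $f=\bigcap_{i\in I}F_i$ is itself viewed as a simple polytope in its affine span $P(f)=\bigcap_{i\in I}\{x\mid\langle\eta_i,x\rangle=\kappa_i\}$ by writing $f=\bigcap_{j\in I_f}\{x\in P(f)\mid\langle\eta_j,x\rangle\le\kappa_j\}$, where $I_f$ is the set of $j\notin I$ with $F_j\cap f\ne\emptyset$; its facets are the $F_j\cap f$, $j\in I_f$, with support numbers $\kappa_j$. With $P(f)$ and the functions $\eta_j|_{P(f)}$ fixed, the chamber $\mathcal C_f\subset\mathbb R^{I_f}$, the center of mass $c_f:\mathcal C_f\to P(f)$, mass linearity of the affine function $H|_{P(f)}$ on $f$ (meaning that $\langle H,c_f\rangle$ is a linear function of the support numbers plus a constant), coefficients, and symmetric/asymmetric facets of $f$ are defined exactly as for $\Delta$. *)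

theory Defs
  imports "HOL-Analysis.Analysis"
begin

text \<open>
  The ambient affine space is an affine subset P of a Euclidean space, so that the same
  definitions apply to a polytope and, with a smaller P, to each of its faces. The dual
  space of the mathematical text is a linear subspace; elements of the space it is dual
  to act on it by inner products (every linear functional is of this form).
  Support numbers are functions on an index set J.
\<close>

definition polytope_at ::
  "'a::euclidean_space set \<Rightarrow> 'i set \<Rightarrow> ('i \<Rightarrow> 'a) \<Rightarrow> ('i \<Rightarrow> real) \<Rightarrow> 'a set" where
  "polytope_at P J \<eta> \<kappa> = {x \<in> P. \<forall>i\<in>J. \<eta> i \<bullet> x \<le> \<kappa> i}"

definition facet ::
  "'a::euclidean_space set \<Rightarrow> 'i set \<Rightarrow> ('i \<Rightarrow> 'a) \<Rightarrow> ('i \<Rightarrow> real) \<Rightarrow> 'i \<Rightarrow> 'a set" where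
  "facet P J \<eta> \<kappa> i = polytope_at P J \<eta> \<kappa> \<inter> {x. \<eta> i \<bullet> x = \<kappa> i}"

text \<open>
  Nonemptiness of the facets matters only for a zero-dimensional P, where the empty set
  has affine dimension one less than P but is not a hyperplane. Facets through a vertex
  are counted by index.
\<close>

definition simple_polytope ::
  "'a::euclidean_space set \<Rightarrow> 'i set \<Rightarrow> ('i \<Rightarrow> 'a) \<Rightarrow> ('i \<Rightarrow> real) \<Rightarrow> bool" where
  "simple_polytope P J \<eta> \<kappa> \<longleftrightarrow>
     bounded (polytope_at P J \<eta> \<kappa>) \<and>
     affine hull (polytope_at P J \<eta> \<kappa>) = P \<and>
     (\<forall>i\<in>J. facet P J \<eta> \<kappa> i \<noteq> {} \<and> aff_dim (facet P J \<eta> \<kappa> i) = aff_dim P - 1) \<and>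
     (\<forall>v. v extreme_point_of (polytope_at P J \<eta> \<kappa>) \<longrightarrow>
        int (card {i \<in> J. v \<in> facet P J \<eta> \<kappa> i}) = aff_dim P)"

text \<open>
  The real vector space of J-tuples is represented by the functions that are undefined
  outside J; its topology is the one induced by the product topology of the function type.
\<close>

definition chamber ::
  "'a::euclidean_space set \<Rightarrow> 'i set \<Rightarrow> ('i \<Rightarrow> 'a) \<Rightarrow> ('i \<Rightarrow> real) \<Rightarrow> ('i \<Rightarrow> real) set" where
  "chamber P J \<eta> \<kappa> =
     connected_component_set {\<kappa>' \<in> J \<rightarrow>\<^sub>E UNIV. simple_polytope P J \<eta> \<kappa>'} (restrict \<kappa> J)"

definition orthonormal_frame ::
  "'a::euclidean_space set \<Rightarrow> 'a \<times> (nat \<Rightarrow> 'a) \<Rightarrow> bool" where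
  "orthonormal_frame P = (\<lambda>(p, b).
     (\<forall>i < nat (aff_dim P). \<forall>j < nat (aff_dim P). b i \<bullet> b j = (if i = j then 1 else 0)) \<and>
     P = range (\<lambda>y :: nat \<Rightarrow> real. p + (\<Sum>i < nat (aff_dim P). y i *\<^sub>R b i)))"

text \<open>
  Lebesgue measure on P, transported from coordinates; it does not depend on the
  orthonormal frame chosen. On a point it is the unit mass.
\<close>

definition affine_lborel :: "'a::euclidean_space set \<Rightarrow> 'a measure" where
  "affine_lborel P =
     (let (p, b) = (SOME pb. orthonormal_frame P pb)
      in distr (\<Pi>\<^sub>M i\<in>{..<nat (aff_dim P)}. lborel) borel
           (\<lambda>y. p + (\<Sum>i < nat (aff_dim P). y i *\<^sub>R b i)))"

definition center_of_mass :: "'a::euclidean_space set \<Rightarrow> 'a set \<Rightarrow> 'a" where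
  "center_of_mass P S =
     (1 / measure (affine_lborel P) S) *\<^sub>R (LINT x:S|affine_lborel P. x)"

definition mass_linear_with ::
  "'a::euclidean_space set \<Rightarrow> 'i set \<Rightarrow> ('i \<Rightarrow> 'a) \<Rightarrow> ('i \<Rightarrow> real) \<Rightarrow> 'a \<Rightarrow> ('i \<Rightarrow> real) \<Rightarrow> real \<Rightarrow> bool"
  where
  "mass_linear_with P J \<eta> \<kappa> H \<gamma> C \<longleftrightarrow>
     (\<forall>\<kappa>' \<in> chamber P J \<eta> \<kappa>.
        H \<bullet> center_of_mass P (polytope_at P J \<eta> \<kappa>') = (\<Sum>i\<in>J. \<gamma> i * \<kappa>' i) + C)"

definition mass_linear ::
  "'a::euclidean_space set \<Rightarrow> 'i set \<Rightarrow> ('i \<Rightarrow> 'a) \<Rightarrow> ('i \<Rightarrow> real) \<Rightarrow> 'a \<Rightarrow> bool" where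
  "mass_linear P J \<eta> \<kappa> H \<longleftrightarrow> (\<exists>\<gamma> C. mass_linear_with P J \<eta> \<kappa> H \<gamma> C)"

definition symmetric_index ::
  "'a::euclidean_space set \<Rightarrow> 'i set \<Rightarrow> ('i \<Rightarrow> 'a) \<Rightarrow> ('i \<Rightarrow> real) \<Rightarrow> 'a \<Rightarrow> 'i \<Rightarrow> bool" where
  "symmetric_index P J \<eta> \<kappa> H i \<longleftrightarrow>
     (\<forall>\<kappa>' \<in> chamber P J \<eta> \<kappa>. \<forall>\<kappa>'' \<in> chamber P J \<eta> \<kappa>.
        (\<forall>j \<in> J - {i}. \<kappa>' j = \<kappa>'' j) \<longrightarrow>
        H \<bullet> center_of_mass P (polytope_at P J \<eta> \<kappa>') =
        H \<bullet> center_of_mass P (polytope_at P J \<eta> \<kappa>''))"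

definition asymmetric_facets ::
  "'a::euclidean_space set \<Rightarrow> 'i set \<Rightarrow> ('i \<Rightarrow> 'a) \<Rightarrow> ('i \<Rightarrow> real) \<Rightarrow> 'a \<Rightarrow> 'a set set" where
  "asymmetric_facets P J \<eta> \<kappa> H =
     facet P J \<eta> \<kappa> ` {i \<in> J. \<not> symmetric_index P J \<eta> \<kappa> H i}"

text \<open>The face cut out by the facets with index in I; for empty I it is the whole polytope.\<close>

definition face ::
  "'a::euclidean_space set \<Rightarrow> 'i set \<Rightarrow> ('i \<Rightarrow> 'a) \<Rightarrow> ('i \<Rightarrow> real) \<Rightarrow> 'i set \<Rightarrow> 'a set" where
  "face P J \<eta> \<kappa> I = polytope_at P J \<eta> \<kappa> \<inter> (\<Inter>i\<in>I. facet P J \<eta> \<kappa> i)"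

definition face_space ::
  "'a::euclidean_space set \<Rightarrow> ('i \<Rightarrow> 'a) \<Rightarrow> ('i \<Rightarrow> real) \<Rightarrow> 'i set \<Rightarrow> 'a set" where
  "face_space P \<eta> \<kappa> I = {x \<in> P. \<forall>i\<in>I. \<eta> i \<bullet> x = \<kappa> i}"

definition face_indices ::
  "'a::euclidean_space set \<Rightarrow> 'i set \<Rightarrow> ('i \<Rightarrow> 'a) \<Rightarrow> ('i \<Rightarrow> real) \<Rightarrow> 'i set \<Rightarrow> 'i set" where
  "face_indices P J \<eta> \<kappa> I = {j \<in> J - I. facet P J \<eta> \<kappa> j \<inter> face P J \<eta> \<kappa> I \<noteq> {}}"

end

theory Submission
  imports Defs
begin

text \<open>
  Let \<open>L = \<Sum>\<^sub>j \<gamma>\<^sub>j \<kappa>\<^sub>j + C\<close> be the mean of \<open>H\<close> over the polytope, and let \<open>F\<^sub>i\<close> be a symmetric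
  facet, so that \<open>L\<close> does not depend on \<open>\<kappa>\<^sub>i\<close>. The integral of \<open>H - L\<close> over the polytope vanishes
  for all \<open>\<kappa>\<^sub>i\<close> in an interval, hence so does the integral over each slab that is swept out by
  \<open>F\<^sub>i\<close> as \<open>\<kappa>\<^sub>i\<close> varies; by Fubini's theorem the integral of \<open>H - L\<close> over \<open>F\<^sub>i\<close> vanishes too. So the
  mean of \<open>H\<close> over \<open>F\<^sub>i\<close> is also \<open>L\<close> (\<open>facet_mean\<close>). As \<open>F\<^sub>i\<close> depends only on the support
  numbers of the facets meeting it, \<open>\<gamma>\<^sub>j = 0\<close> for all the others, and \<open>H\<close> is mass linear on
  \<open>F\<^sub>i\<close> with the same coefficients, as long as \<open>\<kappa>\<close> stays close to the given point
  (\<open>mass_linear_facet\<close>). Facets with coefficient \<open>0\<close> are exactly the symmetric ones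
  (\<open>symmetric_index_iff\<close>), so that the argument can be repeated for the other facets through a
  symmetric face (\<open>mass_linear_face\<close>).

  The chamber of a facet is in general larger than what the chamber of the polytope induces on
  it. The passage from a neighbourhood to the whole chamber is an identity theorem
  (\<open>mass_linear_with_from_near\<close>): the volume and the first moments of a simple polytope are
  locally polynomial in the support numbers (\<open>moment_locally_polynomial\<close>). This is proved by
  induction on the dimension. When one support number moves, the moment changes by the integral
  of the moments of the moving facet, and a primitive of a polynomial is a polynomial.

  The geometric input is that near a vertex a simple polytope looks like an orthant
  (\<open>corner_at_vertex\<close>). This gives the dimensions of the faces (\<open>face_hull\<close>), the stability of
  the combinatorial type under small changes of the support numbers
  (\<open>simple_polytope_stable\<close>), and the fact that faces are simple polytopes
  (\<open>simple_polytope_face\<close>). The measure-theoretic input is that the measure on an affine subspace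
  does not depend on the orthonormal frame chosen (\<open>affine_lborel_oframe\<close>), so that frames can
  be adapted to the slices by parallel hyperplanes (\<open>affine_slicing\<close>).
\<close>

section \<open>Directions of an affine set\<close>

text \<open>The linear subspace parallel to an affine set.\<close>

definition directions :: "'a::euclidean_space set \<Rightarrow> 'a set" where
  "directions P = {x - y | x y. x \<in> P \<and> y \<in> P}"

lemma directions_eq:
  assumes "affine P" "p \<in> P"
  shows "directions P = (\<lambda>x. x - p) ` P"
proof -
  have "x - y + p \<in> P" if "x \<in> P" "y \<in> P" for x y
    using mem_affine_3_minus[OF assms(1) assms(2) that, of 1] by (simp add: algebra_simps)
  then have "\<exists>z\<in>P. x - y = z - p" if "x \<in> P" "y \<in> P" for x y
    using that by (metis add_diff_cancel)
  with assms show ?thesis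
    unfolding directions_def by blast
qed

lemma subspace_directions: "affine P \<Longrightarrow> P \<noteq> {} \<Longrightarrow> subspace (directions P)"
  using directions_eq affine_diffs_subspace_subtract by (metis all_not_in_conv)

lemma add_direction_iff:
  assumes "affine P" "p \<in> P"
  shows "p + d \<in> P \<longleftrightarrow> d \<in> directions P"
proof -
  have "d \<in> directions P \<longleftrightarrow> (\<exists>x\<in>P. d = x - p)"
    using directions_eq[OF assms] by auto
  also have "\<dots> \<longleftrightarrow> p + d \<in> P"
    by (auto intro!: bexI[of _ "p + d"])
  finally show ?thesis by simp
qed

lemma diff_in_directions: "x \<in> P \<Longrightarrow> y \<in> P \<Longrightarrow> x - y \<in> directions P"
  unfolding directions_def by blast

lemma aff_dim_directions:
  "affine P \<Longrightarrow> P \<noteq> {} \<Longrightarrow> aff_dim P = int (dim (directions P))"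
  using directions_eq aff_dim_dim_affine_diffs by (metis all_not_in_conv)

lemma functional_on_subspace:
  fixes L :: "'a::euclidean_space set"
  assumes "subspace L"
  shows "\<exists>q\<in>L. \<forall>d\<in>L. q \<bullet> d = a \<bullet> d"
proof -
  obtain y z where "y \<in> span L" "\<And>w. w \<in> span L \<Longrightarrow> orthogonal z w" "a = y + z"
    using orthogonal_subspace_decomp_exists[of L a] by blast
  moreover have "span L = L"
    using assms by (simp add: span_eq_iff)
  ultimately show ?thesis
    by (intro bexI[of _ y]) (auto simp: inner_add_left orthogonal_def)
qed

lemma common_kernel:
  fixes L :: "'a::euclidean_space set"
  assumes L: "subspace L" and A: "finite A" "card A < dim L"
  shows "\<exists>d\<in>L. d \<noteq> 0 \<and> (\<forall>i\<in>A. \<eta> i \<bullet> d = 0)"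
proof -
  have "\<forall>i. \<exists>q. q \<in> L \<and> (\<forall>d\<in>L. q \<bullet> d = \<eta> i \<bullet> d)"
    using functional_on_subspace[OF L] by blast
  from choice[OF this] obtain q
    where q: "\<And>i. q i \<in> L" "\<And>i d. d \<in> L \<Longrightarrow> q i \<bullet> d = \<eta> i \<bullet> d"
    by blast
  have "span (q ` A) \<subseteq> span L"
    using q(1) by (intro span_mono) auto
  moreover have "dim (q ` A) \<le> card A"
    using A by (meson card_image_le dim_le_card' finite_imageI le_trans)
  ultimately have "span (q ` A) \<subset> span L"
    using A by (metis dim_span nless_le not_le psubsetI)
  then obtain d where d: "d \<noteq> 0" "d \<in> span L" "\<And>y. y \<in> span (q ` A) \<Longrightarrow> orthogonal d y"
    using orthogonal_to_subspace_exists_gen by blast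
  have "d \<in> L"
    using d(2) L by (simp add: span_eq_iff[THEN iffD2])
  moreover have "\<eta> i \<bullet> d = 0" if "i \<in> A" for i
    using d(3)[of "q i"] q(2)[OF \<open>d \<in> L\<close>, of i] that
    by (auto simp: orthogonal_def span_base inner_commute)
  ultimately show ?thesis using d(1) by blast
qed

lemma finite_common_radius:
  assumes "finite K" and "\<And>i. i \<in> K \<Longrightarrow> \<exists>\<epsilon>>0. \<forall>t::real. t \<le> \<epsilon> \<longrightarrow> Q i t"
  shows "\<exists>\<epsilon>>0. \<forall>i\<in>K. \<forall>t. t \<le> \<epsilon> \<longrightarrow> Q i t"
  using assms
proof (induction K rule: finite_induct)
  case empty
  show ?case by (intro exI[of _ 1]) auto
next
  case (insert k K)
  obtain e1 where e1: "e1 > 0" "\<forall>i\<in>K. \<forall>t. t \<le> e1 \<longrightarrow> Q i t"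
    using insert by auto
  obtain e2 where e2: "e2 > 0" "\<forall>t. t \<le> e2 \<longrightarrow> Q k t"
    using insert.prems by blast
  show ?case
    using e1 e2 by (intro exI[of _ "min e1 e2"]) auto
qed

section \<open>Polytopes near a vertex\<close>

text \<open>The indices of the constraints that are equalities at a point.\<close>

definition active :: "'i set \<Rightarrow> ('i \<Rightarrow> 'a::euclidean_space) \<Rightarrow> ('i \<Rightarrow> real) \<Rightarrow> 'a \<Rightarrow> 'i set" where
  "active J \<eta> \<kappa> x = {i \<in> J. \<eta> i \<bullet> x = \<kappa> i}"

lemma active_eq_facets:
  "x \<in> polytope_at P J \<eta> \<kappa> \<Longrightarrow> {i \<in> J. x \<in> facet P J \<eta> \<kappa> i} = active J \<eta> \<kappa> x"
  unfolding active_def facet_def by auto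

lemma facet_eq_face: "facet P J \<eta> \<kappa> i = face P J \<eta> \<kappa> {i}"
  unfolding face_def facet_def by auto

lemma mem_face_iff:
  "I \<subseteq> J \<Longrightarrow> x \<in> face P J \<eta> \<kappa> I \<longleftrightarrow> x \<in> polytope_at P J \<eta> \<kappa> \<and> I \<subseteq> active J \<eta> \<kappa> x"
  unfolding face_def facet_def active_def by auto

lemma polytope_at_Inter:
  "polytope_at P J \<eta> \<kappa> = P \<inter> (\<Inter>i\<in>J. {x. \<eta> i \<bullet> x \<le> \<kappa> i})"
  unfolding polytope_at_def by auto

lemma convex_polytope_at: "affine P \<Longrightarrow> convex (polytope_at P J \<eta> \<kappa>)"
  unfolding polytope_at_Inter
  by (intro convex_Int convex_INT ballI convex_halfspace_le affine_imp_convex)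

lemma closed_polytope_at: "affine P \<Longrightarrow> closed (polytope_at P J \<eta> \<kappa>)"
  unfolding polytope_at_Inter
  by (intro closed_Int closed_INT ballI closed_halfspace_le affine_closed)

lemma face_face_of:
  assumes "affine P" "finite I"
  shows "face P J \<eta> \<kappa> (I \<inter> J) face_of polytope_at P J \<eta> \<kappa>"
  using assms(2)
proof (induction I rule: finite_induct)
  case empty
  then show ?case
    using face_of_refl[OF convex_polytope_at[OF assms(1)]] by (simp add: face_def)
next
  case (insert i I)
  show ?case
  proof (cases "i \<in> J")
    case True
    have "face P J \<eta> \<kappa> {i} face_of polytope_at P J \<eta> \<kappa>"
      unfolding facet_eq_face[symmetric] facet_def
      by (rule face_of_Int_supporting_hyperplane_le[OF convex_polytope_at[OF assms(1)]])
        (use True in \<open>auto simp: polytope_at_def\<close>)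
    from face_of_Int[OF insert.IH this] show ?thesis
      using True by (simp add: face_def facet_def Int_ac insert_absorb)
  next
    case False
    then show ?thesis using insert.IH by simp
  qed
qed

lemma extreme_point_of_face_exists:
  assumes P: "affine P" and J: "finite J" and I: "I \<subseteq> J"
    and b: "bounded (polytope_at P J \<eta> \<kappa>)" and ne: "face P J \<eta> \<kappa> I \<noteq> {}"
  shows "\<exists>v. v extreme_point_of polytope_at P J \<eta> \<kappa> \<and> v \<in> face P J \<eta> \<kappa> I"
proof -
  have f: "face P J \<eta> \<kappa> I face_of polytope_at P J \<eta> \<kappa>"
    using face_face_of[OF P finite_subset[OF I J], of J \<eta> \<kappa>] I by (simp add: Int_absorb2)
  have "compact (polytope_at P J \<eta> \<kappa>)"
    using b closed_polytope_at[OF P] by (simp add: compact_eq_bounded_closed)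
  with f have "compact (face P J \<eta> \<kappa> I)"
    using convex_polytope_at[OF P] face_of_imp_compact by blast
  moreover have "convex (face P J \<eta> \<kappa> I)"
    using f face_of_imp_convex by blast
  ultimately obtain v where "v extreme_point_of face P J \<eta> \<kappa> I"
    using ne extreme_point_exists_convex by blast
  then show ?thesis
    using extreme_point_of_face[OF f] by blast
qed

text \<open>A step of small length keeps the inactive constraints strict, whatever the rates \<open>c\<close> at
  which they may be used up.\<close>

lemma inactive_constraints_stable:
  assumes "finite J" and x: "x \<in> polytope_at P J \<eta> \<kappa>"
  shows "\<exists>\<epsilon>>0. \<forall>i\<in>J - active J \<eta> \<kappa> x. \<forall>t. t \<le> \<epsilon> \<longrightarrow> t * c i < \<kappa> i - \<eta> i \<bullet> x \<or> t < 0"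
proof (rule finite_common_radius)
  fix i assume i: "i \<in> J - active J \<eta> \<kappa> x"
  define r where "r = \<kappa> i - \<eta> i \<bullet> x"
  have r: "r > 0"
    using i x by (auto simp: active_def polytope_at_def r_def less_le)
  have "t * c i < r" if "t \<le> r / (\<bar>c i\<bar> + 1)" "0 \<le> t" for t
  proof -
    have "t * c i \<le> t * \<bar>c i\<bar>"
      using that by (simp add: mult_left_mono)
    also have "\<dots> \<le> r / (\<bar>c i\<bar> + 1) * \<bar>c i\<bar>"
      using that by (intro mult_right_mono) auto
    also have "\<dots> < r"
      using r by (simp add: field_simps)
    finally show ?thesis .
  qed
  then show "\<exists>\<epsilon>>0. \<forall>t. t \<le> \<epsilon> \<longrightarrow> t * c i < \<kappa> i - \<eta> i \<bullet> x \<or> t < 0"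
    using r by (intro exI[of _ "r / (\<bar>c i\<bar> + 1)"]) (auto simp: r_def[symmetric] not_less)
qed (use assms in auto)

lemma extreme_point_kernel:
  assumes P: "affine P" and J: "finite J" and v: "v extreme_point_of polytope_at P J \<eta> \<kappa>"
    and d: "d \<in> directions P" "\<And>i. i \<in> active J \<eta> \<kappa> v \<Longrightarrow> \<eta> i \<bullet> d = 0"
  shows "d = 0"
proof (rule ccontr)
  assume "d \<noteq> 0"
  have vD: "v \<in> polytope_at P J \<eta> \<kappa>"
    using v by (simp add: extreme_point_of_def)
  then have vP: "v \<in> P" by (simp add: polytope_at_def)
  obtain \<epsilon> where e: "\<epsilon> > 0"
    "\<forall>i\<in>J - active J \<eta> \<kappa> v. \<forall>t. t \<le> \<epsilon> \<longrightarrow> t * \<bar>\<eta> i \<bullet> d\<bar> < \<kappa> i - \<eta> i \<bullet> v \<or> t < 0"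
    using inactive_constraints_stable[OF J vD, of "\<lambda>i. \<bar>\<eta> i \<bullet> d\<bar>"] by auto
  have D: "v + s *\<^sub>R d \<in> polytope_at P J \<eta> \<kappa>" if s: "\<bar>s\<bar> = \<epsilon>" for s
  proof -
    have "s *\<^sub>R d \<in> directions P"
      using d(1) subspace_directions[OF P] vP by (auto intro: subspace_scale)
    then have "v + s *\<^sub>R d \<in> P"
      using add_direction_iff[OF P vP] by simp
    moreover have "\<eta> i \<bullet> (v + s *\<^sub>R d) \<le> \<kappa> i" if i: "i \<in> J" for i
    proof (cases "i \<in> active J \<eta> \<kappa> v")
      case True
      then show ?thesis
        using d(2) by (simp add: inner_add_right active_def)
    next
      case False
      have "s * (\<eta> i \<bullet> d) \<le> \<epsilon> * \<bar>\<eta> i \<bullet> d\<bar>"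
        using abs_ge_self[of "s * (\<eta> i \<bullet> d)"] s by (simp add: abs_mult)
      then show ?thesis
        using e False i by (force simp: inner_add_right)
    qed
    ultimately show ?thesis by (simp add: polytope_at_def)
  qed
  have "v \<in> open_segment (v + (- \<epsilon>) *\<^sub>R d) (v + \<epsilon> *\<^sub>R d)"
    unfolding in_segment
    using e(1) \<open>d \<noteq> 0\<close> by (intro conjI exI[of _ "1/2"]) (auto simp: algebra_simps simp flip: scaleR_add_left)
  then show False
    using v D[of "- \<epsilon>"] D[of \<epsilon>] e(1) unfolding extreme_point_of_def by auto
qed

lemma card_active_extreme_ge:
  assumes P: "affine P" and J: "finite J" and v: "v extreme_point_of polytope_at P J \<eta> \<kappa>"
  shows "aff_dim P \<le> int (card (active J \<eta> \<kappa> v))"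
proof (rule ccontr)
  assume "\<not> ?thesis"
  moreover have "P \<noteq> {}"
    using v by (auto simp: extreme_point_of_def polytope_at_def)
  moreover have "finite (active J \<eta> \<kappa> v)"
    using J by (simp add: active_def)
  ultimately obtain d where "d \<in> directions P" "d \<noteq> 0" "\<forall>i\<in>active J \<eta> \<kappa> v. \<eta> i \<bullet> d = 0"
    using common_kernel[OF subspace_directions[OF P], of "active J \<eta> \<kappa> v" \<eta>]
      aff_dim_directions[OF P] by auto
  then show False
    using extreme_point_kernel[OF P J v] by blast
qed

text \<open>The vectors \<open>w\<close> are dual to the conormals \<open>\<eta>\<close> with index in \<open>A\<close>.\<close>

abbreviation dual_on :: "'i set \<Rightarrow> ('i \<Rightarrow> 'a::euclidean_space) \<Rightarrow> ('i \<Rightarrow> 'a) \<Rightarrow> bool" where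
  "dual_on A \<eta> w \<equiv> (\<forall>i\<in>A. \<forall>j\<in>A. \<eta> j \<bullet> w i = (if j = i then 1 else 0))"

text \<open>Functionals without a common zero direction, as many as the dimension, have a dual basis. For
  the active conormals at a vertex its negatives are the directions of the edges.\<close>

lemma dual_basis_exists:
  fixes L :: "'a::euclidean_space set"
  assumes L: "subspace L" and A: "finite A" "card A = dim L"
    and ker: "\<And>d. d \<in> L \<Longrightarrow> (\<And>i. i \<in> A \<Longrightarrow> \<eta> i \<bullet> d = 0) \<Longrightarrow> d = 0"
  shows "\<exists>w. (\<forall>i\<in>A. w i \<in> L) \<and> dual_on A \<eta> w"
proof -
  have "\<exists>d\<in>L. \<forall>j\<in>A. \<eta> j \<bullet> d = (if j = i then 1 else 0)" if i: "i \<in> A" for i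
  proof -
    have "card (A - {i}) < dim L"
      using A i by (metis card_Diff1_less)
    then obtain d where d: "d \<in> L" "d \<noteq> 0" "\<forall>j\<in>A - {i}. \<eta> j \<bullet> d = 0"
      using common_kernel[OF L, of "A - {i}" \<eta>] A by auto
    then have nz: "\<eta> i \<bullet> d \<noteq> 0"
      using ker[of d] by blast
    have "d /\<^sub>R (\<eta> i \<bullet> d) \<in> L"
      using L d(1) by (simp add: subspace_scale)
    moreover have "\<forall>j\<in>A. \<eta> j \<bullet> (d /\<^sub>R (\<eta> i \<bullet> d)) = (if j = i then 1 else 0)"
      using d nz by auto
    ultimately show ?thesis by blast
  qed
  then show ?thesis by metis
qed

lemma inner_dual_sum:
  fixes w :: "'i \<Rightarrow> 'a::euclidean_space"
  assumes "finite A" "dual_on A \<eta> w" "B \<subseteq> A" "j \<in> A"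
  shows "\<eta> j \<bullet> (\<Sum>i\<in>B. t i *\<^sub>R w i) = (if j \<in> B then t j else 0)"
proof -
  have "\<eta> j \<bullet> (\<Sum>i\<in>B. t i *\<^sub>R w i) = (\<Sum>i\<in>B. t i * (\<eta> j \<bullet> w i))"
    by (simp add: inner_sum_right)
  also have "\<dots> = (\<Sum>i\<in>B. if j = i then t i else 0)"
    using assms by (intro sum.cong) auto
  also have "\<dots> = (if j \<in> B then t j else 0)"
    using finite_subset[OF assms(3,1)] by simp
  finally show ?thesis .
qed

text \<open>A small corner of the cone spanned at a vertex by the negatives of the dual basis lies in the
  polytope, and each coordinate in it vanishes exactly on the corresponding facet.\<close>

lemma corner_at_vertex:
  assumes P: "affine P" and J: "finite J" and v: "v \<in> polytope_at P J \<eta> \<kappa>"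
    and w: "\<forall>i\<in>active J \<eta> \<kappa> v. w i \<in> directions P"
    and dual: "dual_on (active J \<eta> \<kappa> v) \<eta> w"
  shows "\<exists>\<epsilon>>0. \<forall>t. (\<forall>i\<in>active J \<eta> \<kappa> v. 0 \<le> t i \<and> t i \<le> \<epsilon>) \<longrightarrow>
    v - (\<Sum>i\<in>active J \<eta> \<kappa> v. t i *\<^sub>R w i) \<in> polytope_at P J \<eta> \<kappa> \<and>
    active J \<eta> \<kappa> (v - (\<Sum>i\<in>active J \<eta> \<kappa> v. t i *\<^sub>R w i)) = {i \<in> active J \<eta> \<kappa> v. t i = 0}"
proof -
  let ?A = "active J \<eta> \<kappa> v"
  have A: "finite ?A" using J by (simp add: active_def)
  have vP: "v \<in> P" using v by (simp add: polytope_at_def)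
  then have sub: "subspace (directions P)"
    using subspace_directions[OF P] by blast
  obtain \<epsilon> where e: "\<epsilon> > 0"
    "\<forall>j\<in>J - ?A. \<forall>t. t \<le> \<epsilon> \<longrightarrow> t * (\<Sum>i\<in>?A. \<bar>\<eta> j \<bullet> w i\<bar>) < \<kappa> j - \<eta> j \<bullet> v \<or> t < 0"
    using inactive_constraints_stable[OF J v, of "\<lambda>j. \<Sum>i\<in>?A. \<bar>\<eta> j \<bullet> w i\<bar>"] by auto
  show ?thesis
  proof (intro exI[of _ \<epsilon>] conjI e(1) allI impI)
    fix t :: "'b \<Rightarrow> real" assume t: "\<forall>i\<in>?A. 0 \<le> t i \<and> t i \<le> \<epsilon>"
    define x where "x = v - (\<Sum>i\<in>?A. t i *\<^sub>R w i)"
    have "- (\<Sum>i\<in>?A. t i *\<^sub>R w i) \<in> directions P"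
      using w sub by (intro subspace_neg[OF sub] subspace_sum subspace_scale) auto
    then have xP: "x \<in> P"
      using add_direction_iff[OF P vP, of "- (\<Sum>i\<in>?A. t i *\<^sub>R w i)"] by (simp add: x_def)
    have act: "\<eta> j \<bullet> x = \<kappa> j - t j" if "j \<in> ?A" for j
      using inner_dual_sum[OF A dual subset_refl that, where t = t] that
      by (simp add: x_def inner_diff_right active_def)
    have inact: "\<eta> j \<bullet> x < \<kappa> j" if j: "j \<in> J - ?A" for j
    proof -
      have "- (\<eta> j \<bullet> (\<Sum>i\<in>?A. t i *\<^sub>R w i)) = (\<Sum>i\<in>?A. - (t i * (\<eta> j \<bullet> w i)))"
        by (simp add: inner_sum_right sum_negf)
      also have "\<dots> \<le> (\<Sum>i\<in>?A. \<epsilon> * \<bar>\<eta> j \<bullet> w i\<bar>)"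
      proof (rule sum_mono)
        fix i assume i: "i \<in> ?A"
        have "- (t i * (\<eta> j \<bullet> w i)) \<le> t i * \<bar>\<eta> j \<bullet> w i\<bar>"
          using mult_left_mono[OF abs_ge_minus_self, of "t i" "\<eta> j \<bullet> w i"] t i by simp
        also have "\<dots> \<le> \<epsilon> * \<bar>\<eta> j \<bullet> w i\<bar>"
          using t i by (intro mult_right_mono) auto
        finally show "- (t i * (\<eta> j \<bullet> w i)) \<le> \<epsilon> * \<bar>\<eta> j \<bullet> w i\<bar>" .
      qed
      also have "\<dots> = \<epsilon> * (\<Sum>i\<in>?A. \<bar>\<eta> j \<bullet> w i\<bar>)"
        by (simp add: sum_distrib_left)
      also have "\<dots> < \<kappa> j - \<eta> j \<bullet> v"
        using e j by force
      finally show ?thesis by (simp add: x_def inner_diff_right)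
    qed
    have "x \<in> polytope_at P J \<eta> \<kappa>"
      unfolding polytope_at_def
    proof (intro CollectI conjI xP ballI)
      fix j assume j: "j \<in> J"
      show "\<eta> j \<bullet> x \<le> \<kappa> j"
        using act[of j] inact[of j] t j by (cases "j \<in> ?A") auto
    qed
    moreover have "active J \<eta> \<kappa> x = {i \<in> ?A. t i = 0}"
    proof -
      have "j \<in> active J \<eta> \<kappa> x \<longleftrightarrow> j \<in> {i \<in> ?A. t i = 0}" for j
      proof (cases "j \<in> ?A")
        case True
        then show ?thesis
          using act[OF True] by (auto simp: active_def)
      next
        case False
        then show ?thesis
          using inact[of j] by (auto simp: active_def)
      qed
      then show ?thesis by blast
    qed
    ultimately show "v - (\<Sum>i\<in>?A. t i *\<^sub>R w i) \<in> polytope_at P J \<eta> \<kappa>"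
      "active J \<eta> \<kappa> (v - (\<Sum>i\<in>?A. t i *\<^sub>R w i)) = {i \<in> ?A. t i = 0}"
      by (simp_all add: x_def)
  qed
qed

lemma vertex_dual_basis:
  assumes P: "affine P" and J: "finite J" and v: "v extreme_point_of polytope_at P J \<eta> \<kappa>"
    and c: "int (card (active J \<eta> \<kappa> v)) = aff_dim P"
  shows "\<exists>w. (\<forall>i\<in>active J \<eta> \<kappa> v. w i \<in> directions P) \<and>
    dual_on (active J \<eta> \<kappa> v) \<eta> w"
proof -
  have ne: "P \<noteq> {}"
    using v by (auto simp: extreme_point_of_def polytope_at_def)
  show ?thesis
  proof (rule dual_basis_exists)
    show "subspace (directions P)" using subspace_directions[OF P ne] .
    show "finite (active J \<eta> \<kappa> v)" using J by (simp add: active_def)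
    show "card (active J \<eta> \<kappa> v) = dim (directions P)"
      using c aff_dim_directions[OF P ne] by simp
    show "d = 0" if "d \<in> directions P" "\<And>i. i \<in> active J \<eta> \<kappa> v \<Longrightarrow> \<eta> i \<bullet> d = 0" for d
      using extreme_point_kernel[OF P J v that] .
  qed
qed

lemma affine_face_space: "affine P \<Longrightarrow> affine (face_space P \<eta> \<kappa> I)"
proof -
  assume "affine P"
  moreover have "face_space P \<eta> \<kappa> I = P \<inter> (\<Inter>i\<in>I. {x. \<eta> i \<bullet> x = \<kappa> i})"
    unfolding face_space_def by auto
  ultimately show ?thesis
    by (auto intro!: affine_Int affine_Inter affine_hyperplane)
qed

lemma face_subset_face_space: "I \<subseteq> J \<Longrightarrow> face P J \<eta> \<kappa> I \<subseteq> face_space P \<eta> \<kappa> I"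
  unfolding face_def face_space_def facet_def polytope_at_def by auto

lemma independent_dual:
  fixes w :: "'i \<Rightarrow> 'a::euclidean_space"
  assumes A: "finite A" and dual: "dual_on A \<eta> w"
    and B: "B \<subseteq> A"
  shows "independent (w ` B)" "card (w ` B) = card B"
proof -
  have inj: "inj_on w B"
    using dual B by (intro inj_onI) (metis subsetD zero_neq_one)
  then show "card (w ` B) = card B" by (rule card_image)
  have fB: "finite B" using A B finite_subset by blast
  show "independent (w ` B)"
  proof
    assume "dependent (w ` B)"
    then obtain u where u: "\<exists>x\<in>w ` B. u x \<noteq> 0" "(\<Sum>x\<in>w ` B. u x *\<^sub>R x) = 0"
      using fB by (auto simp: dependent_finite)
    then have "(\<Sum>i\<in>B. u (w i) *\<^sub>R w i) = 0"
      using sum.reindex[OF inj, of "\<lambda>x. u x *\<^sub>R x"] by simp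
    then have "u (w j) = 0" if "j \<in> B" for j
      using inner_dual_sum[OF A dual B, where j = j and t = "\<lambda>i. u (w i)"] that B by auto
    then show False using u(1) by blast
  qed
qed

text \<open>If the active constraints at a vertex are as many as the dimension, then each face through
  the vertex spans the solution space of its equations, and its codimension
  is the number of its equations.\<close>

lemma face_hull:
  assumes P: "affine P" and J: "finite J"
    and v: "v extreme_point_of polytope_at P J \<eta> \<kappa>"
    and c: "int (card (active J \<eta> \<kappa> v)) = aff_dim P"
    and I: "I \<subseteq> active J \<eta> \<kappa> v"
  shows "affine hull (face P J \<eta> \<kappa> I) = face_space P \<eta> \<kappa> I"
    and "aff_dim (face_space P \<eta> \<kappa> I) = aff_dim P - int (card I)"
proof -
  let ?A = "active J \<eta> \<kappa> v" and ?F = "face P J \<eta> \<kappa> I" and ?S = "face_space P \<eta> \<kappa> I"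
  have IJ: "I \<subseteq> J" using I by (auto simp: active_def)
  have A: "finite ?A" using J by (simp add: active_def)
  have vD: "v \<in> polytope_at P J \<eta> \<kappa>" using v by (simp add: extreme_point_of_def)
  then have vP: "v \<in> P" by (simp add: polytope_at_def)
  have vF: "v \<in> ?F" using vD I IJ by (simp add: mem_face_iff)
  then have vS: "v \<in> ?S" using face_subset_face_space[OF IJ] by blast
  then have neS: "?S \<noteq> {}" by blast
  obtain w where w: "\<forall>i\<in>?A. w i \<in> directions P"
    and dual: "dual_on ?A \<eta> w"
    using vertex_dual_basis[OF P J v c] by blast
  obtain \<epsilon> where e: "\<epsilon> > 0" and corner: "\<And>t. (\<forall>i\<in>?A. 0 \<le> t i \<and> t i \<le> \<epsilon>) \<Longrightarrow>
    v - (\<Sum>i\<in>?A. t i *\<^sub>R w i) \<in> polytope_at P J \<eta> \<kappa> \<and>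
    active J \<eta> \<kappa> (v - (\<Sum>i\<in>?A. t i *\<^sub>R w i)) = {i \<in> ?A. t i = 0}"
    using corner_at_vertex[OF P J vD w dual] by auto
  let ?B = "w ` (?A - I)"
  have ray: "v - \<epsilon> *\<^sub>R w i \<in> ?F" if i: "i \<in> ?A - I" for i
  proof -
    define t where "t j = (if j = i then \<epsilon> else 0)" for j
    have "(\<Sum>j\<in>?A. t j *\<^sub>R w j) = (\<Sum>j\<in>?A. if j = i then \<epsilon> *\<^sub>R w i else 0)"
      unfolding t_def by (intro sum.cong) auto
    also have "\<dots> = \<epsilon> *\<^sub>R w i" using A i by simp
    finally have "v - \<epsilon> *\<^sub>R w i \<in> polytope_at P J \<eta> \<kappa>"
      "active J \<eta> \<kappa> (v - \<epsilon> *\<^sub>R w i) = {j \<in> ?A. t j = 0}"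
      using corner[of t] e by (auto simp: t_def)
    then show ?thesis
      using I i IJ by (auto simp: mem_face_iff t_def)
  qed
  have dirS: "directions ?S = span ?B"
  proof
    show "directions ?S \<subseteq> span ?B"
    proof
      fix d assume "d \<in> directions ?S"
      then obtain x y where xy: "x \<in> ?S" "y \<in> ?S" "d = x - y"
        unfolding directions_def by blast
      then have dP: "d \<in> directions P" and dI: "\<forall>i\<in>I. \<eta> i \<bullet> d = 0"
        by (auto simp: face_space_def directions_def inner_diff_right)
      define s where "s = (\<Sum>i\<in>?A - I. (\<eta> i \<bullet> d) *\<^sub>R w i)"
      have sub: "subspace (directions P)"
        using subspace_directions[OF P] vP by blast
      have "d - s = 0"
      proof (rule extreme_point_kernel[OF P J v])
        show "d - s \<in> directions P"
          unfolding s_def using dP w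
          by (intro subspace_diff[OF sub] subspace_sum[OF sub] subspace_scale[OF sub]) auto
        show "\<eta> j \<bullet> (d - s) = 0" if "j \<in> ?A" for j
          using inner_dual_sum[OF A dual Diff_subset that, where t = "\<lambda>i. \<eta> i \<bullet> d"] that dI
          by (auto simp: s_def inner_diff_right)
      qed
      then have "d = s" by simp
      moreover have "s \<in> span ?B"
        unfolding s_def by (intro span_sum span_scale span_base imageI)
      ultimately show "d \<in> span ?B" by simp
    qed
    have "?B \<subseteq> directions ?S"
    proof
      fix b assume "b \<in> ?B"
      then obtain i where i: "i \<in> ?A - I" "b = w i" by blast
      have "v + w i \<in> P"
        using add_direction_iff[OF P vP] w i by blast
      then have "v + w i \<in> ?S"
        using vS dual i I by (auto simp: face_space_def inner_add_right)
      then show "b \<in> directions ?S"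
        using diff_in_directions[OF _ vS] i by force
    qed
    then show "span ?B \<subseteq> directions ?S"
      using subspace_directions[OF affine_face_space[OF P] neS] by (intro span_minimal)
  qed
  have fI: "finite I" using A I finite_subset by blast
  have "dim (span ?B) = card (?A - I)"
    using dim_span_eq_card_independent[OF independent_dual(1)[OF A dual Diff_subset]]
      independent_dual(2)[OF A dual Diff_subset] by simp
  then have "aff_dim ?S = int (card (?A - I))"
    using aff_dim_directions[OF affine_face_space[OF P] neS] dirS by simp
  then show "aff_dim ?S = aff_dim P - int (card I)"
    using c card_mono[OF A I] by (simp add: card_Diff_subset[OF fI I] of_nat_diff)
  show "affine hull ?F = ?S"
  proof
    show "affine hull ?F \<subseteq> ?S"
      using face_subset_face_space[OF IJ] affine_face_space[OF P] by (intro hull_minimal)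
    show "?S \<subseteq> affine hull ?F"
    proof
      fix x assume "x \<in> ?S"
      then have "x - v \<in> span ?B"
        using diff_in_directions[OF _ vS] dirS by blast
      moreover have "?B \<subseteq> span ((\<lambda>x. - v + x) ` ?F)"
      proof
        fix b assume "b \<in> ?B"
        then obtain i where i: "i \<in> ?A - I" "b = w i" by blast
        have "- v + (v - \<epsilon> *\<^sub>R w i) \<in> span ((\<lambda>x. - v + x) ` ?F)"
          using ray[OF i(1)] by (intro span_base imageI)
        from span_scale[OF this, of "- (1 / \<epsilon>)"]
        show "b \<in> span ((\<lambda>x. - v + x) ` ?F)" using e i by simp
      qed
      ultimately have "x - v \<in> span ((\<lambda>x. - v + x) ` ?F)"
        using span_minimal[OF _ subspace_span] by blast
      then have "v + (x - v) \<in> affine hull ?F"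
        unfolding affine_hull_span_gen[OF hull_inc[OF vF]] by blast
      then show "x \<in> affine hull ?F" by simp
    qed
  qed
qed

lemma face_space_empty [simp]: "face_space P \<eta> \<kappa> {} = P"
  unfolding face_space_def by simp

lemma face_empty [simp]: "face P J \<eta> \<kappa> {} = polytope_at P J \<eta> \<kappa>"
  unfolding face_def by simp

lemma simple_polytope_affine: "simple_polytope P J \<eta> \<kappa> \<Longrightarrow> affine P"
  unfolding simple_polytope_def using affine_affine_hull by metis

text \<open>The dimension requirements on a simple polytope follow from the vertex condition, once
  the polytope and its facets are nonempty.\<close>

lemma simple_polytope_iff:
  assumes P: "affine P" "P \<noteq> {}" and J: "finite J"
  shows "simple_polytope P J \<eta> \<kappa> \<longleftrightarrow>
    bounded (polytope_at P J \<eta> \<kappa>) \<and> polytope_at P J \<eta> \<kappa> \<noteq> {} \<and>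
    (\<forall>i\<in>J. face P J \<eta> \<kappa> {i} \<noteq> {}) \<and>
    (\<forall>v. v extreme_point_of polytope_at P J \<eta> \<kappa> \<longrightarrow> int (card (active J \<eta> \<kappa> v)) = aff_dim P)"
    (is "_ \<longleftrightarrow> ?R")
proof
  assume s: "simple_polytope P J \<eta> \<kappa>"
  have "polytope_at P J \<eta> \<kappa> \<noteq> {}"
    using s P unfolding simple_polytope_def by auto
  moreover have "int (card (active J \<eta> \<kappa> v)) = aff_dim P"
    if v: "v extreme_point_of polytope_at P J \<eta> \<kappa>" for v
  proof -
    have "v \<in> polytope_at P J \<eta> \<kappa>" using v by (simp add: extreme_point_of_def)
    from active_eq_facets[OF this] show ?thesis
      using s v unfolding simple_polytope_def by auto
  qed
  ultimately show ?R
    using s unfolding simple_polytope_def facet_eq_face by blast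
next
  assume r: ?R
  then have b: "bounded (polytope_at P J \<eta> \<kappa>)"
    and c: "\<And>v. v extreme_point_of polytope_at P J \<eta> \<kappa> \<Longrightarrow> int (card (active J \<eta> \<kappa> v)) = aff_dim P"
    by auto
  have hull: "affine hull (face P J \<eta> \<kappa> I) = face_space P \<eta> \<kappa> I \<and>
    aff_dim (face_space P \<eta> \<kappa> I) = aff_dim P - int (card I)"
    if I: "I \<subseteq> J" "face P J \<eta> \<kappa> I \<noteq> {}" for I
  proof -
    obtain v where v: "v extreme_point_of polytope_at P J \<eta> \<kappa>" "v \<in> face P J \<eta> \<kappa> I"
      using extreme_point_of_face_exists[OF P(1) J I(1) b I(2)] by blast
    then show ?thesis
      using face_hull[OF P(1) J v(1) c[OF v(1)]] I(1) by (simp add: mem_face_iff)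
  qed
  show "simple_polytope P J \<eta> \<kappa>"
    unfolding simple_polytope_def
  proof (intro conjI ballI allI impI b)
    show "affine hull polytope_at P J \<eta> \<kappa> = P"
      using hull[of "{}"] r by simp
  next
    fix i assume "i \<in> J"
    then show "facet P J \<eta> \<kappa> i \<noteq> {}" "aff_dim (facet P J \<eta> \<kappa> i) = aff_dim P - 1"
      using hull[of "{i}"] r aff_dim_affine_hull[of "face P J \<eta> \<kappa> {i}"]
      by (auto simp: facet_eq_face)
  next
    fix v assume "v extreme_point_of polytope_at P J \<eta> \<kappa>"
    then show "int (card {i \<in> J. v \<in> facet P J \<eta> \<kappa> i}) = aff_dim P"
      using c active_eq_facets[of v P J \<eta> \<kappa>] by (auto simp: extreme_point_of_def)
  qed
qed

section \<open>Faces of simple polytopes\<close>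

text \<open>On the affine span of a face only the constraints whose facets meet the face matter:
  on the segment from a point of the face to a point of the span violating other constraints,
  the first of these to become an equality does so at a point of the face.\<close>

lemma polytope_at_face:
  assumes P: "affine P" and J: "finite J" and I: "I \<subseteq> J" and ne: "face P J \<eta> \<kappa> I \<noteq> {}"
  shows "polytope_at (face_space P \<eta> \<kappa> I) (face_indices P J \<eta> \<kappa> I) \<eta> \<kappa> = face P J \<eta> \<kappa> I"
proof
  show "face P J \<eta> \<kappa> I \<subseteq> polytope_at (face_space P \<eta> \<kappa> I) (face_indices P J \<eta> \<kappa> I) \<eta> \<kappa>"
    using I by (auto simp: face_def polytope_at_def face_space_def face_indices_def facet_def)
  show "polytope_at (face_space P \<eta> \<kappa> I) (face_indices P J \<eta> \<kappa> I) \<eta> \<kappa> \<subseteq> face P J \<eta> \<kappa> I"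
  proof
    fix x assume x: "x \<in> polytope_at (face_space P \<eta> \<kappa> I) (face_indices P J \<eta> \<kappa> I) \<eta> \<kappa>"
    have xP: "x \<in> P" and xI: "\<And>i. i \<in> I \<Longrightarrow> \<eta> i \<bullet> x = \<kappa> i"
      and xf: "\<And>j. j \<in> face_indices P J \<eta> \<kappa> I \<Longrightarrow> \<eta> j \<bullet> x \<le> \<kappa> j"
      using x by (auto simp: polytope_at_def face_space_def)
    define K where "K = {j \<in> J. \<eta> j \<bullet> x > \<kappa> j}"
    obtain y where y: "y \<in> face P J \<eta> \<kappa> I" using ne by blast
    then have yP: "y \<in> P" and yJ: "\<And>j. j \<in> J \<Longrightarrow> \<eta> j \<bullet> y \<le> \<kappa> j"
      and yI: "\<And>i. i \<in> I \<Longrightarrow> \<eta> i \<bullet> y = \<kappa> i"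
      unfolding mem_face_iff[OF I] by (auto simp: polytope_at_def active_def)
    have "K = {}"
    proof (rule ccontr)
      assume K: "K \<noteq> {}"
      define s where "s j = (\<kappa> j - \<eta> j \<bullet> y) / (\<eta> j \<bullet> x - \<eta> j \<bullet> y)" for j
      define t where "t = Min (s ` K)"
      have fK: "finite K" using J by (simp add: K_def)
      have pos: "\<eta> k \<bullet> x - \<eta> k \<bullet> y > 0" if "k \<in> K" for k
        using that yJ[of k] by (auto simp: K_def)
      have s: "0 \<le> s k" "s k \<le> 1" if "k \<in> K" for k
        using that pos[OF that] yJ[of k] by (auto simp: s_def K_def field_simps)
      obtain j where j: "j \<in> K" "t = s j"
        using Min_in[of "s ` K"] fK K unfolding t_def by blast
      have t01: "0 \<le> t" "t \<le> 1" using s j by auto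
      define z where "z = y + t *\<^sub>R (x - y)"
      have \<eta>z: "\<eta> k \<bullet> z = \<eta> k \<bullet> y + t * (\<eta> k \<bullet> x - \<eta> k \<bullet> y)" for k
        by (simp add: z_def inner_add_right inner_diff_right)
      have zP: "z \<in> P"
        unfolding z_def using mem_affine_3_minus[OF P yP xP yP] .
      have zJ: "\<eta> k \<bullet> z \<le> \<kappa> k" if k: "k \<in> J" for k
      proof (cases "k \<in> K")
        case True
        have "t * (\<eta> k \<bullet> x - \<eta> k \<bullet> y) \<le> s k * (\<eta> k \<bullet> x - \<eta> k \<bullet> y)"
          using Min_le[of "s ` K" "s k"] fK True pos[OF True]
          by (intro mult_right_mono) (auto simp: t_def)
        also have "\<dots> = \<kappa> k - \<eta> k \<bullet> y"
          using pos[OF True] by (simp add: s_def)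
        finally show ?thesis by (simp add: \<eta>z)
      next
        case False
        have "\<eta> k \<bullet> z = (1 - t) * (\<eta> k \<bullet> y) + t * (\<eta> k \<bullet> x)"
          by (simp add: \<eta>z algebra_simps)
        also have "\<dots> \<le> (1 - t) * \<kappa> k + t * \<kappa> k"
          using False k yJ[OF k] t01 by (intro add_mono mult_left_mono) (auto simp: K_def)
        finally show ?thesis by (simp add: algebra_simps)
      qed
      have zI: "\<eta> i \<bullet> z = \<kappa> i" if "i \<in> I" for i
        using xI[OF that] yI[OF that] by (simp add: \<eta>z)
      have zj: "\<eta> j \<bullet> z = \<kappa> j"
        using pos[OF j(1)] by (simp add: \<eta>z j(2) s_def)
      have "z \<in> face P J \<eta> \<kappa> I" "z \<in> facet P J \<eta> \<kappa> j"
        using zP zJ zI zj by (auto simp: face_def facet_def polytope_at_def)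
      moreover have "j \<in> J - I"
        using j(1) xI by (auto simp: K_def)
      ultimately have "j \<in> face_indices P J \<eta> \<kappa> I"
        by (auto simp: face_indices_def)
      from xf[OF this] show False using j(1) by (simp add: K_def)
    qed
    have "\<eta> j \<bullet> x \<le> \<kappa> j" if "j \<in> J" for j
    proof -
      have "j \<notin> K" using \<open>K = {}\<close> by simp
      then show ?thesis using that by (simp add: K_def)
    qed
    then show "x \<in> face P J \<eta> \<kappa> I"
      using xP xI by (auto simp: face_def facet_def polytope_at_def)
  qed
qed

lemma facet_of_face:
  assumes "affine P" "finite J" "I \<subseteq> J" "face P J \<eta> \<kappa> I \<noteq> {}"
  shows "facet (face_space P \<eta> \<kappa> I) (face_indices P J \<eta> \<kappa> I) \<eta> \<kappa> j
    = facet P J \<eta> \<kappa> j \<inter> face P J \<eta> \<kappa> I"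
proof -
  have "facet (face_space P \<eta> \<kappa> I) (face_indices P J \<eta> \<kappa> I) \<eta> \<kappa> j = face P J \<eta> \<kappa> I \<inter> {x. \<eta> j \<bullet> x = \<kappa> j}"
    unfolding facet_def[of "face_space P \<eta> \<kappa> I"] polytope_at_face[OF assms] ..
  then show ?thesis by (auto simp: facet_def face_def)
qed

lemma face_of_face:
  assumes "affine P" "finite J" "I \<subseteq> J" "face P J \<eta> \<kappa> I \<noteq> {}"
  shows "face (face_space P \<eta> \<kappa> I) (face_indices P J \<eta> \<kappa> I) \<eta> \<kappa> K = face P J \<eta> \<kappa> (I \<union> K)"
  unfolding face_def[of "face_space P \<eta> \<kappa> I"] polytope_at_face[OF assms] facet_of_face[OF assms]
  by (auto simp: face_def)

lemma face_space_face_space: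
  "face_space (face_space P \<eta> \<kappa> I) \<eta> \<kappa> K = face_space P \<eta> \<kappa> (I \<union> K)"
  by (auto simp: face_space_def)

lemma face_indices_of_face:
  assumes "affine P" "finite J" "I \<subseteq> J" "face P J \<eta> \<kappa> I \<noteq> {}"
  shows "face_indices (face_space P \<eta> \<kappa> I) (face_indices P J \<eta> \<kappa> I) \<eta> \<kappa> K
    = face_indices P J \<eta> \<kappa> (I \<union> K)"
proof -
  have "face P J \<eta> \<kappa> (I \<union> K) \<subseteq> face P J \<eta> \<kappa> I"
    by (auto simp: face_def)
  then show ?thesis
    unfolding face_indices_def[of "face_space P \<eta> \<kappa> I"] facet_of_face[OF assms] face_of_face[OF assms]
    by (auto simp: face_indices_def)
qed

lemma simple_polytope_face:
  assumes s: "simple_polytope P J \<eta> \<kappa>" and J: "finite J" and I: "I \<subseteq> J"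
    and ne: "face P J \<eta> \<kappa> I \<noteq> {}"
  shows "simple_polytope (face_space P \<eta> \<kappa> I) (face_indices P J \<eta> \<kappa> I) \<eta> \<kappa>"
proof -
  let ?D = "polytope_at P J \<eta> \<kappa>"
  let ?S = "face_space P \<eta> \<kappa> I" and ?K = "face_indices P J \<eta> \<kappa> I"
  have P: "affine P" using simple_polytope_affine[OF s] .
  have Pne: "P \<noteq> {}" using ne by (auto simp: face_def polytope_at_def)
  have b: "bounded ?D"
    and c: "\<And>v. v extreme_point_of ?D \<Longrightarrow> int (card (active J \<eta> \<kappa> v)) = aff_dim P"
    using s simple_polytope_iff[OF P Pne J] by auto
  have Sne: "?S \<noteq> {}" using ne face_subset_face_space[OF I] by blast
  have K: "finite ?K" using J by (simp add: face_indices_def)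
  note eq = polytope_at_face[OF P J I ne]
  have fo: "face P J \<eta> \<kappa> I face_of ?D"
    using face_face_of[OF P finite_subset[OF I J], of J \<eta> \<kappa>] I by (simp add: Int_absorb2)
  have card: "int (card (active ?K \<eta> \<kappa> v)) = aff_dim ?S" if v: "v extreme_point_of face P J \<eta> \<kappa> I" for v
  proof -
    have v': "v extreme_point_of ?D" "v \<in> face P J \<eta> \<kappa> I"
      using extreme_point_of_face[OF fo] v by auto
    then have IA: "I \<subseteq> active J \<eta> \<kappa> v" using I by (simp add: mem_face_iff)
    have "v \<in> facet P J \<eta> \<kappa> j" if "j \<in> active J \<eta> \<kappa> v" for j
      using that v'(1) by (simp add: active_def facet_def extreme_point_of_def)
    then have "active ?K \<eta> \<kappa> v = active J \<eta> \<kappa> v - I"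
      using v'(2) unfolding active_def face_indices_def by blast
    then have "card (active ?K \<eta> \<kappa> v) = card (active J \<eta> \<kappa> v) - card I"
      using card_Diff_subset[OF finite_subset[OF I J] IA] by simp
    moreover have "card I \<le> card (active J \<eta> \<kappa> v)"
      using J IA by (intro card_mono) (auto simp: active_def)
    ultimately show ?thesis
      using face_hull(2)[OF P J v'(1) c[OF v'(1)] IA] c[OF v'(1)] by simp
  qed
  show ?thesis
    unfolding simple_polytope_iff[OF affine_face_space[OF P] Sne K] eq
  proof (intro conjI ballI allI impI)
    show "bounded (face P J \<eta> \<kappa> I)"
      using b by (rule bounded_subset) (auto simp: face_def)
    show "face P J \<eta> \<kappa> I \<noteq> {}" by (fact ne)
    show "face ?S ?K \<eta> \<kappa> {i} \<noteq> {}" if "i \<in> ?K" for i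
      using that unfolding facet_eq_face[symmetric] facet_of_face[OF P J I ne]
      by (auto simp: face_indices_def)
  qed (use card in auto)
qed

section \<open>Stability of simple polytopes\<close>

text \<open>The open ball of radius \<open>\<epsilon>\<close> about \<open>\<kappa>\<close> for the maximum norm on the coordinates in \<open>J\<close>.\<close>

definition near :: "'i set \<Rightarrow> real \<Rightarrow> ('i \<Rightarrow> real) \<Rightarrow> ('i \<Rightarrow> real) \<Rightarrow> bool" where
  "near J \<epsilon> \<kappa> \<kappa>' \<longleftrightarrow> (\<forall>j\<in>J. \<bar>\<kappa>' j - \<kappa> j\<bar> < \<epsilon>)"

lemma near_mono: "near J \<epsilon> \<kappa> \<kappa>' \<Longrightarrow> \<epsilon> \<le> \<delta> \<Longrightarrow> near J \<delta> \<kappa> \<kappa>'"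
  unfolding near_def by force

lemma near_refl: "\<epsilon> > 0 \<Longrightarrow> near J \<epsilon> \<kappa> \<kappa>"
  unfolding near_def by simp

lemma finite_common_near:
  assumes "finite K" and "\<And>k. k \<in> K \<Longrightarrow> \<exists>\<epsilon>>0. \<forall>\<kappa>'. near J \<epsilon> \<kappa> \<kappa>' \<longrightarrow> Q k \<kappa>'"
  shows "\<exists>\<epsilon>>0. \<forall>k\<in>K. \<forall>\<kappa>'. near J \<epsilon> \<kappa> \<kappa>' \<longrightarrow> Q k \<kappa>'"
  using assms
proof (induction K rule: finite_induct)
  case empty
  show ?case by (intro exI[of _ 1]) auto
next
  case (insert k K)
  obtain e1 where e1: "e1 > 0" "\<forall>k\<in>K. \<forall>\<kappa>'. near J e1 \<kappa> \<kappa>' \<longrightarrow> Q k \<kappa>'"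
    using insert by auto
  obtain e2 where e2: "e2 > 0" "\<forall>\<kappa>'. near J e2 \<kappa> \<kappa>' \<longrightarrow> Q k \<kappa>'"
    using insert.prems by blast
  have "near J e1 \<kappa> \<kappa>'" "near J e2 \<kappa> \<kappa>'" if "near J (min e1 e2) \<kappa> \<kappa>'" for \<kappa>'
    using near_mono[OF that] by auto
  then show ?case
    using e1 e2 by (intro exI[of _ "min e1 e2"]) auto
qed

lemma polytope_uniformly_bounded:
  assumes P: "affine P" and J: "finite J"
    and b: "bounded (polytope_at P J \<eta> \<kappa>)" and ne: "polytope_at P J \<eta> \<kappa> \<noteq> {}"
  shows "\<exists>R. \<forall>\<kappa>'. near J 1 \<kappa> \<kappa>' \<longrightarrow> polytope_at P J \<eta> \<kappa>' \<subseteq> cball 0 R"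
proof -
  let ?L = "directions P"
  obtain x0 where x0: "x0 \<in> polytope_at P J \<eta> \<kappa>" using ne by blast
  then have x0P: "x0 \<in> P" and x0J: "\<And>i. i \<in> J \<Longrightarrow> \<eta> i \<bullet> x0 \<le> \<kappa> i"
    by (auto simp: polytope_at_def)
  have L: "subspace ?L" using subspace_directions[OF P] x0P by blast
  \<comment> \<open>A direction in which no constraint increases spans a ray inside the polytope.\<close>
  have ray: "d = 0" if d: "d \<in> ?L" "\<And>i. i \<in> J \<Longrightarrow> \<eta> i \<bullet> d \<le> 0" for d
  proof (rule ccontr)
    assume "d \<noteq> 0"
    obtain R where R: "\<And>x. x \<in> polytope_at P J \<eta> \<kappa> \<Longrightarrow> norm x \<le> R"
      using b by (auto simp: bounded_iff)
    have D: "x0 + t *\<^sub>R d \<in> polytope_at P J \<eta> \<kappa>" if "t \<ge> 0" for t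
    proof -
      have "\<eta> i \<bullet> (x0 + t *\<^sub>R d) \<le> \<kappa> i" if "i \<in> J" for i
        using x0J[OF that] mult_nonneg_nonpos[OF \<open>t \<ge> 0\<close> d(2)[OF that]]
        by (simp add: inner_add_right)
      then show ?thesis
        using add_direction_iff[OF P x0P, of "t *\<^sub>R d"] subspace_scale[OF L d(1), of t]
        by (simp add: polytope_at_def)
    qed
    define t where "t = (R + norm x0 + 1) / norm d"
    have "0 \<le> R" using R[OF x0] norm_ge_zero[of x0] by linarith
    then have t: "t \<ge> 0" unfolding t_def by simp
    have "t * norm d = norm (t *\<^sub>R d)" using t by simp
    also have "\<dots> = norm ((x0 + t *\<^sub>R d) - x0)" by simp
    also have "\<dots> \<le> norm (x0 + t *\<^sub>R d) + norm x0" by (rule norm_triangle_ineq4)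
    also have "\<dots> \<le> R + norm x0" using R[OF D[OF t]] by simp
    finally show False using \<open>d \<noteq> 0\<close> by (simp add: t_def)
  qed
  define m where "m d = (\<Sum>i\<in>J. max 0 (\<eta> i \<bullet> d))" for d
  have m0: "m d > 0" if d: "d \<in> ?L" "d \<noteq> 0" for d
  proof (rule ccontr)
    assume "\<not> m d > 0"
    moreover have "m d \<ge> 0" unfolding m_def by (intro sum_nonneg) auto
    ultimately have "m d = 0" by simp
    then have "\<forall>i\<in>J. max 0 (\<eta> i \<bullet> d) = 0"
      unfolding m_def using sum_nonneg_eq_0_iff[OF J, of "\<lambda>i. max 0 (\<eta> i \<bullet> d)"] by simp
    then have "\<And>i. i \<in> J \<Longrightarrow> \<eta> i \<bullet> d \<le> 0" by (metis max.cobounded2)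
    then show False using ray d by blast
  qed
  have "\<exists>c>0. \<forall>d\<in>?L. c * norm d \<le> m d"
  proof (cases "?L \<inter> sphere 0 1 = {}")
    case True
    have "d = 0" if "d \<in> ?L" for d
    proof (rule ccontr)
      assume "d \<noteq> 0"
      then have "(1 / norm d) *\<^sub>R d \<in> ?L \<inter> sphere 0 1"
        using subspace_scale[OF L that, of "1 / norm d"] by simp
      then show False using True by blast
    qed
    then have "1 * norm d \<le> m d" if "d \<in> ?L" for d
      using that by (fastforce simp: m_def)
    then show ?thesis using zero_less_one by blast
  next
    case False
    have "compact (?L \<inter> sphere 0 1)"
      using closed_subspace[OF L] by (simp add: closed_Int_compact)
    moreover have "continuous_on (?L \<inter> sphere 0 1) m"
      unfolding m_def by (intro continuous_intros)
    ultimately obtain d0 where d0: "d0 \<in> ?L \<inter> sphere 0 1"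
      "\<And>d. d \<in> ?L \<inter> sphere 0 1 \<Longrightarrow> m d0 \<le> m d"
      using continuous_attains_inf[OF _ False] by blast
    have "m d0 * norm d \<le> m d" if d: "d \<in> ?L" for d
    proof (cases "d = 0")
      case True
      then show ?thesis by (simp add: m_def)
    next
      case nz: False
      have "(1 / norm d) *\<^sub>R d \<in> ?L \<inter> sphere 0 1"
        using subspace_scale[OF L d, of "1 / norm d"] nz by simp
      then have "m d0 \<le> m ((1 / norm d) *\<^sub>R d)" using d0(2) by blast
      also have "\<dots> = (\<Sum>i\<in>J. (1 / norm d) * max 0 (\<eta> i \<bullet> d))"
        unfolding m_def using nz by (intro sum.cong) (auto simp: max_def zero_le_divide_iff)
      also have "\<dots> = m d / norm d"
        unfolding m_def by (simp add: sum_divide_distrib)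
      finally show ?thesis using nz by (simp add: field_simps)
    qed
    moreover have "m d0 > 0" using d0(1) by (intro m0) auto
    ultimately show ?thesis by blast
  qed
  then obtain c where c: "c > 0" "\<And>d. d \<in> ?L \<Longrightarrow> c * norm d \<le> m d" by blast
  define r where "r = (\<Sum>i\<in>J. \<kappa> i + 1 - \<eta> i \<bullet> x0)"
  have "norm x \<le> norm x0 + r / c" if k: "near J 1 \<kappa> \<kappa>'" and x: "x \<in> polytope_at P J \<eta> \<kappa>'" for \<kappa>' x
  proof -
    have xP: "x \<in> P" using x by (simp add: polytope_at_def)
    have "c * norm (x - x0) \<le> m (x - x0)"
      using c(2) diff_in_directions[OF xP x0P] by blast
    also have "\<dots> \<le> r"
      unfolding m_def r_def
    proof (rule sum_mono)
      fix i assume i: "i \<in> J"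
      have "\<eta> i \<bullet> x \<le> \<kappa>' i" "\<kappa>' i < \<kappa> i + 1"
        using x k i by (auto simp: polytope_at_def near_def abs_less_iff)
      then show "max 0 (\<eta> i \<bullet> (x - x0)) \<le> \<kappa> i + 1 - \<eta> i \<bullet> x0"
        using x0J[OF i] by (simp add: inner_diff_right)
    qed
    finally have "norm (x - x0) \<le> r / c" using c(1) by (simp add: field_simps)
    then show ?thesis using norm_triangle_sub[of x x0] by simp
  qed
  then show ?thesis by (intro exI[of _ "norm x0 + r / c"]) auto
qed

text \<open>The total violation \<open>\<phi>\<close> of the constraints and equations of an empty face is bounded below on
  a compact set containing all the polytopes in question.\<close>

lemma empty_face_stable:
  assumes P: "affine P" and J: "finite J" and I: "I \<subseteq> J"
    and b: "bounded (polytope_at P J \<eta> \<kappa>)" and ne: "polytope_at P J \<eta> \<kappa> \<noteq> {}"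
    and e: "face P J \<eta> \<kappa> I = {}"
  shows "\<exists>\<epsilon>>0. \<forall>\<kappa>'. near J \<epsilon> \<kappa> \<kappa>' \<longrightarrow> face P J \<eta> \<kappa>' I = {}"
proof -
  obtain R where R: "\<And>\<kappa>'. near J 1 \<kappa> \<kappa>' \<Longrightarrow> polytope_at P J \<eta> \<kappa>' \<subseteq> cball 0 R"
    using polytope_uniformly_bounded[OF P J b ne] by blast
  define \<phi> where "\<phi> x = (\<Sum>j\<in>J. max 0 (\<eta> j \<bullet> x - \<kappa> j)) + (\<Sum>i\<in>I. \<bar>\<eta> i \<bullet> x - \<kappa> i\<bar>)" for x
  have fI: "finite I" using I J finite_subset by blast
  have K: "compact (P \<inter> cball 0 R)"
    using affine_closed[OF P] by (simp add: closed_Int_compact)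
  have Kne: "P \<inter> cball 0 R \<noteq> {}"
    using R[OF near_refl[of 1 J \<kappa>]] ne by (auto simp: polytope_at_def)
  have "continuous_on (P \<inter> cball 0 R) \<phi>"
    unfolding \<phi>_def by (intro continuous_intros)
  then obtain x0 where x0: "x0 \<in> P \<inter> cball 0 R" "\<And>x. x \<in> P \<inter> cball 0 R \<Longrightarrow> \<phi> x0 \<le> \<phi> x"
    using continuous_attains_inf[OF K Kne] by blast
  have nn: "0 \<le> (\<Sum>j\<in>J. max 0 (\<eta> j \<bullet> x0 - \<kappa> j))" "0 \<le> (\<Sum>i\<in>I. \<bar>\<eta> i \<bullet> x0 - \<kappa> i\<bar>)"
    by (auto intro: sum_nonneg)
  have pos: "\<phi> x0 > 0"
  proof (rule ccontr)
    assume "\<not> \<phi> x0 > 0"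
    then have z: "(\<Sum>j\<in>J. max 0 (\<eta> j \<bullet> x0 - \<kappa> j)) = 0" "(\<Sum>i\<in>I. \<bar>\<eta> i \<bullet> x0 - \<kappa> i\<bar>) = 0"
      using nn unfolding \<phi>_def by linarith+
    have "\<forall>j\<in>J. max 0 (\<eta> j \<bullet> x0 - \<kappa> j) = 0"
      using z(1) sum_nonneg_eq_0_iff[OF J, of "\<lambda>j. max 0 (\<eta> j \<bullet> x0 - \<kappa> j)"] by simp
    moreover have "\<forall>i\<in>I. \<eta> i \<bullet> x0 = \<kappa> i"
      using z(2) sum_nonneg_eq_0_iff[OF fI, of "\<lambda>i. \<bar>\<eta> i \<bullet> x0 - \<kappa> i\<bar>"] by simp
    ultimately have "x0 \<in> face P J \<eta> \<kappa> I"
      using x0(1) by (force simp: face_def facet_def polytope_at_def max_def split: if_splits)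
    then show False using e by blast
  qed
  define \<epsilon> where "\<epsilon> = min 1 (\<phi> x0 / (2 * (real (card J) + real (card I) + 1)))"
  have e0: "\<epsilon> > 0" using pos by (simp add: \<epsilon>_def)
  have "face P J \<eta> \<kappa>' I = {}" if k: "near J \<epsilon> \<kappa> \<kappa>'" for \<kappa>'
  proof (rule ccontr)
    assume "face P J \<eta> \<kappa>' I \<noteq> {}"
    then obtain x where x: "x \<in> polytope_at P J \<eta> \<kappa>'" "\<forall>i\<in>I. \<eta> i \<bullet> x = \<kappa>' i"
      unfolding face_def facet_def by blast
    have "near J 1 \<kappa> \<kappa>'" using near_mono[OF k, of 1] by (simp add: \<epsilon>_def)
    moreover have "x \<in> P" using x(1) by (simp add: polytope_at_def)
    ultimately have "x \<in> P \<inter> cball 0 R" using R x(1) by blast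
    then have "\<phi> x0 \<le> \<phi> x" using x0(2) by blast
    also have "\<phi> x \<le> (\<Sum>j\<in>J. \<epsilon>) + (\<Sum>i\<in>I. \<epsilon>)"
      unfolding \<phi>_def
    proof (intro add_mono sum_mono)
      fix j assume "j \<in> J"
      then have "\<eta> j \<bullet> x \<le> \<kappa>' j" "\<kappa>' j - \<kappa> j < \<epsilon>"
        using x(1) k by (auto simp: polytope_at_def near_def abs_less_iff)
      then show "max 0 (\<eta> j \<bullet> x - \<kappa> j) \<le> \<epsilon>" using e0 by simp
    next
      fix i assume "i \<in> I"
      then show "\<bar>\<eta> i \<bullet> x - \<kappa> i\<bar> \<le> \<epsilon>" using x(2) k I by (force simp: near_def)
    qed
    also have "\<dots> = (real (card J) + real (card I)) * \<epsilon>" by (simp add: algebra_simps)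
    also have "\<dots> \<le> (real (card J) + real (card I) + 1) * (\<phi> x0 / (2 * (real (card J) + real (card I) + 1)))"
      using e0 by (intro mult_mono) (auto simp: \<epsilon>_def)
    also have "\<dots> = \<phi> x0 / 2"
      by (simp add: field_simps)
    finally show False using pos by simp
  qed
  then show ?thesis using e0 by blast
qed

text \<open>A vertex moves linearly with the support numbers of the facets through it.\<close>

lemma nonempty_face_stable:
  assumes P: "affine P" and J: "finite J" and I: "I \<subseteq> J"
    and v: "v extreme_point_of polytope_at P J \<eta> \<kappa>" "v \<in> face P J \<eta> \<kappa> I"
    and c: "int (card (active J \<eta> \<kappa> v)) = aff_dim P"
  shows "\<exists>\<epsilon>>0. \<forall>\<kappa>'. near J \<epsilon> \<kappa> \<kappa>' \<longrightarrow> face P J \<eta> \<kappa>' I \<noteq> {}"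
proof -
  let ?A = "active J \<eta> \<kappa> v"
  have IA: "I \<subseteq> ?A" using v(2) I by (simp add: mem_face_iff)
  have A: "finite ?A" "?A \<subseteq> J" using J by (auto simp: active_def)
  have vD: "v \<in> polytope_at P J \<eta> \<kappa>" using v(1) by (simp add: extreme_point_of_def)
  then have vP: "v \<in> P" by (simp add: polytope_at_def)
  obtain w where w: "\<forall>i\<in>?A. w i \<in> directions P"
    and dual: "dual_on ?A \<eta> w"
    using vertex_dual_basis[OF P J v(1) c] by blast
  have sub: "subspace (directions P)" using subspace_directions[OF P] vP by blast
  obtain \<epsilon> where e: "\<epsilon> > 0"
    "\<forall>j\<in>J - ?A. \<forall>t. t \<le> \<epsilon> \<longrightarrow> t * (1 + (\<Sum>i\<in>?A. \<bar>\<eta> j \<bullet> w i\<bar>)) < \<kappa> j - \<eta> j \<bullet> v \<or> t < 0"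
    using inactive_constraints_stable[OF J vD, of "\<lambda>j. 1 + (\<Sum>i\<in>?A. \<bar>\<eta> j \<bullet> w i\<bar>)"] by auto
  have "face P J \<eta> \<kappa>' I \<noteq> {}" if k: "near J \<epsilon> \<kappa> \<kappa>'" for \<kappa>'
  proof -
    define x where "x = v + (\<Sum>i\<in>?A. (\<kappa>' i - \<kappa> i) *\<^sub>R w i)"
    have "(\<Sum>i\<in>?A. (\<kappa>' i - \<kappa> i) *\<^sub>R w i) \<in> directions P"
      using w by (intro subspace_sum[OF sub] subspace_scale[OF sub]) auto
    then have xP: "x \<in> P"
      unfolding x_def using add_direction_iff[OF P vP] by blast
    have act: "\<eta> j \<bullet> x = \<kappa>' j" if "j \<in> ?A" for j
      using inner_dual_sum[OF A(1) dual subset_refl that, where t = "\<lambda>i. \<kappa>' i - \<kappa> i"] that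
      by (simp add: x_def inner_add_right active_def)
    have inact: "\<eta> j \<bullet> x \<le> \<kappa>' j" if j: "j \<in> J - ?A" for j
    proof -
      have "\<eta> j \<bullet> (\<Sum>i\<in>?A. (\<kappa>' i - \<kappa> i) *\<^sub>R w i) = (\<Sum>i\<in>?A. (\<kappa>' i - \<kappa> i) * (\<eta> j \<bullet> w i))"
        by (simp add: inner_sum_right)
      also have "\<dots> \<le> (\<Sum>i\<in>?A. \<epsilon> * \<bar>\<eta> j \<bullet> w i\<bar>)"
      proof (rule sum_mono)
        fix i assume i: "i \<in> ?A"
        have "(\<kappa>' i - \<kappa> i) * (\<eta> j \<bullet> w i) \<le> \<bar>\<kappa>' i - \<kappa> i\<bar> * \<bar>\<eta> j \<bullet> w i\<bar>"
          by (metis abs_ge_self abs_mult)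
        also have "\<dots> \<le> \<epsilon> * \<bar>\<eta> j \<bullet> w i\<bar>"
          using k i A by (intro mult_right_mono) (auto simp: near_def less_imp_le)
        finally show "(\<kappa>' i - \<kappa> i) * (\<eta> j \<bullet> w i) \<le> \<epsilon> * \<bar>\<eta> j \<bullet> w i\<bar>" .
      qed
      also have "\<dots> = \<epsilon> * (\<Sum>i\<in>?A. \<bar>\<eta> j \<bullet> w i\<bar>)" by (simp add: sum_distrib_left)
      finally have "\<eta> j \<bullet> x \<le> \<eta> j \<bullet> v + \<epsilon> * (\<Sum>i\<in>?A. \<bar>\<eta> j \<bullet> w i\<bar>)"
        by (simp add: x_def inner_add_right)
      moreover have "\<epsilon> * (1 + (\<Sum>i\<in>?A. \<bar>\<eta> j \<bullet> w i\<bar>)) < \<kappa> j - \<eta> j \<bullet> v"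
        using e(1) e(2)[rule_format, OF j, of \<epsilon>] by simp
      moreover have "\<kappa> j - \<epsilon> < \<kappa>' j"
        using k j by (auto simp: near_def abs_less_iff)
      ultimately show ?thesis by (simp add: algebra_simps)
    qed
    have "x \<in> face P J \<eta> \<kappa>' I"
      using xP act inact IA by (force simp: face_def facet_def polytope_at_def)
    then show ?thesis by blast
  qed
  then show ?thesis using e(1) by blast
qed

text \<open>Nearby support numbers give simple polytopes in which the same sets of facets intersect.\<close>

lemma simple_polytope_stable:
  assumes s: "simple_polytope P J \<eta> \<kappa>" and Pne: "P \<noteq> {}" and J: "finite J"
  shows "\<exists>\<epsilon>>0. \<forall>\<kappa>'. near J \<epsilon> \<kappa> \<kappa>' \<longrightarrow> simple_polytope P J \<eta> \<kappa>' \<and>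
    (\<forall>I\<subseteq>J. face P J \<eta> \<kappa>' I \<noteq> {} \<longleftrightarrow> face P J \<eta> \<kappa> I \<noteq> {})"
proof -
  let ?D = "polytope_at P J \<eta> \<kappa>"
  have P: "affine P" using simple_polytope_affine[OF s] .
  have b: "bounded ?D" and ne: "?D \<noteq> {}"
    and fne: "\<And>i. i \<in> J \<Longrightarrow> face P J \<eta> \<kappa> {i} \<noteq> {}"
    and c: "\<And>v. v extreme_point_of ?D \<Longrightarrow> int (card (active J \<eta> \<kappa> v)) = aff_dim P"
    using s simple_polytope_iff[OF P Pne J] by auto
  have "\<exists>\<epsilon>>0. \<forall>I\<in>Pow J. \<forall>\<kappa>'. near J \<epsilon> \<kappa> \<kappa>' \<longrightarrow> (face P J \<eta> \<kappa>' I \<noteq> {} \<longleftrightarrow> face P J \<eta> \<kappa> I \<noteq> {})"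
  proof (rule finite_common_near)
    fix I assume "I \<in> Pow J"
    then have I: "I \<subseteq> J" by simp
    show "\<exists>\<epsilon>>0. \<forall>\<kappa>'. near J \<epsilon> \<kappa> \<kappa>' \<longrightarrow> (face P J \<eta> \<kappa>' I \<noteq> {} \<longleftrightarrow> face P J \<eta> \<kappa> I \<noteq> {})"
    proof (cases "face P J \<eta> \<kappa> I = {}")
      case True
      then show ?thesis using empty_face_stable[OF P J I b ne True] by simp
    next
      case False
      obtain v where v: "v extreme_point_of ?D" "v \<in> face P J \<eta> \<kappa> I"
        using extreme_point_of_face_exists[OF P J I b False] by blast
      show ?thesis using nonempty_face_stable[OF P J I v c[OF v(1)]] False by simp
    qed
  qed (use J in simp)
  then obtain \<epsilon> where e: "\<epsilon> > 0" and faces: "\<And>\<kappa>' I. near J \<epsilon> \<kappa> \<kappa>' \<Longrightarrow> I \<subseteq> J \<Longrightarrow>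
    (face P J \<eta> \<kappa>' I \<noteq> {} \<longleftrightarrow> face P J \<eta> \<kappa> I \<noteq> {})" by auto
  obtain R where R: "\<And>\<kappa>'. near J 1 \<kappa> \<kappa>' \<Longrightarrow> polytope_at P J \<eta> \<kappa>' \<subseteq> cball 0 R"
    using polytope_uniformly_bounded[OF P J b ne] by blast
  have "simple_polytope P J \<eta> \<kappa>'" if k: "near J (min 1 \<epsilon>) \<kappa> \<kappa>'" for \<kappa>'
  proof -
    have k1: "near J 1 \<kappa> \<kappa>'" and ke: "near J \<epsilon> \<kappa> \<kappa>'"
      using near_mono[OF k] by auto
    have "int (card (active J \<eta> \<kappa>' v)) = aff_dim P" if v: "v extreme_point_of polytope_at P J \<eta> \<kappa>'" for v
    proof -
      have AJ: "active J \<eta> \<kappa>' v \<subseteq> J" by (auto simp: active_def)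
      have "v \<in> face P J \<eta> \<kappa>' (active J \<eta> \<kappa>' v)"
        using v AJ by (simp add: mem_face_iff extreme_point_of_def)
      then have "face P J \<eta> \<kappa> (active J \<eta> \<kappa>' v) \<noteq> {}" using faces[OF ke AJ] by blast
      then obtain u where u: "u extreme_point_of ?D"
        "u \<in> face P J \<eta> \<kappa> (active J \<eta> \<kappa>' v)"
        using extreme_point_of_face_exists[OF P J AJ b] by blast
      then have "active J \<eta> \<kappa>' v \<subseteq> active J \<eta> \<kappa> u" using AJ by (simp add: mem_face_iff)
      then have "card (active J \<eta> \<kappa>' v) \<le> card (active J \<eta> \<kappa> u)"
        using J by (intro card_mono) (auto simp: active_def)
      then show ?thesis
        using c[OF u(1)] card_active_extreme_ge[OF P J v] by simp
    qed
    moreover have "bounded (polytope_at P J \<eta> \<kappa>')"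
      using R[OF k1] bounded_cball bounded_subset by blast
    moreover have "polytope_at P J \<eta> \<kappa>' \<noteq> {}"
      using faces[OF ke, of "{}"] ne by simp
    moreover have "\<forall>i\<in>J. face P J \<eta> \<kappa>' {i} \<noteq> {}"
      using faces[OF ke] fne by simp
    ultimately show ?thesis using simple_polytope_iff[OF P Pne J] by blast
  qed
  moreover have "near J \<epsilon> \<kappa> \<kappa>'" if "near J (min 1 \<epsilon>) \<kappa> \<kappa>'" for \<kappa>'
    using near_mono[OF that] by auto
  ultimately show ?thesis
    using e faces by (intro exI[of _ "min 1 \<epsilon>"]) auto
qed

section \<open>Polynomial functions of the support numbers\<close>

text \<open>Polynomial functions of finitely many of the coordinates of a tuple.\<close>

inductive polyfun :: "(('i \<Rightarrow> real) \<Rightarrow> real) \<Rightarrow> bool" where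
  polyfun_const: "polyfun (\<lambda>\<kappa>. c)"
| polyfun_add: "polyfun Q \<Longrightarrow> polyfun R \<Longrightarrow> polyfun (\<lambda>\<kappa>. Q \<kappa> + R \<kappa>)"
| polyfun_coord_mult: "polyfun Q \<Longrightarrow> polyfun (\<lambda>\<kappa>. \<kappa> j * Q \<kappa>)"

lemma polyfun_coord: "polyfun (\<lambda>\<kappa>. \<kappa> j)"
  using polyfun_coord_mult[OF polyfun_const[of 1]] by simp

lemma polyfun_cmult: "polyfun Q \<Longrightarrow> polyfun (\<lambda>\<kappa>. c * Q \<kappa>)"
proof (induction rule: polyfun.induct)
  case (polyfun_const d)
  show ?case by (rule polyfun.polyfun_const)
next
  case (polyfun_add Q R)
  then show ?case using polyfun.polyfun_add by (simp add: distrib_left)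
next
  case (polyfun_coord_mult Q j)
  then show ?case
    using polyfun.polyfun_coord_mult[of "\<lambda>\<kappa>. c * Q \<kappa>" j] by (simp add: mult.left_commute)
qed

lemma polyfun_mult: "polyfun Q \<Longrightarrow> polyfun R \<Longrightarrow> polyfun (\<lambda>\<kappa>. Q \<kappa> * R \<kappa>)"
proof (induction rule: polyfun.induct)
  case (polyfun_const d)
  then show ?case by (rule polyfun_cmult)
next
  case (polyfun_add Q S)
  then show ?case
    using polyfun.polyfun_add[of "\<lambda>\<kappa>. Q \<kappa> * R \<kappa>" "\<lambda>\<kappa>. S \<kappa> * R \<kappa>"]
    by (simp add: distrib_right)
next
  case (polyfun_coord_mult Q j)
  then show ?case
    using polyfun.polyfun_coord_mult[of "\<lambda>\<kappa>. Q \<kappa> * R \<kappa>" j] by (simp add: mult.assoc)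
qed

lemma polyfun_diff: "polyfun Q \<Longrightarrow> polyfun R \<Longrightarrow> polyfun (\<lambda>\<kappa>. Q \<kappa> - R \<kappa>)"
  using polyfun_add[OF _ polyfun_cmult[of R "-1"]] by simp

lemma polyfun_sum:
  assumes "\<And>j. j \<in> J \<Longrightarrow> polyfun (Q j)"
  shows "polyfun (\<lambda>\<kappa>. \<Sum>j\<in>J. Q j \<kappa>)"
  using assms
  by (induction J rule: infinite_finite_induct) (auto intro: polyfun_const polyfun_add)

lemma polyfun_subst:
  assumes "polyfun Q" and "\<And>j. polyfun (\<lambda>\<kappa>. \<phi> \<kappa> j)"
  shows "polyfun (\<lambda>\<kappa>. Q (\<phi> \<kappa>))"
  using assms(1)
  by (induction rule: polyfun.induct) (auto intro: polyfun_const polyfun_add polyfun_mult assms(2))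

lemma polyfun_fun_upd:
  assumes "polyfun Q"
  shows "polyfun (\<lambda>\<kappa>. Q (\<kappa>(i := c)))"
proof (rule polyfun_subst[OF assms])
  show "polyfun (\<lambda>\<kappa>. (\<kappa>(i := c)) j)" for j
    by (cases "j = i") (auto intro: polyfun_const polyfun_coord)
qed

lemma polyfun_line:
  assumes "polyfun Q"
  shows "\<exists>q. \<forall>t. Q (\<lambda>j. a j + t * b j) = poly q t"
  using assms
proof (induction rule: polyfun.induct)
  case (polyfun_const c)
  show ?case by (intro exI[of _ "[:c:]"]) simp
next
  case (polyfun_add Q R)
  then obtain q r where "\<forall>t. Q (\<lambda>j. a j + t * b j) = poly q t"
    "\<forall>t. R (\<lambda>j. a j + t * b j) = poly r t" by blast
  then show ?case by (intro exI[of _ "q + r"]) simp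
next
  case (polyfun_coord_mult Q j)
  then obtain q where "\<forall>t. Q (\<lambda>j. a j + t * b j) = poly q t" by blast
  then show ?case by (intro exI[of _ "[:a j, b j:] * q"]) (simp add: algebra_simps)
qed

text \<open>A polynomial vanishing on a ball vanishes on every line through its centre, hence
  everywhere.\<close>

lemma polyfun_zero_if_zero_near:
  assumes Q: "polyfun Q" and J: "finite J" and \<delta>: "\<delta> > 0"
    and z: "\<And>\<kappa>'. near J \<delta> \<kappa> \<kappa>' \<Longrightarrow> Q \<kappa>' = 0"
  shows "Q \<kappa>'' = 0"
proof -
  obtain q where q: "\<And>t. Q (\<lambda>j. \<kappa> j + t * (\<kappa>'' j - \<kappa> j)) = poly q t"
    using polyfun_line[OF Q, of \<kappa> "\<lambda>j. \<kappa>'' j - \<kappa> j"] by blast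
  define c where "c = (\<Sum>j\<in>J. \<bar>\<kappa>'' j - \<kappa> j\<bar>)"
  have c0: "c \<ge> 0" unfolding c_def by (intro sum_nonneg) auto
  have "poly q t = 0" if t: "0 < t" "t < \<delta> / (c + 1)" for t
  proof -
    have "near J \<delta> \<kappa> (\<lambda>j. \<kappa> j + t * (\<kappa>'' j - \<kappa> j))"
      unfolding near_def
    proof
      fix j assume j: "j \<in> J"
      have "\<bar>\<kappa>'' j - \<kappa> j\<bar> \<le> c"
        unfolding c_def using member_le_sum[OF j _ J, of "\<lambda>j. \<bar>\<kappa>'' j - \<kappa> j\<bar>"] by simp
      then have "t * \<bar>\<kappa>'' j - \<kappa> j\<bar> \<le> t * (c + 1)"
        using t by (intro mult_left_mono) auto
      also have "\<dots> < \<delta>" using t c0 by (simp add: field_simps)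
      finally show "\<bar>\<kappa> j + t * (\<kappa>'' j - \<kappa> j) - \<kappa> j\<bar> < \<delta>" using t by (simp add: abs_mult)
    qed
    then show ?thesis using z q[of t] by simp
  qed
  then have "{0<..<\<delta> / (c + 1)} \<subseteq> {t. poly q t = 0}" by auto
  moreover have "infinite {0<..<\<delta> / (c + 1)}" using \<delta> c0 by (simp add: infinite_Ioo)
  ultimately have "q = 0" using poly_roots_finite finite_subset by blast
  then show ?thesis using q[of 1] by simp
qed

text \<open>The powers \<open>s ^ k\<close> make the statement inductive: multiplication by the coordinate \<open>i\<close> raises
  \<open>k\<close>.\<close>

lemma polyfun_primitive:
  assumes "polyfun Q"
  shows "\<exists>R. polyfun R \<and>
    (\<forall>\<kappa> s. ((\<lambda>s. R (\<kappa>(i := s))) has_real_derivative Q (\<kappa>(i := s))) (at s))"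
proof -
  have "\<exists>R. polyfun R \<and>
    (\<forall>\<kappa> s. ((\<lambda>s. R (\<kappa>(i := s))) has_real_derivative s ^ k * Q (\<kappa>(i := s))) (at s))" for k
    using assms
  proof (induction arbitrary: k rule: polyfun.induct)
    case (polyfun_const c)
    have pw: "polyfun (\<lambda>\<kappa>. \<kappa> i ^ n)" for n
      by (induction n) (auto intro: polyfun.polyfun_const polyfun.polyfun_coord_mult)
    have "((\<lambda>s. c / real (Suc k) * s ^ Suc k) has_real_derivative s ^ k * c) (at s)" for s
      by (rule derivative_eq_intros refl | simp)+
    then show ?case
      by (intro exI[of _ "\<lambda>\<kappa>. c / real (Suc k) * \<kappa> i ^ Suc k"] conjI polyfun_cmult pw) simp
  next
    case (polyfun_add Q R)
    then obtain A B where "polyfun A" "polyfun B"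
      "\<And>\<kappa> s. ((\<lambda>s. A (\<kappa>(i := s))) has_real_derivative s ^ k * Q (\<kappa>(i := s))) (at s)"
      "\<And>\<kappa> s. ((\<lambda>s. B (\<kappa>(i := s))) has_real_derivative s ^ k * R (\<kappa>(i := s))) (at s)"
      by meson
    then show ?case
      by (intro exI[of _ "\<lambda>\<kappa>. A \<kappa> + B \<kappa>"] conjI allI polyfun.polyfun_add)
        (auto simp only: distrib_left intro: DERIV_add)
  next
    case (polyfun_coord_mult Q j)
    show ?case
    proof (cases "j = i")
      case True
      obtain A where "polyfun A"
        "\<And>\<kappa> s. ((\<lambda>s. A (\<kappa>(i := s))) has_real_derivative s ^ Suc k * Q (\<kappa>(i := s))) (at s)"
        using polyfun_coord_mult.IH[of "Suc k"] by blast
      then show ?thesis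
        using True by (intro exI[of _ A]) (simp add: power_Suc2 mult.assoc del: fun_upd_apply power_Suc, simp)
    next
      case False
      obtain A where "polyfun A"
        "\<And>\<kappa> s. ((\<lambda>s. A (\<kappa>(i := s))) has_real_derivative s ^ k * Q (\<kappa>(i := s))) (at s)"
        using polyfun_coord_mult.IH[of k] by blast
      then have "((\<lambda>s. (\<kappa>(i := s)) j * A (\<kappa>(i := s))) has_real_derivative
          s ^ k * ((\<kappa>(i := s)) j * Q (\<kappa>(i := s)))) (at s)" for \<kappa> s
        using False DERIV_cmult[of "\<lambda>s. A (\<kappa>(i := s))" "s ^ k * Q (\<kappa>(i := s))" s UNIV "\<kappa> j"]
        by (simp add: mult.left_commute)
      then show ?thesis
        using \<open>polyfun A\<close> by (intro exI[of _ "\<lambda>\<kappa>. \<kappa> j * A \<kappa>"] conjI allI polyfun.polyfun_coord_mult)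
    qed
  qed
  from this[of 0] show ?thesis by simp
qed

section \<open>Lebesgue measure on affine subspaces\<close>

text \<open>Lebesgue measure on coordinate vectors of length \<open>k\<close>.\<close>

abbreviation coord_lborel :: "nat \<Rightarrow> (nat \<Rightarrow> real) measure" where
  "coord_lborel k \<equiv> \<Pi>\<^sub>M i\<in>{..<k}. lborel"

text \<open>The point of an affine space with given coordinates in the frame \<open>b\<close> based at \<open>p\<close>; only
  the first \<open>k\<close> coordinates and frame vectors are used.\<close>

definition frame_map :: "nat \<Rightarrow> 'a::euclidean_space \<Rightarrow> (nat \<Rightarrow> 'a) \<Rightarrow> (nat \<Rightarrow> real) \<Rightarrow> 'a" where
  "frame_map k p b y = p + (\<Sum>i<k. y i *\<^sub>R b i)"

text \<open>The first \<open>k\<close> vectors of a sequence are orthonormal.\<close>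

abbreviation orthonormal :: "nat \<Rightarrow> (nat \<Rightarrow> 'a::euclidean_space) \<Rightarrow> bool" where
  "orthonormal k b \<equiv> (\<forall>i<k. \<forall>j<k. b i \<bullet> b j = (if i = j then 1 else 0))"

text \<open>An orthonormal frame of \<open>P\<close>, with its length \<open>k\<close> explicit; by \<open>oframe_aff_dim\<close> below the
  length is the dimension of \<open>P\<close>.\<close>

definition oframe :: "nat \<Rightarrow> 'a::euclidean_space \<Rightarrow> (nat \<Rightarrow> 'a) \<Rightarrow> 'a set \<Rightarrow> bool" where
  "oframe k p b P \<longleftrightarrow> orthonormal k b \<and> P = range (frame_map k p b)"

lemma orthonormal_frame_iff: "orthonormal_frame P (p, b) \<longleftrightarrow> oframe (nat (aff_dim P)) p b P"
  unfolding orthonormal_frame_def oframe_def frame_map_def by auto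

lemma frame_map_measurable [measurable]: "frame_map k p b \<in> borel_measurable (coord_lborel k)"
  unfolding frame_map_def by measurable

lemma frame_map_base: "frame_map k p b y = p + frame_map k 0 b y"
  unfolding frame_map_def by simp

lemma frame_map_affine:
  "frame_map k 0 b c + \<sigma> *\<^sub>R frame_map k 0 b y = frame_map k 0 b (\<lambda>i. c i + \<sigma> * y i)"
  unfolding frame_map_def by (simp add: scaleR_add_left sum.distrib scaleR_sum_right)

lemma frame_map_restrict: "frame_map k p b (\<lambda>i\<in>{..<k}. y i) = frame_map k p b y"
  unfolding frame_map_def by simp

lemma frame_map_unit:
  assumes "j < k"
  shows "frame_map k 0 b (\<lambda>i. if i = j then 1 else 0) = b j"
proof -
  have "frame_map k 0 b (\<lambda>i. if i = j then 1 else 0) = (\<Sum>i<k. if i = j then b i else 0)"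
    unfolding frame_map_def add_0 by (rule sum.cong) auto
  then show ?thesis using assms by simp
qed

lemma frame_inner:
  assumes "orthonormal k b" "j < k"
  shows "b j \<bullet> frame_map k 0 b y = y j"
proof -
  have "b j \<bullet> frame_map k 0 b y = (\<Sum>i<k. y i * (b j \<bullet> b i))"
    by (simp add: frame_map_def inner_sum_right)
  also have "\<dots> = (\<Sum>i<k. if i = j then y i else 0)"
    using assms by (intro sum.cong) auto
  also have "\<dots> = y j" using assms by simp
  finally show ?thesis .
qed

lemma norm_frame_map:
  assumes "orthonormal k b"
  shows "(norm (frame_map k 0 b y))\<^sup>2 = (\<Sum>i<k. (y i)\<^sup>2)"
proof -
  have "(norm (frame_map k 0 b y))\<^sup>2 = (\<Sum>i<k. y i *\<^sub>R b i) \<bullet> frame_map k 0 b y"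
    by (simp add: power2_norm_eq_inner frame_map_def)
  also have "\<dots> = (\<Sum>i<k. y i * (b i \<bullet> frame_map k 0 b y))"
    by (simp add: inner_sum_left)
  also have "\<dots> = (\<Sum>i<k. (y i)\<^sup>2)"
    using frame_inner[OF assms] by (intro sum.cong) (auto simp: power2_eq_square)
  finally show ?thesis .
qed

lemma oframe_directions: "oframe k p b P \<Longrightarrow> directions P = range (frame_map k 0 b)"
proof -
  assume o: "oframe k p b P"
  have "frame_map k p b y - frame_map k p b z = frame_map k 0 b (\<lambda>i. y i - z i)" for y z
    by (simp add: frame_map_def scaleR_diff_left sum_subtractf)
  moreover have "frame_map k 0 b y = frame_map k p b y - frame_map k p b (\<lambda>i. 0)" for y
    by (simp add: frame_map_def)
  ultimately show ?thesis
    using o unfolding directions_def oframe_def by blast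
qed

lemma oframe_base: "oframe k p b P \<Longrightarrow> p \<in> P"
  unfolding oframe_def frame_map_def by (auto intro!: image_eqI[of _ _ "\<lambda>_. 0"])

lemma oframe_aff_dim:
  assumes "oframe k p b P" "affine P"
  shows "aff_dim P = int k"
proof -
  have on: "orthonormal k b"
    using assms by (simp add: oframe_def)
  have dual: "\<forall>i\<in>{..<k}. \<forall>j\<in>{..<k}. b j \<bullet> b i = (if j = i then 1 else 0)"
    using on by auto
  note ind = independent_dual[OF finite_lessThan dual subset_refl]
  have "directions P = span (b ` {..<k})"
  proof
    show "directions P \<subseteq> span (b ` {..<k})"
      unfolding oframe_directions[OF assms(1)] frame_map_def
      by (auto intro!: span_sum intro: span_scale span_base)
    have "b ` {..<k} \<subseteq> directions P"
    proof
      fix x assume "x \<in> b ` {..<k}"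
      then obtain j where j: "j < k" "x = b j" by blast
      then show "x \<in> directions P"
        unfolding oframe_directions[OF assms(1)] using frame_map_unit[of j k b] by (metis rangeI)
    qed
    then show "span (b ` {..<k}) \<subseteq> directions P"
      using subspace_directions[OF assms(2)] oframe_base[OF assms(1)] span_minimal by blast
  qed
  then have "dim (directions P) = k"
    using dim_span_eq_card_independent[OF ind(1)] ind(2) by simp
  then show ?thesis
    using aff_dim_directions[OF assms(2)] oframe_base[OF assms(1)] by auto
qed

lemma orthonormal_basis_enum:
  fixes L :: "'a::euclidean_space set"
  assumes "subspace L"
  shows "\<exists>b. orthonormal (dim L) b \<and>
    L = range (frame_map (dim L) 0 b)"
proof -
  obtain B where B: "B \<subseteq> L" "pairwise orthogonal B" "\<And>x. x \<in> B \<Longrightarrow> norm x = 1"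
    "independent B" "card B = dim L" "span B = L"
    using orthonormal_basis_subspace[OF assms] by metis
  have fB: "finite B" using B(4) independent_imp_finite by blast
  obtain b where b: "bij_betw b {0..<card B} B"
    using ex_bij_betw_nat_finite[OF fB] by blast
  then have b': "bij_betw b {..<dim L} B"
    using B(5) by (simp add: atLeast0LessThan)
  then have inj: "inj_on b {..<dim L}" and im: "b ` {..<dim L} = B"
    by (auto simp: bij_betw_def)
  have on: "b i \<bullet> b j = (if i = j then 1 else 0)" if "i < dim L" "j < dim L" for i j
  proof (cases "i = j")
    case True
    have "b j \<in> B" using im that by blast
    then have "norm (b j) = 1" using B(3) by blast
    then show ?thesis using True by (simp add: norm_eq_1)
  next
    case False
    have "b i \<noteq> b j" using inj that False by (auto simp: inj_on_def)
    moreover have "b i \<in> B" "b j \<in> B" using im that by auto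
    ultimately show ?thesis
      using B(2) False unfolding pairwise_def orthogonal_def by simp
  qed
  have "range (frame_map (dim L) 0 b) = L"
  proof
    have "y i *\<^sub>R b i \<in> L" if "i < dim L" for i y
      using im that B(1) assms by (intro subspace_scale) auto
    then show "range (frame_map (dim L) 0 b) \<subseteq> L"
      unfolding frame_map_def using assms by (auto intro!: subspace_sum)
    show "L \<subseteq> range (frame_map (dim L) 0 b)"
    proof
      fix x assume "x \<in> L"
      then have "x \<in> range (\<lambda>u. \<Sum>v\<in>B. u v *\<^sub>R v)"
        using B(6) span_finite[OF fB] by simp
      then obtain u where "x = (\<Sum>v\<in>B. u v *\<^sub>R v)" by blast
      also have "\<dots> = (\<Sum>i<dim L. u (b i) *\<^sub>R b i)"
        unfolding im[symmetric] using sum.reindex[OF inj, of "\<lambda>v. u v *\<^sub>R v"] by simp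
      finally show "x \<in> range (frame_map (dim L) 0 b)"
        unfolding frame_map_def by (auto intro!: image_eqI[of _ _ "\<lambda>i. u (b i)"])
    qed
  qed
  then show ?thesis using on by (intro exI[of _ b]) auto
qed

lemma oframe_exists:
  assumes "affine P" "p \<in> P"
  shows "\<exists>b. oframe (nat (aff_dim P)) p b P"
proof -
  have "subspace (directions P)" "nat (aff_dim P) = dim (directions P)"
    using assms subspace_directions aff_dim_directions by force+
  then obtain b where b: "orthonormal (nat (aff_dim P)) b"
    "directions P = range (frame_map (nat (aff_dim P)) 0 b)"
    using orthonormal_basis_enum by metis
  have "P = (\<lambda>d. p + d) ` directions P"
    using directions_eq[OF assms] by (simp add: image_image)
  also have "\<dots> = range (frame_map (nat (aff_dim P)) p b)"
    unfolding b(2) image_image frame_map_base[of _ p, symmetric] ..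
  finally show ?thesis using b(1) unfolding oframe_def by blast
qed

text \<open>Invariance of the coordinate measure under translations and the reflection.\<close>

lemma coord_lborel_reflect:
  assumes "\<bar>\<sigma>\<bar> = 1"
  shows "distr (coord_lborel k) (coord_lborel k) (\<lambda>y. \<lambda>i\<in>{..<k}. c i + \<sigma> * y i) = coord_lborel k"
proof -
  let ?D = "distr (coord_lborel k) (coord_lborel k) (\<lambda>y. \<lambda>i\<in>{..<k}. c i + \<sigma> * y i)"
  interpret product_sigma_finite "\<lambda>_::nat. lborel :: real measure" by standard
  have \<sigma>: "\<sigma> \<noteq> 0" using assms by auto
  have lb: "distr lborel borel (\<lambda>x. t + \<sigma> * x) = lborel" for t
  proof -
    have "lborel = density (distr lborel borel (\<lambda>x. t + \<sigma> * x)) (\<lambda>_. 1)"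
      using lborel_real_affine[OF \<sigma>, of t] assms by simp
    then show ?thesis by (simp add: density_1)
  qed
  have m: "(\<lambda>y. \<lambda>i\<in>{..<k}. c i + \<sigma> * y i) \<in> measurable (coord_lborel k) (coord_lborel k)"
    by measurable
  show ?thesis
  proof (rule PiM_eqI)
    show "finite {..<k}" by simp
    show "sets ?D = sets (coord_lborel k)"
      by simp
    fix A :: "nat \<Rightarrow> real set" assume A: "\<And>i. i \<in> {..<k} \<Longrightarrow> A i \<in> sets lborel"
    let ?B = "\<lambda>i. (\<lambda>x. c i + \<sigma> * x) -` A i"
    have B: "?B i \<in> sets lborel" if "i \<in> {..<k}" for i
    proof -
      have "(\<lambda>x. c i + \<sigma> * x) \<in> borel_measurable borel" by measurable
      from measurable_sets[OF this, of "A i"] show ?thesis using A[OF that] by simp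
    qed
    have PA: "Pi\<^sub>E {..<k} A \<in> sets (coord_lborel k)"
      using A by (intro sets_PiM_I_finite) auto
    have "(\<lambda>y. \<lambda>i\<in>{..<k}. c i + \<sigma> * y i) -` Pi\<^sub>E {..<k} A \<inter> space (coord_lborel k) = Pi\<^sub>E {..<k} ?B"
      by (auto simp: space_PiM PiE_iff)
    then have "emeasure ?D (Pi\<^sub>E {..<k} A)
      = emeasure (coord_lborel k) (Pi\<^sub>E {..<k} ?B)"
      using emeasure_distr[OF m PA] by simp
    also have "\<dots> = (\<Prod>i<k. emeasure lborel (?B i))"
      using B by (intro emeasure_PiM) auto
    also have "\<dots> = (\<Prod>i<k. emeasure lborel (A i))"
    proof (rule prod.cong[OF refl])
      fix i assume i: "i \<in> {..<k}"
      have "emeasure lborel (A i) = emeasure (distr lborel borel (\<lambda>x. c i + \<sigma> * x)) (A i)"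
        by (simp add: lb)
      also have "\<dots> = emeasure lborel (?B i)"
        using A[OF i] by (subst emeasure_distr) auto
      finally show "emeasure lborel (?B i) = emeasure lborel (A i)" by simp
    qed
    finally show "emeasure ?D (Pi\<^sub>E {..<k} A)
      = (\<Prod>i\<in>{..<k}. emeasure lborel (A i))" .
  qed
qed

lemma nn_integral_frame_reflect:
  fixes g :: "'a::euclidean_space \<Rightarrow> ennreal"
  assumes [measurable]: "g \<in> borel_measurable borel" and "\<bar>\<sigma>\<bar> = 1" and u: "u \<in> range (frame_map k 0 b)"
  shows "(\<integral>\<^sup>+y. g (u + \<sigma> *\<^sub>R frame_map k 0 b y) \<partial>coord_lborel k) = (\<integral>\<^sup>+y. g (frame_map k 0 b y) \<partial>coord_lborel k)"
proof -
  obtain c where c: "u = frame_map k 0 b c" using u by blast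
  have "(\<integral>\<^sup>+y. g (frame_map k 0 b y) \<partial>coord_lborel k)
    = (\<integral>\<^sup>+y. g (frame_map k 0 b y) \<partial>distr (coord_lborel k) (coord_lborel k) (\<lambda>y. \<lambda>i\<in>{..<k}. c i + \<sigma> * y i))"
    by (simp add: coord_lborel_reflect[OF assms(2)])
  also have "\<dots> = (\<integral>\<^sup>+y. g (frame_map k 0 b (\<lambda>i\<in>{..<k}. c i + \<sigma> * y i)) \<partial>coord_lborel k)"
    by (rule nn_integral_distr) measurable
  also have "\<dots> = (\<integral>\<^sup>+y. g (u + \<sigma> *\<^sub>R frame_map k 0 b y) \<partial>coord_lborel k)"
    unfolding frame_map_restrict c frame_map_affine ..
  finally show ?thesis by simp
qed

lemma emeasure_coord_box:
  assumes "0 \<le> r"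
  shows "emeasure (coord_lborel k) (Pi\<^sub>E {..<k} (\<lambda>_. {-r..r})) = ennreal ((2 * r) ^ k)"
proof -
  interpret product_sigma_finite "\<lambda>_::nat. lborel :: real measure" by standard
  have "emeasure (coord_lborel k) (Pi\<^sub>E {..<k} (\<lambda>_. {-r..r})) = (\<Prod>i<k. emeasure lborel {-r..r})"
    by (intro emeasure_PiM) auto
  also have "\<dots> = ennreal ((2 * r) ^ k)"
    using assms by (simp add: ennreal_power)
  finally show ?thesis .
qed

text \<open>Two orthonormal frames spanning the same linear subspace induce the same measure on it:
  both measures are invariant under translations and the reflection, so that they are
  proportional by Fubini's theorem, and they agree on the unit ball.\<close>

lemma nn_integral_frame_indep:
  fixes f :: "'a::euclidean_space \<Rightarrow> ennreal"
  assumes f[measurable]: "f \<in> borel_measurable borel"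
    and b: "orthonormal k b"
    and b': "orthonormal k b'"
    and r: "range (frame_map k 0 b) = range (frame_map k 0 b')"
  shows "(\<integral>\<^sup>+y. f (frame_map k 0 b y) \<partial>coord_lborel k) = (\<integral>\<^sup>+y. f (frame_map k 0 b' y) \<partial>coord_lborel k)"
proof -
  interpret product_sigma_finite "\<lambda>_::nat. lborel :: real measure" by standard
  interpret finite_product_sigma_finite "\<lambda>_::nat. lborel :: real measure" "{..<k}" by standard simp
  interpret pair_sigma_finite "coord_lborel k" "coord_lborel k" by standard
  let ?M = "coord_lborel k" and ?\<phi> = "frame_map k 0 b" and ?\<psi> = "frame_map k 0 b'"
  define g :: "'a \<Rightarrow> ennreal" where "g = indicator (ball 0 1)"
  have g[measurable]: "g \<in> borel_measurable borel" unfolding g_def by (rule borel_measurable_indicator) simp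
  have neg: "- ?\<psi> z \<in> range ?\<phi>" for z
  proof -
    have "- ?\<psi> z = ?\<psi> (\<lambda>i. - z i)" by (simp add: frame_map_def sum_negf)
    then show ?thesis unfolding r by blast
  qed
  have pos: "?\<phi> y \<in> range ?\<psi>" for y
    unfolding r[symmetric] by (rule rangeI)
  have "(\<integral>\<^sup>+y. f (?\<phi> y) \<partial>?M) * (\<integral>\<^sup>+z. g (?\<psi> z) \<partial>?M)
    = (\<integral>\<^sup>+y. f (?\<phi> y) * (\<integral>\<^sup>+z. g (?\<psi> z) \<partial>?M) \<partial>?M)"
    by (rule nn_integral_multc[symmetric]) measurable
  also have "\<dots> = (\<integral>\<^sup>+y. (\<integral>\<^sup>+z. f (?\<phi> y) * g (?\<phi> y + ?\<psi> z) \<partial>?M) \<partial>?M)"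
  proof (rule nn_integral_cong)
    fix y
    have "(\<integral>\<^sup>+z. g (?\<psi> z) \<partial>?M) = (\<integral>\<^sup>+z. g (?\<phi> y + 1 *\<^sub>R ?\<psi> z) \<partial>?M)"
      using nn_integral_frame_reflect[OF g _ pos[of y], of 1] by simp
    also have "f (?\<phi> y) * \<dots> = (\<integral>\<^sup>+z. f (?\<phi> y) * g (?\<phi> y + ?\<psi> z) \<partial>?M)"
      by (subst nn_integral_cmult) auto
    finally show "f (?\<phi> y) * (\<integral>\<^sup>+z. g (?\<psi> z) \<partial>?M) = \<dots>" .
  qed
  also have "\<dots> = (\<integral>\<^sup>+z. (\<integral>\<^sup>+y. f (?\<phi> y) * g (?\<phi> y + ?\<psi> z) \<partial>?M) \<partial>?M)"
    by (rule Fubini') measurable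
  also have "\<dots> = (\<integral>\<^sup>+z. (\<integral>\<^sup>+y. f (?\<phi> y - ?\<psi> z) * g (?\<phi> y) \<partial>?M) \<partial>?M)"
  proof (rule nn_integral_cong)
    fix z
    have "(\<lambda>x. f x * g (x + ?\<psi> z)) \<in> borel_measurable borel" by measurable
    from nn_integral_frame_reflect[OF this, of 1, OF _ neg[of z]]
    show "(\<integral>\<^sup>+y. f (?\<phi> y) * g (?\<phi> y + ?\<psi> z) \<partial>?M) = (\<integral>\<^sup>+y. f (?\<phi> y - ?\<psi> z) * g (?\<phi> y) \<partial>?M)"
      by simp
  qed
  also have "\<dots> = (\<integral>\<^sup>+y. (\<integral>\<^sup>+z. f (?\<phi> y - ?\<psi> z) * g (?\<phi> y) \<partial>?M) \<partial>?M)"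
    by (rule Fubini'[symmetric]) measurable
  also have "\<dots> = (\<integral>\<^sup>+y. (\<integral>\<^sup>+z. f (?\<psi> z) \<partial>?M) * g (?\<phi> y) \<partial>?M)"
  proof (rule nn_integral_cong)
    fix y
    have "(\<integral>\<^sup>+z. f (?\<psi> z) \<partial>?M) = (\<integral>\<^sup>+z. f (?\<phi> y - ?\<psi> z) \<partial>?M)"
      using nn_integral_frame_reflect[OF f _ pos[of y], of "-1"] by simp
    then show "(\<integral>\<^sup>+z. f (?\<phi> y - ?\<psi> z) * g (?\<phi> y) \<partial>?M) = (\<integral>\<^sup>+z. f (?\<psi> z) \<partial>?M) * g (?\<phi> y)"
      by (subst nn_integral_multc) auto
  qed
  also have "\<dots> = (\<integral>\<^sup>+z. f (?\<psi> z) \<partial>?M) * (\<integral>\<^sup>+y. g (?\<phi> y) \<partial>?M)"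
    by (rule nn_integral_cmult) measurable
  finally have proportional: "(\<integral>\<^sup>+y. f (?\<phi> y) \<partial>?M) * (\<integral>\<^sup>+z. g (?\<psi> z) \<partial>?M)
    = (\<integral>\<^sup>+z. f (?\<psi> z) \<partial>?M) * (\<integral>\<^sup>+y. g (?\<phi> y) \<partial>?M)" .
  define U where "U = {y \<in> space ?M. (\<Sum>i<k. (y i)\<^sup>2) < 1}"
  have U[measurable]: "U \<in> sets ?M" unfolding U_def by measurable
  have ballU: "(\<integral>\<^sup>+y. g (frame_map k 0 c y) \<partial>?M) = emeasure ?M U"
    if "orthonormal k c" for c
  proof -
    have "norm (frame_map k 0 c y) < 1 \<longleftrightarrow> (\<Sum>i<k. (y i)\<^sup>2) < 1" for y
      unfolding norm_frame_map[OF that, symmetric] by (simp add: power_less_one_iff)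
    then have "(\<integral>\<^sup>+y. g (frame_map k 0 c y) \<partial>?M) = (\<integral>\<^sup>+y. indicator U y \<partial>?M)"
      unfolding g_def U_def by (intro nn_integral_cong) (auto simp: indicator_def)
    then show ?thesis by simp
  qed
  have "emeasure ?M U \<noteq> 0"
  proof
    assume 0: "emeasure ?M U = 0"
    \<comment> \<open>The cube of half-width \<open>s\<close> lies in the unit ball, as \<open>k s\<^sup>2 < 1\<close>.\<close>
    define s where "s = 1 / (real k + 1)"
    have s: "0 < s" "s \<le> 1" by (auto simp: s_def)
    have "Pi\<^sub>E {..<k} (\<lambda>_. {-s..s}) \<subseteq> U"
    proof
      fix y assume y: "y \<in> Pi\<^sub>E {..<k} (\<lambda>_. {-s..s})"
      have "(\<Sum>i<k. (y i)\<^sup>2) \<le> (\<Sum>i<k. s * 1)"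
      proof (rule sum_mono)
        fix i assume "i \<in> {..<k}"
        then have "- s \<le> y i" "y i \<le> s" using y by (auto simp: PiE_iff)
        then have "\<bar>y i\<bar> \<le> s" by (simp add: abs_le_iff)
        then have "(y i)\<^sup>2 \<le> s\<^sup>2" using s by (simp add: abs_le_square_iff[symmetric])
        also have "\<dots> \<le> s * 1" unfolding power2_eq_square using s by (intro mult_left_mono) auto
        finally show "(y i)\<^sup>2 \<le> s * 1" .
      qed
      also have "\<dots> < 1" by (simp add: s_def)
      finally show "y \<in> U" using y by (auto simp: U_def space_PiM PiE_iff)
    qed
    then have "emeasure ?M (Pi\<^sub>E {..<k} (\<lambda>_. {-s..s})) \<le> emeasure ?M U"
      by (rule emeasure_mono) (rule U)
    then show False
      using emeasure_coord_box[of s k] s 0 by simp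
  qed
  moreover have "emeasure ?M U \<noteq> \<infinity>"
  proof -
    have "U \<subseteq> Pi\<^sub>E {..<k} (\<lambda>_. {-1..1})"
    proof
      fix y assume y: "y \<in> U"
      have "\<bar>y i\<bar> \<le> 1" if i: "i < k" for i
      proof -
        have "(y i)\<^sup>2 \<le> (\<Sum>i<k. (y i)\<^sup>2)"
          using i by (intro member_le_sum) auto
        then have "(y i)\<^sup>2 \<le> 1" using y by (simp add: U_def)
        then show ?thesis by (simp add: abs_square_le_1)
      qed
      then show "y \<in> Pi\<^sub>E {..<k} (\<lambda>_. {-1..1})"
        using y by (auto simp: U_def space_PiM PiE_iff abs_le_iff) 
    qed
    then have "emeasure ?M U \<le> emeasure ?M (Pi\<^sub>E {..<k} (\<lambda>_. {-1..1}))"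
      by (rule emeasure_mono) (auto intro!: sets_PiM_I_finite)
    also have "\<dots> < \<infinity>" using emeasure_coord_box[of 1 k] by simp
    finally show ?thesis by simp
  qed
  ultimately show ?thesis
    using proportional unfolding ballU[OF b] ballU[OF b']
    by (simp add: mult.commute[of _ "emeasure ?M U"] ennreal_mult_cancel_left)
qed

lemma distr_frame_indep:
  assumes o: "oframe k p b P" "oframe k p' b' P"
  shows "distr (coord_lborel k) borel (frame_map k p b) = distr (coord_lborel k) borel (frame_map k p' b')"
proof (rule measure_eqI)
  fix A assume "A \<in> sets (distr (coord_lborel k) borel (frame_map k p b))"
  then have A[measurable]: "A \<in> sets borel" by simp
  have r: "range (frame_map k 0 b) = range (frame_map k 0 b')"
    using oframe_directions[OF o(1)] oframe_directions[OF o(2)] by simp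
  have u: "p - p' \<in> range (frame_map k 0 b')"
    using oframe_directions[OF o(2)] diff_in_directions[OF oframe_base[OF o(1)] oframe_base[OF o(2)]]
    by simp
  have e: "emeasure (distr (coord_lborel k) borel (frame_map k q c)) A
    = (\<integral>\<^sup>+y. indicator A (q + frame_map k 0 c y) \<partial>coord_lborel k)" for q c
    unfolding frame_map_base[of k q, symmetric]
    using nn_integral_distr[of "frame_map k q c" "coord_lborel k" borel "indicator A"] by simp
  have "(\<integral>\<^sup>+y. indicator A (p + frame_map k 0 b y) \<partial>coord_lborel k)
    = (\<integral>\<^sup>+y. indicator A (p + frame_map k 0 b' y) \<partial>coord_lborel k)"
    by (rule nn_integral_frame_indep[where f = "\<lambda>x. indicator A (p + x)"])
      (use o r in \<open>auto simp: oframe_def\<close>)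
  also have "\<dots> = (\<integral>\<^sup>+y. indicator A (p' + ((p - p') + 1 *\<^sub>R frame_map k 0 b' y)) \<partial>coord_lborel k)"
    by (simp add: algebra_simps)
  also have "\<dots> = (\<integral>\<^sup>+y. indicator A (p' + frame_map k 0 b' y) \<partial>coord_lborel k)"
    by (rule nn_integral_frame_reflect[where g = "\<lambda>x. indicator A (p' + x)"]) (use u in auto)
  finally show "emeasure (distr (coord_lborel k) borel (frame_map k p b)) A
    = emeasure (distr (coord_lborel k) borel (frame_map k p' b')) A"
    unfolding e .
qed simp

lemma affine_lborel_oframe:
  assumes o: "oframe k p b P" and P: "affine P"
  shows "affine_lborel P = distr (coord_lborel k) borel (frame_map k p b)"
proof -
  have k: "nat (aff_dim P) = k" using oframe_aff_dim[OF assms] by simp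
  define pb where "pb = (SOME pb. orthonormal_frame P pb)"
  have "orthonormal_frame P (p, b)" using o k by (simp add: orthonormal_frame_iff)
  then have "orthonormal_frame P pb" unfolding pb_def by (rule someI)
  then have o': "oframe k (fst pb) (snd pb) P"
    using k orthonormal_frame_iff[of P "fst pb" "snd pb"] by simp
  have "affine_lborel P = distr (coord_lborel k) borel (frame_map k (fst pb) (snd pb))"
    unfolding affine_lborel_def pb_def[symmetric] k frame_map_def by (simp add: case_prod_beta)
  then show ?thesis using distr_frame_indep[OF o' o] by simp
qed

lemma sets_affine_lborel [measurable_cong, simp]: "sets (affine_lborel P) = sets borel"
  unfolding affine_lborel_def by (simp add: case_prod_beta Let_def)

lemma space_affine_lborel [simp]: "space (affine_lborel P) = UNIV"
  unfolding affine_lborel_def by (simp add: case_prod_beta Let_def)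

lemma emeasure_affine_lborel_bounded:
  assumes P: "affine P" "P \<noteq> {}" and S: "bounded S" "S \<in> sets borel"
  shows "emeasure (affine_lborel P) S < \<infinity>"
proof -
  obtain p where p: "p \<in> P" using P by blast
  obtain b where o: "oframe (nat (aff_dim P)) p b P" using oframe_exists[OF P(1) p] by blast
  define k where "k = nat (aff_dim P)"
  note o = o[folded k_def]
  have on: "orthonormal k b" using o by (simp add: oframe_def)
  obtain R where R: "\<And>x. x \<in> S \<Longrightarrow> dist p x \<le> R" "0 \<le> R"
    using S(1) bounded_any_center[of S p] by (meson dual_order.trans linear)
  have "emeasure (affine_lborel P) S
    = emeasure (coord_lborel k) (frame_map k p b -` S \<inter> space (coord_lborel k))"
    unfolding affine_lborel_oframe[OF o P(1)] using S(2) by (intro emeasure_distr) auto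
  also have "\<dots> \<le> emeasure (coord_lborel k) (Pi\<^sub>E {..<k} (\<lambda>_. {-R..R}))"
  proof (rule emeasure_mono)
    show "frame_map k p b -` S \<inter> space (coord_lborel k) \<subseteq> Pi\<^sub>E {..<k} (\<lambda>_. {-R..R})"
    proof
      fix y assume y: "y \<in> frame_map k p b -` S \<inter> space (coord_lborel k)"
      have "- R \<le> y i \<and> y i \<le> R" if i: "i < k" for i
      proof -
        have "\<bar>y i\<bar> = \<bar>b i \<bullet> frame_map k 0 b y\<bar>" using frame_inner[OF on i] by simp
        also have "\<dots> \<le> norm (b i) * norm (frame_map k 0 b y)" by (rule Cauchy_Schwarz_ineq2)
        also have "\<dots> = norm (frame_map k 0 b y)" using on i by (simp add: norm_eq_sqrt_inner)
        also have "\<dots> = dist p (frame_map k p b y)"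
          unfolding frame_map_base[of k p] by (simp add: dist_norm)
        also have "\<dots> \<le> R" using R y by simp
        finally show ?thesis by linarith
      qed
      then show "y \<in> Pi\<^sub>E {..<k} (\<lambda>_. {-R..R})"
        using y by (auto simp: space_PiM PiE_iff)
    qed
  qed (auto intro!: sets_PiM_I_finite)
  also have "\<dots> < \<infinity>" using emeasure_coord_box[OF R(2)] by simp
  finally show ?thesis .
qed

lemma emeasure_affine_lborel_pos:
  assumes P: "affine P" and p: "p \<in> P" and e: "e > 0" and sub: "cball p e \<inter> P \<subseteq> S" and S: "S \<in> sets borel"
  shows "emeasure (affine_lborel P) S > 0"
proof -
  obtain b where o: "oframe (nat (aff_dim P)) p b P" using oframe_exists[OF P p] by blast
  define k where "k = nat (aff_dim P)"
  note o = o[folded k_def]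
  have on: "orthonormal k b" using o by (simp add: oframe_def)
  \<comment> \<open>The cube of half-width \<open>s\<close> about \<open>p\<close> lies in the ball of radius \<open>e\<close>.\<close>
  define s where "s = e / (real k + 1)"
  have s: "s > 0" using e by (simp add: s_def)
  have "0 < emeasure (coord_lborel k) (Pi\<^sub>E {..<k} (\<lambda>_. {-s..s}))"
    using emeasure_coord_box[of s k] s by simp
  also have "\<dots> \<le> emeasure (coord_lborel k) (frame_map k p b -` S \<inter> space (coord_lborel k))"
  proof (rule emeasure_mono)
    show "Pi\<^sub>E {..<k} (\<lambda>_. {-s..s}) \<subseteq> frame_map k p b -` S \<inter> space (coord_lborel k)"
    proof
      fix y assume y: "y \<in> Pi\<^sub>E {..<k} (\<lambda>_. {-s..s})"
      have "norm (frame_map k 0 b y) \<le> (\<Sum>i<k. norm (y i *\<^sub>R b i))"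
        unfolding frame_map_def using norm_sum[of "\<lambda>i. y i *\<^sub>R b i" "{..<k}"] by simp
      also have "\<dots> \<le> (\<Sum>i<k. s)"
      proof (rule sum_mono)
        fix i assume i: "i \<in> {..<k}"
        then have "- s \<le> y i" "y i \<le> s" using y by (auto simp: PiE_iff)
        then show "norm (y i *\<^sub>R b i) \<le> s" using on i by (simp add: norm_eq_sqrt_inner abs_le_iff)
      qed
      also have "\<dots> \<le> e" using e by (simp add: s_def field_simps)
      finally have "frame_map k p b y \<in> cball p e"
        unfolding frame_map_base[of k p] by (simp add: dist_norm)
      moreover have "frame_map k p b y \<in> P" using o by (auto simp: oframe_def)
      ultimately show "y \<in> frame_map k p b -` S \<inter> space (coord_lborel k)"
        using sub y by (auto simp: space_PiM PiE_iff)
    qed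
    show "frame_map k p b -` S \<inter> space (coord_lborel k) \<in> sets (coord_lborel k)"
      using S by measurable
  qed
  also have "\<dots> = emeasure (affine_lborel P) S"
    unfolding affine_lborel_oframe[OF o P] using S by (intro emeasure_distr[symmetric]) auto
  finally show ?thesis .
qed

lemma integral_affine_lborel_translation:
  fixes g :: "'a::euclidean_space \<Rightarrow> real"
  assumes P: "affine P" "P \<noteq> {}" and [measurable]: "g \<in> borel_measurable borel"
  shows "integral\<^sup>L (affine_lborel ((+) v ` P)) g = integral\<^sup>L (affine_lborel P) (\<lambda>x. g (v + x))"
proof -
  obtain p where p: "p \<in> P" using P by blast
  obtain b where o: "oframe (nat (aff_dim P)) p b P" using oframe_exists[OF P(1) p] by blast
  define k where "k = nat (aff_dim P)"
  note o = o[folded k_def]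
  have "frame_map k (v + p) b y = v + frame_map k p b y" for y
    by (simp add: frame_map_def add.assoc)
  then have fm: "frame_map k (v + p) b = (\<lambda>y. v + frame_map k p b y)" by auto
  have "oframe k (v + p) b ((+) v ` P)"
    using o unfolding oframe_def fm by auto
  moreover have "affine ((+) v ` P)"
    using P(1) affine_translation by blast
  ultimately have "affine_lborel ((+) v ` P) = distr (coord_lborel k) borel (\<lambda>y. v + frame_map k p b y)"
    using affine_lborel_oframe fm by metis
  then have "integral\<^sup>L (affine_lborel ((+) v ` P)) g = integral\<^sup>L (coord_lborel k) (\<lambda>y. g (v + frame_map k p b y))"
    by (simp add: integral_distr)
  also have "\<dots> = integral\<^sup>L (affine_lborel P) (\<lambda>x. g (v + x))"
    unfolding affine_lborel_oframe[OF o P(1)] by (subst integral_distr) auto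
  finally show ?thesis .
qed

text \<open>Fubini's theorem for the slices of an affine set by parallel hyperplanes.\<close>

lemma affine_slicing:
  fixes P :: "'a::euclidean_space set"
  assumes P: "affine P" and d: "d \<in> directions P" "a \<bullet> d \<noteq> 0"
  shows "\<exists>c>0. \<forall>g::'a \<Rightarrow> real. integrable (affine_lborel P) g \<longrightarrow>
    integral\<^sup>L (affine_lborel P) g = c * (\<integral>s. integral\<^sup>L (affine_lborel (P \<inter> {x. a \<bullet> x = s})) g \<partial>lborel)"
proof -
  obtain p where p: "p \<in> P" using d by (auto simp: directions_def)
  let ?L = "directions P"
  have L: "subspace ?L" using subspace_directions[OF P] p by blast
  obtain q where q: "q \<in> ?L" "\<And>d. d \<in> ?L \<Longrightarrow> q \<bullet> d = a \<bullet> d"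
    using functional_on_subspace[OF L] by blast
  have q0: "q \<noteq> 0" using q(2)[OF d(1)] d(2) by auto
  \<comment> \<open>An orthonormal basis of the directions within the slices, completed by the unit normal
      \<open>u\<close> of the slices, is a frame of \<open>P\<close>.\<close>
  define u where "u = q /\<^sub>R norm q"
  have uL: "u \<in> ?L" unfolding u_def using q(1) L by (simp add: subspace_scale)
  have au: "a \<bullet> u = norm q"
    using q(2)[OF uL] q0 by (simp add: u_def dot_square_norm power2_eq_square field_simps)
  have uu: "u \<bullet> u = 1" using q0 by (simp add: u_def dot_square_norm power2_eq_square)
  define L0 where "L0 = ?L \<inter> {x. a \<bullet> x = 0}"
  have L0: "subspace L0"
    unfolding L0_def using L by (intro subspace_inter subspace_hyperplane)
  define m where "m = dim L0"
  obtain b where b: "orthonormal m b"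
    and bL0: "L0 = range (frame_map m 0 b)"
    using orthonormal_basis_enum[OF L0] unfolding m_def by blast
  define b' where "b' = b(m := u)"
  have fmS: "frame_map (Suc m) r b' y = frame_map m (r + y m *\<^sub>R u) b y" for r y
    unfolding frame_map_def b'_def by (simp add: algebra_simps)
  have ub: "u \<bullet> b i = 0" if "i < m" for i
  proof -
    have "b i \<in> L0"
      unfolding bL0 using frame_map_unit[OF that, of b] by (metis rangeI)
    then show ?thesis using q(2)[of "b i"] unfolding u_def L0_def by simp
  qed
  have b'on: "orthonormal (Suc m) b'"
    using b ub uu unfolding b'_def by (auto simp: less_Suc_eq inner_commute)
  have oP: "oframe (Suc m) p b' P"
    unfolding oframe_def
  proof (intro conjI b'on set_eqI iffI)
    fix x assume "x \<in> P"
    then have dx: "x - p \<in> ?L" using diff_in_directions p by blast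
    define t where "t = u \<bullet> (x - p)"
    have "a \<bullet> (x - p) = norm q * t"
      using q(2)[OF dx] q0 by (simp add: t_def u_def)
    then have "x - p - t *\<^sub>R u \<in> L0"
      unfolding L0_def using dx uL L au
      by (auto simp: inner_diff_right intro: subspace_diff subspace_scale)
    then obtain y where "x - p - t *\<^sub>R u = frame_map m 0 b y" unfolding bL0 by blast
    then have "x = frame_map m (p + t *\<^sub>R u) b y"
      unfolding frame_map_base[of m "p + t *\<^sub>R u"] by (simp add: algebra_simps)
    also have "\<dots> = frame_map (Suc m) p b' (y(m := t))"
      unfolding fmS by (simp add: frame_map_def)
    finally show "x \<in> range (frame_map (Suc m) p b')" by blast
  next
    fix x assume "x \<in> range (frame_map (Suc m) p b')"
    then obtain y where y: "x = frame_map m (p + y m *\<^sub>R u) b y" using fmS by auto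
    have "frame_map m 0 b y \<in> ?L" using bL0 L0_def by blast
    then have "y m *\<^sub>R u + frame_map m 0 b y \<in> ?L"
      using uL L by (intro subspace_add subspace_scale)
    then have "p + (y m *\<^sub>R u + frame_map m 0 b y) \<in> P"
      using add_direction_iff[OF P p] by blast
    then show "x \<in> P" unfolding y frame_map_base[of m "p + y m *\<^sub>R u"] by (simp add: add.assoc)
  qed
  define T where "T s = (s - a \<bullet> p) / norm q" for s
  have oS: "oframe m (p + T s *\<^sub>R u) b (P \<inter> {x. a \<bullet> x = s})" for s
    unfolding oframe_def
  proof (intro conjI b set_eqI iffI)
    fix x assume x: "x \<in> P \<inter> {x. a \<bullet> x = s}"
    have "a \<bullet> (x - (p + T s *\<^sub>R u)) = 0"
      using x au q0 by (simp add: T_def inner_diff_right inner_add_right)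
    moreover have "x - (p + T s *\<^sub>R u) \<in> ?L"
    proof -
      have "(x - p) - T s *\<^sub>R u \<in> ?L"
        using diff_in_directions[of x P p] x p
        by (intro subspace_diff[OF L _ subspace_scale[OF L uL]]) simp
      then show ?thesis by (simp add: algebra_simps)
    qed
    ultimately obtain y where "x - (p + T s *\<^sub>R u) = frame_map m 0 b y"
      using bL0 L0_def by blast
    then have "x = frame_map m (p + T s *\<^sub>R u) b y"
      unfolding frame_map_base[of m "p + T s *\<^sub>R u"] by (simp add: algebra_simps)
    then show "x \<in> range (frame_map m (p + T s *\<^sub>R u) b)" by blast
  next
    fix x assume "x \<in> range (frame_map m (p + T s *\<^sub>R u) b)"
    then obtain y where y: "x = p + T s *\<^sub>R u + frame_map m 0 b y"
      unfolding frame_map_base[of m "p + T s *\<^sub>R u"] by auto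
    have L0y: "frame_map m 0 b y \<in> L0" using bL0 by blast
    then have "T s *\<^sub>R u + frame_map m 0 b y \<in> ?L"
      using uL L unfolding L0_def by (intro subspace_add subspace_scale) auto
    then have "x \<in> P"
      using add_direction_iff[OF P p, of "T s *\<^sub>R u + frame_map m 0 b y"] y by (simp add: add.assoc)
    moreover have "a \<bullet> x = s"
      using L0y au q0 unfolding y L0_def by (simp add: inner_add_right T_def)
    ultimately show "x \<in> P \<inter> {x. a \<bullet> x = s}" by simp
  qed
  interpret product_sigma_finite "\<lambda>_::nat. lborel :: real measure" by standard
  interpret finite_product_sigma_finite "\<lambda>_::nat. lborel :: real measure" "{..<m}" by standard simp
  have "integral\<^sup>L (affine_lborel P) g
      = (1 / norm q) * (\<integral>s. integral\<^sup>L (affine_lborel (P \<inter> {x. a \<bullet> x = s})) g \<partial>lborel)"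
    if int: "integrable (affine_lborel P) g" for g :: "'a \<Rightarrow> real"
  proof -
    have g[measurable]: "g \<in> borel_measurable borel"
      using borel_measurable_integrable[OF int] by simp
    define G where "G t = (\<integral>y. g (frame_map m (p + t *\<^sub>R u) b y) \<partial>coord_lborel m)" for t
    have G[measurable]: "G \<in> borel_measurable borel"
    proof -
      have "G \<in> borel_measurable lborel"
        unfolding G_def frame_map_def
        by (rule borel_measurable_lebesgue_integral) measurable
      then show ?thesis by simp
    qed
    have un: "{..<Suc m} = {m} \<union> {..<m}" by auto
    have int': "integrable (coord_lborel (Suc m)) (\<lambda>y. g (frame_map (Suc m) p b' y))"
      using int unfolding affine_lborel_oframe[OF oP P] by (simp add: integrable_distr_eq)
    have "integral\<^sup>L (affine_lborel P) g = (\<integral>y. g (frame_map (Suc m) p b' y) \<partial>coord_lborel (Suc m))"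
      unfolding affine_lborel_oframe[OF oP P] by (rule integral_distr) auto
    also have "\<dots> = (\<integral>x. (\<integral>y. g (frame_map (Suc m) p b' (merge {m} {..<m} (x, y))) \<partial>coord_lborel m)
        \<partial>(\<Pi>\<^sub>M i\<in>{m}. lborel))"
      using int' unfolding un by (intro product_integral_fold) auto
    also have "\<dots> = (\<integral>x. G (x m) \<partial>(\<Pi>\<^sub>M i\<in>{m}. lborel))"
    proof -
      have "frame_map (Suc m) p b' (merge {m} {..<m} (x, y)) = frame_map m (p + x m *\<^sub>R u) b y" for x y
        unfolding fmS by (simp add: frame_map_def merge_def)
      then show ?thesis unfolding G_def by simp
    qed
    also have "\<dots> = integral\<^sup>L lborel G"
      by (rule product_integral_singleton) simp
    also have "\<dots> = \<bar>1 / norm q\<bar> *\<^sub>R (\<integral>s. G (- (a \<bullet> p) / norm q + (1 / norm q) * s) \<partial>lborel)"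
      using q0 by (intro lborel_integral_real_affine) auto
    also have "\<dots> = (1 / norm q) * (\<integral>s. G (T s) \<partial>lborel)"
      by (simp add: T_def diff_divide_distrib)
    also have "(\<integral>s. G (T s) \<partial>lborel) = (\<integral>s. integral\<^sup>L (affine_lborel (P \<inter> {x. a \<bullet> x = s})) g \<partial>lborel)"
    proof (rule Bochner_Integration.integral_cong[OF refl])
      fix s
      have aff: "affine (P \<inter> {x. a \<bullet> x = s})" using P affine_hyperplane by (intro affine_Int)
      have "integral\<^sup>L (affine_lborel (P \<inter> {x. a \<bullet> x = s})) g
        = (\<integral>y. g (frame_map m (p + T s *\<^sub>R u) b y) \<partial>coord_lborel m)"
        unfolding affine_lborel_oframe[OF oS aff] by (rule integral_distr) auto
      then show "G (T s) = integral\<^sup>L (affine_lborel (P \<inter> {x. a \<bullet> x = s})) g"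
        unfolding G_def by simp
    qed
    finally show ?thesis .
  qed
  then show ?thesis using q0 by (intro exI[of _ "1 / norm q"]) auto
qed

section \<open>Moments of polytopes\<close>

text \<open>The integral of a function over a subset of an affine space. For a linear function
  and for the constant \<open>1\<close> these are the numerator and the denominator of the value of the linear
  function at the centre of mass.\<close>

definition moment :: "'a::euclidean_space set \<Rightarrow> ('a \<Rightarrow> real) \<Rightarrow> 'a set \<Rightarrow> real" where
  "moment P h S = (\<integral>x. indicator S x * h x \<partial>affine_lborel P)"

text \<open>The moment of the affine function \<open>H \<bullet> x + C\<close>; for \<open>H = 0\<close> and \<open>C = 1\<close> it is the volume.\<close>

abbreviation affine_moment :: "'a::euclidean_space set \<Rightarrow> 'a \<Rightarrow> real \<Rightarrow> 'a set \<Rightarrow> real" where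
  "affine_moment P H C S \<equiv> moment P (\<lambda>x. H \<bullet> x + C) S"

lemma integrable_moment:
  fixes H :: "'a::euclidean_space"
  assumes P: "affine P" "P \<noteq> {}" and S: "bounded S" "S \<in> sets borel"
  shows "integrable (affine_lborel P) (\<lambda>x. indicator S x * (H \<bullet> x + C))"
proof -
  obtain R where R: "\<And>x. x \<in> S \<Longrightarrow> norm x \<le> R" using S(1) by (auto simp: bounded_iff)
  have i: "integrable (affine_lborel P) (\<lambda>x. indicator S x * (norm H * \<bar>R\<bar> + \<bar>C\<bar>))"
    using emeasure_affine_lborel_bounded[OF P S] S(2)
    by (intro integrable_mult_left integrable_real_indicator) auto
  show ?thesis
  proof (rule Bochner_Integration.integrable_bound[OF i])
    show "(\<lambda>x. indicator S x * (H \<bullet> x + C)) \<in> borel_measurable (affine_lborel P)"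
      using S(2) by measurable
    have "norm (indicator S x * (H \<bullet> x + C)) \<le> norm (indicator S x * (norm H * \<bar>R\<bar> + \<bar>C\<bar>))" for x
    proof (cases "x \<in> S")
      case True
      have "\<bar>H \<bullet> x\<bar> \<le> norm H * norm x" by (rule Cauchy_Schwarz_ineq2)
      also have "\<dots> \<le> norm H * \<bar>R\<bar>" using R[OF True] by (intro mult_left_mono) auto
      finally have "\<bar>H \<bullet> x + C\<bar> \<le> norm H * \<bar>R\<bar> + \<bar>C\<bar>" by linarith
      then show ?thesis using True by simp
    qed simp
    then show "AE x in affine_lborel P. norm (indicator S x * (H \<bullet> x + C))
      \<le> norm (indicator S x * (norm H * \<bar>R\<bar> + \<bar>C\<bar>))" by simp
  qed
qed

lemma moment_affine:
  assumes P: "affine P" "P \<noteq> {}" and S: "bounded S" "S \<in> sets borel"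
  shows "affine_moment P H (C + t) S = affine_moment P H C S + t * affine_moment P 0 1 S"
proof -
  have "affine_moment P H (C + t) S
    = (\<integral>x. indicator S x * (H \<bullet> x + C) + t * (indicator S x * (0 \<bullet> x + 1)) \<partial>affine_lborel P)"
    unfolding moment_def by (intro Bochner_Integration.integral_cong) (auto simp: algebra_simps)
  also have "\<dots> = affine_moment P H C S + t * affine_moment P 0 1 S"
  proof -
    have i1: "integrable (affine_lborel P) (\<lambda>x. t * (indicator S x * (0 \<bullet> x + 1)))"
      by (intro integrable_mult_right integrable_moment[OF P S])
    show ?thesis
      unfolding moment_def Bochner_Integration.integral_add[OF integrable_moment[OF P S] i1]
        integral_mult_right_zero ..
  qed
  finally show ?thesis .
qed

lemma moment_one: "S \<in> sets borel \<Longrightarrow> affine_moment P 0 1 S = measure (affine_lborel P) S"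
  unfolding moment_def by simp

lemma inner_center_of_mass:
  assumes P: "affine P" "P \<noteq> {}" and S: "bounded S" "S \<in> sets borel"
  shows "H \<bullet> center_of_mass P S = affine_moment P H 0 S / affine_moment P 0 1 S"
proof -
  have int: "integrable (affine_lborel P) (\<lambda>x. indicator S x *\<^sub>R x)"
  proof -
    obtain R where R: "\<And>x. x \<in> S \<Longrightarrow> norm x \<le> R" using S(1) by (auto simp: bounded_iff)
    have "integrable (affine_lborel P) (\<lambda>x. indicator S x * (0 \<bullet> x + \<bar>R\<bar>))"
      by (rule integrable_moment[OF P S])
    then show ?thesis
    proof (rule Bochner_Integration.integrable_bound)
      show "(\<lambda>x. indicator S x *\<^sub>R x) \<in> borel_measurable (affine_lborel P)"
        using S(2) by measurable
      have "norm (indicator S x *\<^sub>R x) \<le> norm (indicator S x * (0 \<bullet> x + \<bar>R\<bar>))" for x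
        using R[of x] by (cases "x \<in> S") auto
      then show "AE x in affine_lborel P. norm (indicator S x *\<^sub>R x)
        \<le> norm (indicator S x * (0 \<bullet> x + \<bar>R\<bar>))" by simp
    qed
  qed
  have "H \<bullet> (LINT x:S|affine_lborel P. x) = (\<integral>x. H \<bullet> (indicator S x *\<^sub>R x) \<partial>affine_lborel P)"
    unfolding set_lebesgue_integral_def by (rule integral_inner_right[symmetric]) (rule int)
  also have "\<dots> = affine_moment P H 0 S" unfolding moment_def by simp
  finally show ?thesis
    unfolding center_of_mass_def moment_one[OF S(2)] by simp
qed

lemma moment_translation:
  assumes P: "affine P" "P \<noteq> {}" and S: "S \<in> sets borel"
  shows "affine_moment ((+) v ` P) H C ((+) v ` S) = affine_moment P H (C + H \<bullet> v) S"
proof -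
  have im: "(+) v ` S = (\<lambda>x. x - v) -` S"
    by (auto simp: image_iff) (metis add.commute diff_add_cancel)
  have "(\<lambda>x::'a. x - v) -` S \<in> sets borel"
    using measurable_sets[of "\<lambda>x::'a. x - v" borel borel S] S by simp
  then have [measurable]: "(+) v ` S \<in> sets borel" using im by simp
  have "affine_moment ((+) v ` P) H C ((+) v ` S)
    = (\<integral>x. indicator ((+) v ` S) (v + x) * (H \<bullet> (v + x) + C) \<partial>affine_lborel P)"
    unfolding moment_def by (rule integral_affine_lborel_translation[OF P]) measurable
  also have "\<dots> = affine_moment P H (C + H \<bullet> v) S"
    unfolding moment_def
    by (intro Bochner_Integration.integral_cong) (auto simp: im indicator_def inner_add_right)
  finally show ?thesis .
qed

lemma AE_affine_lborel:
  assumes "affine P" "P \<noteq> {}"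
  shows "AE x in affine_lborel P. x \<in> P"
proof -
  obtain p where p: "p \<in> P" using assms by blast
  obtain b where o: "oframe (nat (aff_dim P)) p b P" using oframe_exists[OF assms(1) p] by blast
  have "{x \<in> space borel. x \<in> P} \<in> sets borel"
    using affine_closed[OF assms(1)] by (simp add: borel_closed)
  moreover have "frame_map (nat (aff_dim P)) p b y \<in> P" for y
    using o by (auto simp: oframe_def)
  ultimately show ?thesis
    unfolding affine_lborel_oframe[OF o assms(1)] by (subst AE_distr_iff) auto
qed

lemma polytope_at_borel: "affine P \<Longrightarrow> polytope_at P J \<eta> \<kappa> \<in> sets borel"
  by (simp add: borel_closed closed_polytope_at)

lemma facet_borel:
  assumes "affine P"
  shows "facet P J \<eta> \<kappa> i \<in> sets borel"
proof -
  have "closed (facet P J \<eta> \<kappa> i)"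
    unfolding facet_def using closed_polytope_at[OF assms] closed_hyperplane by (rule closed_Int)
  then show ?thesis by (simp add: borel_closed)
qed

lemma polytope_at_cong: "(\<And>j. j \<in> J \<Longrightarrow> \<kappa> j = \<kappa>' j) \<Longrightarrow> polytope_at P J \<eta> \<kappa> = polytope_at P J \<eta> \<kappa>'"
  unfolding polytope_at_def by auto

lemma volume_pos:
  assumes s: "simple_polytope P J \<eta> \<kappa>" and P: "P \<noteq> {}"
  shows "affine_moment P 0 1 (polytope_at P J \<eta> \<kappa>) > 0"
proof -
  let ?D = "polytope_at P J \<eta> \<kappa>"
  have aff: "affine P" using simple_polytope_affine[OF s] .
  have hull: "affine hull ?D = P" and b: "bounded ?D" using s by (auto simp: simple_polytope_def)
  have "rel_interior ?D \<noteq> {}"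
    using convex_polytope_at[OF aff, of J \<eta> \<kappa>] hull P by (auto simp: rel_interior_eq_empty)
  then obtain x e where x: "x \<in> ?D" "e > 0" "cball x e \<inter> P \<subseteq> ?D"
    using mem_rel_interior_cball[of _ ?D] hull by auto
  have "x \<in> P" using x(1) by (simp add: polytope_at_def)
  then have "0 < emeasure (affine_lborel P) ?D"
    using emeasure_affine_lborel_pos[OF aff _ x(2,3) polytope_at_borel[OF aff]] by blast
  moreover have "emeasure (affine_lborel P) ?D < \<infinity>"
    using emeasure_affine_lborel_bounded[OF aff P b polytope_at_borel[OF aff]] .
  ultimately have "0 < measure (affine_lborel P) ?D"
    unfolding measure_def by (simp add: enn2real_positive_iff)
  then show ?thesis by (simp only: moment_one[OF polytope_at_borel[OF aff]])
qed

lemma center_of_mass_eq_iff: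
  assumes s: "simple_polytope P J \<eta> \<kappa>" and P: "P \<noteq> {}"
  shows "H \<bullet> center_of_mass P (polytope_at P J \<eta> \<kappa>) = L \<longleftrightarrow>
    affine_moment P H (- L) (polytope_at P J \<eta> \<kappa>) = 0"
proof -
  have aff: "affine P" using simple_polytope_affine[OF s] .
  have b: "bounded (polytope_at P J \<eta> \<kappa>)" using s by (simp add: simple_polytope_def)
  note bm = b polytope_at_borel[OF aff, of J \<eta> \<kappa>]
  show ?thesis
    using volume_pos[OF s P] moment_affine[OF aff P bm, of H 0 "- L"]
    unfolding inner_center_of_mass[OF aff P bm] by (auto simp: field_simps)
qed

text \<open>Moving one facet outwards adds a slab, which is fibred over an interval by the facet
  in its successive positions.\<close>

lemma moment_slab:
  assumes P: "affine P" and d: "d \<in> directions P" "\<eta> i \<bullet> d \<noteq> 0" and i: "i \<in> J"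
  shows "\<exists>c>0. \<forall>H C \<kappa> s1 s2. s1 \<le> s2 \<longrightarrow> bounded (polytope_at P J \<eta> (\<kappa>(i := s2))) \<longrightarrow>
    affine_moment P H C (polytope_at P J \<eta> (\<kappa>(i := s2)))
      - affine_moment P H C (polytope_at P J \<eta> (\<kappa>(i := s1)))
    = c * (\<integral>s. moment (face_space P \<eta> (\<kappa>(i := s)) {i}) (\<lambda>x. H \<bullet> x + C) (facet P J \<eta> (\<kappa>(i := s)) i)
        * indicator {s1<..s2} s \<partial>lborel)"
proof -
  have ne: "P \<noteq> {}" using d by (auto simp: directions_def)
  obtain c where c: "c > 0" "\<And>g::'a \<Rightarrow> real. integrable (affine_lborel P) g \<Longrightarrow>
    integral\<^sup>L (affine_lborel P) g = c * (\<integral>s. integral\<^sup>L (affine_lborel (P \<inter> {x. \<eta> i \<bullet> x = s})) g \<partial>lborel)"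
    using affine_slicing[OF P d] by blast
  have "affine_moment P H C (polytope_at P J \<eta> (\<kappa>(i := s2)))
      - affine_moment P H C (polytope_at P J \<eta> (\<kappa>(i := s1)))
    = c * (\<integral>s. moment (face_space P \<eta> (\<kappa>(i := s)) {i}) (\<lambda>x. H \<bullet> x + C) (facet P J \<eta> (\<kappa>(i := s)) i)
        * indicator {s1<..s2} s \<partial>lborel)"
    if s12: "s1 \<le> s2" and b: "bounded (polytope_at P J \<eta> (\<kappa>(i := s2)))" for H C \<kappa> s1 s2
  proof -
    let ?D1 = "polytope_at P J \<eta> (\<kappa>(i := s1))" and ?D2 = "polytope_at P J \<eta> (\<kappa>(i := s2))"
    let ?h = "\<lambda>x. H \<bullet> x + C"
    have sub: "?D1 \<subseteq> ?D2" using s12 i by (force simp: polytope_at_def)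
    have b1: "bounded ?D1" using bounded_subset[OF b sub] .
    note D1 = polytope_at_borel[OF P, of J \<eta> "\<kappa>(i := s1)"] and D2 = polytope_at_borel[OF P, of J \<eta> "\<kappa>(i := s2)"]
    define W where "W = ?D2 - ?D1"
    have W: "bounded W" "W \<in> sets borel"
      using b bounded_diff D1 D2 unfolding W_def by auto
    have "moment P ?h ?D2 - moment P ?h ?D1
      = (\<integral>x. indicator ?D2 x * ?h x - indicator ?D1 x * ?h x \<partial>affine_lborel P)"
      unfolding moment_def
      by (rule Bochner_Integration.integral_diff[symmetric]) (intro integrable_moment P ne b b1 D1 D2)+
    also have "\<dots> = (\<integral>x. indicator W x * ?h x \<partial>affine_lborel P)"
      using sub by (intro Bochner_Integration.integral_cong) (auto simp: W_def indicator_def)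
    also have "\<dots> = c * (\<integral>s. integral\<^sup>L (affine_lborel (P \<inter> {x. \<eta> i \<bullet> x = s})) (\<lambda>x. indicator W x * ?h x) \<partial>lborel)"
      by (intro c(2) integrable_moment P ne W)
    also have "(\<integral>s. integral\<^sup>L (affine_lborel (P \<inter> {x. \<eta> i \<bullet> x = s})) (\<lambda>x. indicator W x * ?h x) \<partial>lborel)
      = (\<integral>s. affine_moment (face_space P \<eta> (\<kappa>(i := s)) {i}) H C (facet P J \<eta> (\<kappa>(i := s)) i) * indicator {s1<..s2} s \<partial>lborel)"
    proof (rule Bochner_Integration.integral_cong[OF refl])
      fix s
      let ?P = "face_space P \<eta> (\<kappa>(i := s)) {i}"
      have eq: "P \<inter> {x. \<eta> i \<bullet> x = s} = ?P" by (auto simp: face_space_def)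
      have neP: "?P \<noteq> {}"
      proof -
        obtain p where p: "p \<in> P" using ne by blast
        have "((s - \<eta> i \<bullet> p) / (\<eta> i \<bullet> d)) *\<^sub>R d \<in> directions P"
          using subspace_directions[OF P ne] d(1) by (rule subspace_scale)
        then have "p + ((s - \<eta> i \<bullet> p) / (\<eta> i \<bullet> d)) *\<^sub>R d \<in> P"
          using add_direction_iff[OF P p] by blast
        then have "p + ((s - \<eta> i \<bullet> p) / (\<eta> i \<bullet> d)) *\<^sub>R d \<in> ?P"
          using d(2) by (simp add: face_space_def inner_add_right)
        then show ?thesis by blast
      qed
      have "indicator W x * ?h x = indicator (facet P J \<eta> (\<kappa>(i := s)) i) x * ?h x * indicator {s1<..s2} s"
        if "x \<in> ?P" for x
      proof -
        have "x \<in> P" "\<eta> i \<bullet> x = s" using that by (auto simp: face_space_def)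
        then have "x \<in> polytope_at P J \<eta> (\<kappa>(i := t)) \<longleftrightarrow> (\<forall>j\<in>J - {i}. \<eta> j \<bullet> x \<le> \<kappa> j) \<and> s \<le> t" for t
          using i by (auto simp: polytope_at_def)
        then have "x \<in> W \<longleftrightarrow> x \<in> facet P J \<eta> (\<kappa>(i := s)) i \<and> s \<in> {s1<..s2}"
          using \<open>\<eta> i \<bullet> x = s\<close> unfolding W_def facet_def by auto
        then show ?thesis by (auto simp: indicator_def)
      qed
      then have "integral\<^sup>L (affine_lborel ?P) (\<lambda>x. indicator W x * ?h x)
        = integral\<^sup>L (affine_lborel ?P) (\<lambda>x. indicator (facet P J \<eta> (\<kappa>(i := s)) i) x * ?h x * indicator {s1<..s2} s)"
        using AE_affine_lborel[OF affine_face_space[OF P] neP] W(2) facet_borel[OF P, of J \<eta> "\<kappa>(i := s)" i]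
        by (intro integral_cong_AE) auto
      then show "integral\<^sup>L (affine_lborel (P \<inter> {x. \<eta> i \<bullet> x = s})) (\<lambda>x. indicator W x * ?h x)
        = moment ?P ?h (facet P J \<eta> (\<kappa>(i := s)) i) * indicator {s1<..s2} s"
        unfolding eq moment_def by simp
    qed
    finally show ?thesis .
  qed
  then show ?thesis using c(1) by blast
qed

section \<open>Moments are locally polynomial in the support numbers\<close>

text \<open>Agreement with a polynomial function on a ball about \<open>\<kappa>\<close>.\<close>

abbreviation locally_polynomial ::
  "'i set \<Rightarrow> ('i \<Rightarrow> real) \<Rightarrow> (('i \<Rightarrow> real) \<Rightarrow> real) \<Rightarrow> bool" where
  "locally_polynomial J \<kappa> F \<equiv>
    \<exists>\<epsilon>>0. \<exists>Q. polyfun Q \<and> (\<forall>\<kappa>'. near J \<epsilon> \<kappa> \<kappa>' \<longrightarrow> F \<kappa>' = Q \<kappa>')"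

lemma polyfun_isCont:
  assumes "polyfun Q"
  shows "isCont (\<lambda>s. Q (\<kappa>(i := s))) s"
proof -
  obtain q where q: "\<And>t. Q (\<lambda>j. (\<kappa>(i := 0)) j + t * (if j = i then 1 else 0)) = poly q t"
    using polyfun_line[OF assms, of "\<kappa>(i := 0)" "\<lambda>j. if j = i then 1 else 0"] by blast
  have "(\<lambda>j. (\<kappa>(i := 0)) j + t * (if j = i then 1 else 0)) = \<kappa>(i := t)" for t
    by auto
  then have "(\<lambda>s. Q (\<kappa>(i := s))) = poly q" using q by auto
  then show ?thesis by simp
qed

lemma polyfun_integral:
  assumes Q: "polyfun Q" and R: "\<And>s. ((\<lambda>s. R (\<kappa>(i := s))) has_real_derivative Q (\<kappa>(i := s))) (at s)"
    and "s1 \<le> s2"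
  shows "(\<integral>s. Q (\<kappa>(i := s)) * indicator {s1<..s2} s \<partial>lborel) = R (\<kappa>(i := s2)) - R (\<kappa>(i := s1))"
proof -
  have "continuous_on UNIV (\<lambda>s. Q (\<kappa>(i := s)))"
    using polyfun_isCont[OF Q] by (intro continuous_at_imp_continuous_on) auto
  then have [measurable]: "(\<lambda>s. Q (\<kappa>(i := s))) \<in> borel_measurable borel"
    by (rule borel_measurable_continuous_onI)
  have "(\<integral>s. Q (\<kappa>(i := s)) * indicator {s1<..s2} s \<partial>lborel)
    = (\<integral>s. Q (\<kappa>(i := s)) * indicator {s1..s2} s \<partial>lborel)"
  proof (rule integral_cong_AE)
    show "AE s in lborel. Q (\<kappa>(i := s)) * indicator {s1<..s2} s = Q (\<kappa>(i := s)) * indicator {s1..s2} s"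
      using AE_lborel_singleton[of s1] by eventually_elim (auto simp: indicator_def)
  qed measurable
  also have "\<dots> = R (\<kappa>(i := s2)) - R (\<kappa>(i := s1))"
    using assms polyfun_isCont[OF Q]
    by (intro integral_FTC_Icc_real[where F = "\<lambda>s. R (\<kappa>(i := s))"]) auto
  finally show ?thesis .
qed

lemma simple_polytope_facts:
  assumes "simple_polytope P J \<eta> \<kappa>" "P \<noteq> {}" "finite J"
  shows "bounded (polytope_at P J \<eta> \<kappa>)" "polytope_at P J \<eta> \<kappa> \<noteq> {}"
    "\<And>i. i \<in> J \<Longrightarrow> face P J \<eta> \<kappa> {i} \<noteq> {}"
    "\<And>v. v extreme_point_of polytope_at P J \<eta> \<kappa> \<Longrightarrow> int (card (active J \<eta> \<kappa> v)) = aff_dim P"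
  using assms simple_polytope_iff[OF simple_polytope_affine[OF assms(1)] assms(2,3)] by auto

lemma simple_polytope_vertex:
  assumes s: "simple_polytope P J \<eta> \<kappa>" and P: "P \<noteq> {}" and J: "finite J"
    and I: "I \<subseteq> J" "face P J \<eta> \<kappa> I \<noteq> {}"
  obtains v w where "v \<in> face P J \<eta> \<kappa> I" "\<forall>i\<in>active J \<eta> \<kappa> v. w i \<in> directions P"
    "dual_on (active J \<eta> \<kappa> v) \<eta> w"
proof -
  have aff: "affine P" using simple_polytope_affine[OF s] .
  note facts = simple_polytope_facts[OF s P J]
  obtain v where v: "v extreme_point_of polytope_at P J \<eta> \<kappa>" "v \<in> face P J \<eta> \<kappa> I"
    using extreme_point_of_face_exists[OF aff J I(1) facts(1) I(2)] by blast
  then show ?thesis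
    using vertex_dual_basis[OF aff J v(1) facts(4)[OF v(1)]] that by blast
qed

lemma facet_transversal:
  assumes s: "simple_polytope P J \<eta> \<kappa>" and P: "P \<noteq> {}" and J: "finite J" and i: "i \<in> J"
  shows "\<exists>w\<in>directions P. \<eta> i \<bullet> w = 1"
proof -
  have "{i} \<subseteq> J" using i by simp
  then obtain v w where v: "v \<in> face P J \<eta> \<kappa> {i}" and w: "\<forall>i\<in>active J \<eta> \<kappa> v. w i \<in> directions P"
    "dual_on (active J \<eta> \<kappa> v) \<eta> w"
    using simple_polytope_vertex[OF s P J _ simple_polytope_facts(3)[OF s P J i]] by metis
  have "i \<in> active J \<eta> \<kappa> v" using v mem_face_iff[of "{i}" J v P \<eta> \<kappa>] i by simp
  then show ?thesis using w by (intro bexI[of _ "w i"]) auto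
qed

lemma polytope_at_translation:
  "polytope_at ((+) v ` S) K \<eta> \<kappa> = (+) v ` polytope_at S K \<eta> (\<lambda>j. \<kappa> j - \<eta> j \<bullet> v)"
  unfolding polytope_at_def by (auto simp: inner_add_right algebra_simps)

lemma face_space_translation:
  assumes P: "affine P" and w: "w \<in> directions P" "\<eta> i \<bullet> w = 1"
  shows "face_space P \<eta> \<kappa>' {i} = (+) ((\<kappa>' i - \<kappa> i) *\<^sub>R w) ` face_space P \<eta> \<kappa> {i}"
proof -
  have sub: "subspace (directions P)"
    using w subspace_directions[OF P] by (auto simp: directions_def)
  have shift: "r *\<^sub>R w + x \<in> P" if "x \<in> P" for r x
    using add_direction_iff[OF P that, of "r *\<^sub>R w"] subspace_scale[OF sub w(1), of r]
    by (simp add: add.commute)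
  show ?thesis
  proof (intro equalityI subsetI)
    fix x assume x: "x \<in> face_space P \<eta> \<kappa>' {i}"
    have "(- (\<kappa>' i - \<kappa> i)) *\<^sub>R w + x \<in> face_space P \<eta> \<kappa> {i}"
      using x shift[of x "- (\<kappa>' i - \<kappa> i)"] w(2)
      by (auto simp: face_space_def inner_add_right inner_diff_right algebra_simps)
    then have "(\<kappa>' i - \<kappa> i) *\<^sub>R w + ((- (\<kappa>' i - \<kappa> i)) *\<^sub>R w + x) \<in> (+) ((\<kappa>' i - \<kappa> i) *\<^sub>R w) ` face_space P \<eta> \<kappa> {i}"
      by (rule imageI)
    then show "x \<in> (+) ((\<kappa>' i - \<kappa> i) *\<^sub>R w) ` face_space P \<eta> \<kappa> {i}"
      by (simp add: algebra_simps)
  next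
    fix x assume "x \<in> (+) ((\<kappa>' i - \<kappa> i) *\<^sub>R w) ` face_space P \<eta> \<kappa> {i}"
    then show "x \<in> face_space P \<eta> \<kappa>' {i}"
      using shift w(2) by (auto simp: face_space_def inner_add_right)
  qed
qed

text \<open>The moments of a facet inherit local polynomiality from the moments of the facet within
  a fixed hyperplane, by translating the hyperplane along a transversal direction.\<close>

lemma facet_moment_polynomial:
  fixes H :: "'a::euclidean_space" and J :: "'i set"
  assumes s: "simple_polytope P J \<eta> \<kappa>" and P: "P \<noteq> {}" and J: "finite J" and i: "i \<in> J"
    and IH: "\<And>(H::'a) C. locally_polynomial (face_indices P J \<eta> \<kappa> {i}) \<kappa>
      (\<lambda>\<kappa>'. affine_moment (face_space P \<eta> \<kappa> {i}) H C (polytope_at (face_space P \<eta> \<kappa> {i}) (face_indices P J \<eta> \<kappa> {i}) \<eta> \<kappa>'))"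
  shows "locally_polynomial J \<kappa> (\<lambda>\<kappa>'. affine_moment (face_space P \<eta> \<kappa>' {i}) H C (facet P J \<eta> \<kappa>' i))"
proof -
  let ?S = "face_space P \<eta> \<kappa> {i}" and ?K = "face_indices P J \<eta> \<kappa> {i}"
  have aff: "affine P" using simple_polytope_affine[OF s] .
  have iJ: "{i} \<subseteq> J" using i by simp
  have fne: "face P J \<eta> \<kappa> {i} \<noteq> {}" using simple_polytope_facts(3)[OF s P J i] .
  have affS: "affine ?S" using affine_face_space[OF aff] .
  have Sne: "?S \<noteq> {}" using fne face_subset_face_space[OF iJ] by blast
  obtain w where w: "w \<in> directions P" "\<eta> i \<bullet> w = 1"
    using facet_transversal[OF s P J i] by blast
  obtain e0 where e0: "e0 > 0" "\<And>\<kappa>'. near J e0 \<kappa> \<kappa>' \<Longrightarrow> simple_polytope P J \<eta> \<kappa>' \<and>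
    (\<forall>I\<subseteq>J. face P J \<eta> \<kappa>' I \<noteq> {} \<longleftrightarrow> face P J \<eta> \<kappa> I \<noteq> {})"
    using simple_polytope_stable[OF s P J] by blast
  obtain e1 Q1 where Q1: "e1 > 0" "polyfun Q1" "\<And>\<kappa>'. near ?K e1 \<kappa> \<kappa>' \<Longrightarrow>
    affine_moment ?S H C (polytope_at ?S ?K \<eta> \<kappa>') = Q1 \<kappa>'"
    using IH[of H C] by blast
  obtain e2 Q2 where Q2: "e2 > 0" "polyfun Q2" "\<And>\<kappa>'. near ?K e2 \<kappa> \<kappa>' \<Longrightarrow>
    affine_moment ?S 0 1 (polytope_at ?S ?K \<eta> \<kappa>') = Q2 \<kappa>'"
    using IH[of 0 1] by blast
  have sS: "simple_polytope ?S ?K \<eta> \<kappa>" using simple_polytope_face[OF s J iJ fne] .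
  have KJ: "?K \<subseteq> J" "finite ?K" using J by (auto simp: face_indices_def)
  obtain e3 where e3: "e3 > 0" "\<And>\<kappa>'. near ?K e3 \<kappa> \<kappa>' \<Longrightarrow> simple_polytope ?S ?K \<eta> \<kappa>'"
    using simple_polytope_stable[OF sS Sne KJ(2)] by blast
  \<comment> \<open>The support numbers of the facet after translation back to the fixed hyperplane.\<close>
  define \<psi> where "\<psi> \<kappa>' j = \<kappa>' j - (\<kappa>' i - \<kappa> i) * (\<eta> j \<bullet> w)" for \<kappa>' j
  define Q where "Q \<kappa>' = Q1 (\<psi> \<kappa>') + ((\<kappa>' i - \<kappa> i) * (H \<bullet> w)) * Q2 (\<psi> \<kappa>')" for \<kappa>'
  have \<psi>: "polyfun (\<lambda>\<kappa>'. \<psi> \<kappa>' j)" for j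
    unfolding \<psi>_def by (intro polyfun_diff polyfun_mult polyfun_coord polyfun_const)
  have "polyfun Q"
    unfolding Q_def
    by (intro polyfun_add polyfun_mult polyfun_diff polyfun_coord polyfun_const
        polyfun_subst[OF Q1(2) \<psi>] polyfun_subst[OF Q2(2) \<psi>])
  define B where "B = (\<Sum>j\<in>J. \<bar>\<eta> j \<bullet> w\<bar>)"
  have B: "B \<ge> 0" "\<bar>\<eta> j \<bullet> w\<bar> \<le> B" if "j \<in> J" for j
    unfolding B_def using member_le_sum[OF that _ J, of "\<lambda>j. \<bar>\<eta> j \<bullet> w\<bar>"] by (auto intro: sum_nonneg)
  define e4 where "e4 = min e1 (min e2 e3)"
  have B0: "B \<ge> 0" unfolding B_def by (intro sum_nonneg) auto
  define \<epsilon> where "\<epsilon> = min e0 (e4 / (1 + B))"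
  have \<epsilon>: "\<epsilon> > 0" using e0 Q1 Q2 e3 B0 by (simp add: \<epsilon>_def e4_def)
  have "affine_moment (face_space P \<eta> \<kappa>' {i}) H C (facet P J \<eta> \<kappa>' i) = Q \<kappa>'"
    if k: "near J \<epsilon> \<kappa> \<kappa>'" for \<kappa>'
  proof -
    have k0: "near J e0 \<kappa> \<kappa>'" using near_mono[OF k] by (simp add: \<epsilon>_def)
    have "near ?K e4 \<kappa> (\<psi> \<kappa>')"
      unfolding near_def
    proof
      fix j assume "j \<in> ?K"
      then have j: "j \<in> J" using KJ by blast
      have "\<bar>\<psi> \<kappa>' j - \<kappa> j\<bar> \<le> \<bar>\<kappa>' j - \<kappa> j\<bar> + \<bar>\<kappa>' i - \<kappa> i\<bar> * \<bar>\<eta> j \<bullet> w\<bar>"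
        unfolding \<psi>_def abs_mult[symmetric] by linarith
      also have "\<dots> < \<epsilon> + \<epsilon> * B"
        using k i j B(2)[OF j] B0 \<epsilon> unfolding near_def
        by (intro add_less_le_mono mult_mono) (auto simp: less_imp_le)
      also have "\<dots> = \<epsilon> * (1 + B)" by (simp add: algebra_simps)
      also have "\<dots> \<le> e4 / (1 + B) * (1 + B)"
        using B0 by (intro mult_right_mono) (auto simp: \<epsilon>_def)
      also have "\<dots> = e4" using B0 by simp
      finally show "\<bar>\<psi> \<kappa>' j - \<kappa> j\<bar> < e4" .
    qed
    then have k1: "near ?K e1 \<kappa> (\<psi> \<kappa>')" and k2: "near ?K e2 \<kappa> (\<psi> \<kappa>')" and k3: "near ?K e3 \<kappa> (\<psi> \<kappa>')"
      by (auto elim!: near_mono simp: e4_def)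
    let ?v = "(\<kappa>' i - \<kappa> i) *\<^sub>R w"
    have fne': "face P J \<eta> \<kappa>' {i} \<noteq> {}" using e0(2)[OF k0] fne iJ by blast
    have K': "face_indices P J \<eta> \<kappa>' {i} = ?K"
    proof -
      have "facet P J \<eta> c j \<inter> face P J \<eta> c {i} = face P J \<eta> c {j, i}" for c j
        by (auto simp: face_def facet_def)
      moreover have "face P J \<eta> \<kappa>' {j, i} \<noteq> {} \<longleftrightarrow> face P J \<eta> \<kappa> {j, i} \<noteq> {}" if "j \<in> J" for j
        using e0(2)[OF k0] that i by auto
      ultimately have "j \<in> face_indices P J \<eta> \<kappa>' {i} \<longleftrightarrow> j \<in> ?K" for j
        by (cases "j \<in> J") (simp_all add: face_indices_def)
      then show ?thesis by blast
    qed
    have S': "face_space P \<eta> \<kappa>' {i} = (+) ?v ` ?S"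
      using face_space_translation[where \<eta> = \<eta> and i = i, OF aff w] .
    have "facet P J \<eta> \<kappa>' i = polytope_at (face_space P \<eta> \<kappa>' {i}) ?K \<eta> \<kappa>'"
      using polytope_at_face[OF aff J iJ fne'] unfolding K' facet_eq_face by simp
    also have "\<dots> = (+) ?v ` polytope_at ?S ?K \<eta> (\<psi> \<kappa>')"
      unfolding S' polytope_at_translation \<psi>_def by simp
    finally have F': "facet P J \<eta> \<kappa>' i = (+) ?v ` polytope_at ?S ?K \<eta> (\<psi> \<kappa>')" .
    have bm: "bounded (polytope_at ?S ?K \<eta> (\<psi> \<kappa>'))" "polytope_at ?S ?K \<eta> (\<psi> \<kappa>') \<in> sets borel"
      using e3(2)[OF k3] polytope_at_borel[OF affS] by (auto simp: simple_polytope_def)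
    have "affine_moment (face_space P \<eta> \<kappa>' {i}) H C (facet P J \<eta> \<kappa>' i)
      = affine_moment ?S H (C + H \<bullet> ?v) (polytope_at ?S ?K \<eta> (\<psi> \<kappa>'))"
      unfolding S' F' by (rule moment_translation[OF affS Sne bm(2)])
    also have "\<dots> = Q \<kappa>'"
      unfolding moment_affine[OF affS Sne bm] Q1(3)[OF k1] Q2(3)[OF k2] Q_def by simp
    finally show ?thesis .
  qed
  then show ?thesis using \<epsilon> \<open>polyfun Q\<close> by blast
qed

lemma near_fun_upd_between:
  assumes "near J \<epsilon> \<kappa> (\<kappa>'(i := s1))" "near J \<epsilon> \<kappa> (\<kappa>'(i := s2))" "s1 \<le> s" "s \<le> s2"
  shows "near J \<epsilon> \<kappa> (\<kappa>'(i := s))"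
  unfolding near_def
proof
  fix j assume j: "j \<in> J"
  show "\<bar>(\<kappa>'(i := s)) j - \<kappa> j\<bar> < \<epsilon>"
    using assms(1,2)[unfolded near_def, rule_format, OF j] assms(3,4)
    by (cases "j = i") auto
qed

text \<open>If the moments of a facet are locally polynomial, then the dependence of the moment of
  the polytope on the support number of that facet is given by a
  positive multiple of a primitive.\<close>

lemma moment_coordinate_primitive:
  assumes s: "simple_polytope P J \<eta> \<kappa>" and P: "P \<noteq> {}" and J: "finite J" and i: "i \<in> J"
    and Q: "polyfun Q" and e: "\<epsilon> > 0"
    and facet: "\<And>\<kappa>'. near J \<epsilon> \<kappa> \<kappa>' \<Longrightarrow>
      affine_moment (face_space P \<eta> \<kappa>' {i}) H C (facet P J \<eta> \<kappa>' i) = Q \<kappa>'"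
  shows "\<exists>c>0. \<exists>\<delta>>0. \<exists>R. polyfun R \<and>
    (\<forall>\<kappa>' s. ((\<lambda>s. R (\<kappa>'(i := s))) has_real_derivative Q (\<kappa>'(i := s))) (at s)) \<and>
    (\<forall>\<kappa>' s1 s2. near J \<delta> \<kappa> (\<kappa>'(i := s1)) \<longrightarrow> near J \<delta> \<kappa> (\<kappa>'(i := s2)) \<longrightarrow>
      affine_moment P H C (polytope_at P J \<eta> (\<kappa>'(i := s2)))
        - affine_moment P H C (polytope_at P J \<eta> (\<kappa>'(i := s1)))
      = c * (R (\<kappa>'(i := s2)) - R (\<kappa>'(i := s1))))"
proof -
  have aff: "affine P" using simple_polytope_affine[OF s] .
  obtain w where w: "w \<in> directions P" "\<eta> i \<bullet> w = 1"
    using facet_transversal[OF s P J i] by blast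
  let ?F = "\<lambda>\<kappa>. affine_moment (face_space P \<eta> \<kappa> {i}) H C (facet P J \<eta> \<kappa> i)"
  let ?M = "\<lambda>\<kappa>. affine_moment P H C (polytope_at P J \<eta> \<kappa>)"
  have "\<eta> i \<bullet> w \<noteq> 0" using w by simp
  from moment_slab[where \<eta> = \<eta> and i = i, OF aff w(1) this i] obtain c where c: "c > 0"
    "\<And>\<kappa> s1 s2. s1 \<le> s2 \<Longrightarrow> bounded (polytope_at P J \<eta> (\<kappa>(i := s2))) \<Longrightarrow>
      ?M (\<kappa>(i := s2)) - ?M (\<kappa>(i := s1))
      = c * (\<integral>s. moment (face_space P \<eta> (\<kappa>(i := s)) {i}) (\<lambda>x. H \<bullet> x + C) (facet P J \<eta> (\<kappa>(i := s)) i)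
        * indicator {s1<..s2} s \<partial>lborel)"
    by blast
  obtain e0 where e0: "e0 > 0" "\<And>\<kappa>'. near J e0 \<kappa> \<kappa>' \<Longrightarrow> simple_polytope P J \<eta> \<kappa>'"
    using simple_polytope_stable[OF s P J] by blast
  obtain R where R: "polyfun R"
    "\<And>\<kappa>' s. ((\<lambda>s. R (\<kappa>'(i := s))) has_real_derivative Q (\<kappa>'(i := s))) (at s)"
    using polyfun_primitive[OF Q] by blast
  define \<delta> where "\<delta> = min e0 \<epsilon>"
  have up: "?M (\<kappa>'(i := s2)) - ?M (\<kappa>'(i := s1)) = c * (R (\<kappa>'(i := s2)) - R (\<kappa>'(i := s1)))"
    if k: "near J \<delta> \<kappa> (\<kappa>'(i := s1))" "near J \<delta> \<kappa> (\<kappa>'(i := s2))" and le: "s1 \<le> s2" for \<kappa>' s1 s2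
  proof -
    have "near J e0 \<kappa> (\<kappa>'(i := s2))" using near_mono[OF k(2)] by (simp add: \<delta>_def)
    then have "bounded (polytope_at P J \<eta> (\<kappa>'(i := s2)))"
      using e0(2) by (simp add: simple_polytope_def)
    from c(2)[OF le this] have "?M (\<kappa>'(i := s2)) - ?M (\<kappa>'(i := s1))
      = c * (\<integral>s. moment (face_space P \<eta> (\<kappa>'(i := s)) {i}) (\<lambda>x. H \<bullet> x + C) (facet P J \<eta> (\<kappa>'(i := s)) i)
        * indicator {s1<..s2} s \<partial>lborel)" .
    also have "(\<integral>s. moment (face_space P \<eta> (\<kappa>'(i := s)) {i}) (\<lambda>x. H \<bullet> x + C) (facet P J \<eta> (\<kappa>'(i := s)) i)
        * indicator {s1<..s2} s \<partial>lborel) = (\<integral>s. Q (\<kappa>'(i := s)) * indicator {s1<..s2} s \<partial>lborel)"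
    proof (rule Bochner_Integration.integral_cong[OF refl])
      fix s
      have "moment (face_space P \<eta> (\<kappa>'(i := s)) {i}) (\<lambda>x. H \<bullet> x + C) (facet P J \<eta> (\<kappa>'(i := s)) i)
        = Q (\<kappa>'(i := s))" if "s \<in> {s1<..s2}"
      proof (rule facet)
        have "near J \<delta> \<kappa> (\<kappa>'(i := s))" using near_fun_upd_between[OF k] that by simp
        then show "near J \<epsilon> \<kappa> (\<kappa>'(i := s))" by (rule near_mono) (simp add: \<delta>_def)
      qed
      then show "moment (face_space P \<eta> (\<kappa>'(i := s)) {i}) (\<lambda>x. H \<bullet> x + C) (facet P J \<eta> (\<kappa>'(i := s)) i)
        * indicator {s1<..s2} s = Q (\<kappa>'(i := s)) * indicator {s1<..s2} s"
        by (cases "s \<in> {s1<..s2}") simp_all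
    qed
    also have "\<dots> = R (\<kappa>'(i := s2)) - R (\<kappa>'(i := s1))"
      by (rule polyfun_integral[OF Q R(2) le])
    finally show ?thesis .
  qed
  have "?M (\<kappa>'(i := s2)) - ?M (\<kappa>'(i := s1)) = c * (R (\<kappa>'(i := s2)) - R (\<kappa>'(i := s1)))"
    if k: "near J \<delta> \<kappa> (\<kappa>'(i := s1))" "near J \<delta> \<kappa> (\<kappa>'(i := s2))" for \<kappa>' s1 s2
  proof (cases "s1 \<le> s2")
    case True
    then show ?thesis using up[OF k] by blast
  next
    case False
    then have "?M (\<kappa>'(i := s1)) - ?M (\<kappa>'(i := s2)) = c * (R (\<kappa>'(i := s1)) - R (\<kappa>'(i := s2)))"
      using up[OF k(2,1)] by simp
    then show ?thesis by (simp add: algebra_simps)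
  qed
  moreover have "\<delta> > 0" using e0 e by (simp add: \<delta>_def)
  ultimately show ?thesis using c(1) R by blast
qed

text \<open>In the inductive step the support numbers are moved to their new values one after the other,
  those in \<open>S\<close> having been moved already.\<close>

lemma moment_locally_polynomial:
  fixes P :: "'a::euclidean_space set" and J :: "'i set"
  assumes "simple_polytope P J \<eta> \<kappa>" "P \<noteq> {}" "finite J"
  shows "locally_polynomial J \<kappa> (\<lambda>\<kappa>'. affine_moment P H C (polytope_at P J \<eta> \<kappa>'))"
  using assms
proof (induction "nat (aff_dim P)" arbitrary: P J H C rule: less_induct)
  case less
  note s = less.prems(1) and P = less.prems(2) and J = less.prems(3)
  have aff: "affine P" using simple_polytope_affine[OF s] .
  let ?M = "\<lambda>\<kappa>. affine_moment P H C (polytope_at P J \<eta> \<kappa>)"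
  have facet: "locally_polynomial J \<kappa>
      (\<lambda>\<kappa>'. affine_moment (face_space P \<eta> \<kappa>' {i}) H C (facet P J \<eta> \<kappa>' i))"
    if i: "i \<in> J" for i
  proof (rule facet_moment_polynomial[OF s P J i])
    fix H :: 'a and C
    let ?S = "face_space P \<eta> \<kappa> {i}" and ?K = "face_indices P J \<eta> \<kappa> {i}"
    have iJ: "{i} \<subseteq> J" using i by simp
    have fne: "face P J \<eta> \<kappa> {i} \<noteq> {}" using simple_polytope_facts(3)[OF s P J i] .
    have Sne: "?S \<noteq> {}" using fne face_subset_face_space[OF iJ] by blast
    obtain v where v: "v extreme_point_of polytope_at P J \<eta> \<kappa>" "v \<in> face P J \<eta> \<kappa> {i}"
      using extreme_point_of_face_exists[OF aff J iJ simple_polytope_facts(1)[OF s P J] fne] by blast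
    have "aff_dim ?S = aff_dim P - 1"
      using face_hull(2)[OF aff J v(1) simple_polytope_facts(4)[OF s P J v(1)], of "{i}"] v(2)
        mem_face_iff[OF iJ, of v P \<eta> \<kappa>] by simp
    moreover have "aff_dim ?S \<ge> 0"
      using aff_dim_directions[OF affine_face_space[OF aff] Sne] by simp
    ultimately have "nat (aff_dim ?S) < nat (aff_dim P)" by simp
    moreover have "finite ?K" using J by (simp add: face_indices_def)
    ultimately show "locally_polynomial ?K \<kappa> (\<lambda>\<kappa>'. affine_moment ?S H C
        (polytope_at ?S ?K \<eta> \<kappa>'))"
      using less.hyps simple_polytope_face[OF s J iJ fne] Sne by blast
  qed
  have "\<exists>\<epsilon>>0. \<exists>Q. polyfun Q \<and> (\<forall>\<kappa>'. near J \<epsilon> \<kappa> \<kappa>' \<longrightarrow> (\<forall>j\<in>J - S. \<kappa>' j = \<kappa> j) \<longrightarrow> ?M \<kappa>' = Q \<kappa>')"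
    if "S \<subseteq> J" for S
    using finite_subset[OF that J] that
  proof (induction S rule: finite_induct)
    case empty
    have "?M \<kappa>' = ?M \<kappa>" if "\<forall>j\<in>J. \<kappa>' j = \<kappa> j" for \<kappa>'
      using polytope_at_cong[of J \<kappa>' \<kappa> P \<eta>] that by simp
    then have "\<forall>\<kappa>'. near J 1 \<kappa> \<kappa>' \<longrightarrow> (\<forall>j\<in>J - {}. \<kappa>' j = \<kappa> j) \<longrightarrow> ?M \<kappa>' = ?M \<kappa>"
      unfolding Diff_empty by blast
    then show ?case
      using polyfun_const[of "?M \<kappa>"] zero_less_one by blast
  next
    case (insert i S)
    then obtain e1 Q1 where Q1: "e1 > 0" "polyfun Q1"
      "\<And>\<kappa>'. near J e1 \<kappa> \<kappa>' \<Longrightarrow> (\<forall>j\<in>J - S. \<kappa>' j = \<kappa> j) \<Longrightarrow> ?M \<kappa>' = Q1 \<kappa>'"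
      by auto
    have i: "i \<in> J" using insert by simp
    obtain e2 Q where Q: "e2 > 0" "polyfun Q" "\<And>\<kappa>'. near J e2 \<kappa> \<kappa>' \<Longrightarrow>
      affine_moment (face_space P \<eta> \<kappa>' {i}) H C (facet P J \<eta> \<kappa>' i) = Q \<kappa>'"
      using facet[OF i] by blast
    obtain c \<delta> R where c: "c > 0" and d: "\<delta> > 0" and R: "polyfun R"
      and diff: "\<And>\<kappa>' s1 s2. near J \<delta> \<kappa> (\<kappa>'(i := s1)) \<Longrightarrow> near J \<delta> \<kappa> (\<kappa>'(i := s2)) \<Longrightarrow>
        ?M (\<kappa>'(i := s2)) - ?M (\<kappa>'(i := s1)) = c * (R (\<kappa>'(i := s2)) - R (\<kappa>'(i := s1)))"
      using moment_coordinate_primitive[OF s P J i Q(2,1,3)] by blast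
    define T where "T \<kappa>' = Q1 (\<kappa>'(i := \<kappa> i)) + c * (R \<kappa>' - R (\<kappa>'(i := \<kappa> i)))" for \<kappa>'
    have "polyfun T"
      unfolding T_def by (intro polyfun_add polyfun_cmult polyfun_diff polyfun_fun_upd Q1 R)
    moreover have "?M \<kappa>' = T \<kappa>'"
      if k: "near J (min e1 \<delta>) \<kappa> \<kappa>'" and eq: "\<forall>j\<in>J - insert i S. \<kappa>' j = \<kappa> j" for \<kappa>'
    proof -
      have k0: "near J (min e1 \<delta>) \<kappa> (\<kappa>'(i := \<kappa> i))"
        using k Q1(1) d by (auto simp: near_def)
      have "?M (\<kappa>'(i := \<kappa>' i)) - ?M (\<kappa>'(i := \<kappa> i)) = c * (R (\<kappa>'(i := \<kappa>' i)) - R (\<kappa>'(i := \<kappa> i)))"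
        by (rule diff; rule near_mono) (use k k0 in auto)
      moreover have "?M (\<kappa>'(i := \<kappa> i)) = Q1 (\<kappa>'(i := \<kappa> i))"
      proof (rule Q1(3))
        show "near J e1 \<kappa> (\<kappa>'(i := \<kappa> i))" using near_mono[OF k0] by simp
        show "\<forall>j\<in>J - S. (\<kappa>'(i := \<kappa> i)) j = \<kappa> j" using eq by auto
      qed
      ultimately show ?thesis by (simp add: T_def)
    qed
    moreover have "min e1 \<delta> > 0" using Q1(1) d by simp
    ultimately show ?case by blast
  qed
  from this[of J] show ?case by auto
qed

text \<open>When the support number of a facet does not influence the mean of \<open>H\<close> over the polytope,
  slabs at the facet have the same mean, and so has the facet, as the limit of slabs.\<close>

lemma facet_mean:
  fixes P :: "'a::euclidean_space set"
  assumes s: "simple_polytope P J \<eta> \<kappa>" and P: "P \<noteq> {}" and J: "finite J" and i: "i \<in> J"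
    and e: "\<epsilon> > 0" and mean: "\<And>t. \<bar>t - \<kappa> i\<bar> < \<epsilon> \<Longrightarrow>
      simple_polytope P J \<eta> (\<kappa>(i := t)) \<and> H \<bullet> center_of_mass P (polytope_at P J \<eta> (\<kappa>(i := t))) = L"
  shows "H \<bullet> center_of_mass (face_space P \<eta> \<kappa> {i}) (facet P J \<eta> \<kappa> i) = L"
proof -
  let ?S = "face_space P \<eta> \<kappa> {i}" and ?K = "face_indices P J \<eta> \<kappa> {i}"
  have aff: "affine P" using simple_polytope_affine[OF s] .
  have iJ: "{i} \<subseteq> J" using i by simp
  have fne: "face P J \<eta> \<kappa> {i} \<noteq> {}" using simple_polytope_facts(3)[OF s P J i] .
  have Sne: "?S \<noteq> {}" using fne face_subset_face_space[OF iJ] by blast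
  have sS: "simple_polytope ?S ?K \<eta> \<kappa>"
    using simple_polytope_face[OF s J iJ fne] .
  have K: "finite ?K" using J by (simp add: face_indices_def)
  let ?M = "\<lambda>\<kappa>. affine_moment P H (- L) (polytope_at P J \<eta> \<kappa>)"
  have M0: "?M (\<kappa>(i := t)) = 0" if "\<bar>t - \<kappa> i\<bar> < \<epsilon>" for t
    using mean[OF that] center_of_mass_eq_iff[OF _ P] by blast
  obtain e1 Q where Q: "e1 > 0" "polyfun Q" "\<And>\<kappa>'. near J e1 \<kappa> \<kappa>' \<Longrightarrow>
      affine_moment (face_space P \<eta> \<kappa>' {i}) H (- L) (facet P J \<eta> \<kappa>' i) = Q \<kappa>'"
    using facet_moment_polynomial[OF s P J i moment_locally_polynomial[OF sS Sne K]] by blast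
  obtain c \<delta> R where c: "c > 0" and d: "\<delta> > 0"
    and R: "\<And>\<kappa>' s. ((\<lambda>s. R (\<kappa>'(i := s))) has_real_derivative Q (\<kappa>'(i := s))) (at s)"
    and diff: "\<And>\<kappa>' s1 s2. near J \<delta> \<kappa> (\<kappa>'(i := s1)) \<Longrightarrow> near J \<delta> \<kappa> (\<kappa>'(i := s2)) \<Longrightarrow>
        ?M (\<kappa>'(i := s2)) - ?M (\<kappa>'(i := s1)) = c * (R (\<kappa>'(i := s2)) - R (\<kappa>'(i := s1)))"
    using moment_coordinate_primitive[OF s P J i Q(2,1,3)] by blast
  have const: "R (\<kappa>(i := t)) = R (\<kappa>(i := \<kappa> i))" if t: "\<bar>t - \<kappa> i\<bar> < min \<epsilon> \<delta>" for t
  proof -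
    have "near J \<delta> \<kappa> (\<kappa>(i := t))" "near J \<delta> \<kappa> (\<kappa>(i := \<kappa> i))"
      using t d by (auto simp: near_def)
    from diff[OF this(2,1)] show ?thesis
      using M0[of t] M0[of "\<kappa> i"] t e c by simp
  qed
  have "Q (\<kappa>(i := \<kappa> i)) = 0"
  proof (rule DERIV_local_const[OF R])
    show "0 < min \<epsilon> \<delta>" using e d by simp
    show "\<forall>t. \<bar>\<kappa> i - t\<bar> < min \<epsilon> \<delta> \<longrightarrow> R (\<kappa>(i := \<kappa> i)) = R (\<kappa>(i := t))"
      using const by (simp add: abs_minus_commute)
  qed
  then have "Q \<kappa> = 0" by simp
  then have "affine_moment ?S H (- L) (facet P J \<eta> \<kappa> i) = 0"
    using Q(3)[OF near_refl[OF Q(1)]] by simp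
  moreover have "facet P J \<eta> \<kappa> i = polytope_at ?S ?K \<eta> \<kappa>"
    using polytope_at_face[OF aff J iJ fne] facet_eq_face by simp
  ultimately show ?thesis
    using center_of_mass_eq_iff[OF sS Sne] by simp
qed

section \<open>Chambers\<close>

lemma facet_cong:
  "(\<And>j. j \<in> J \<Longrightarrow> \<kappa> j = \<kappa>' j) \<Longrightarrow> i \<in> J \<Longrightarrow> facet P J \<eta> \<kappa> i = facet P J \<eta> \<kappa>' i"
  using polytope_at_cong[of J \<kappa> \<kappa>' P \<eta>] unfolding facet_def by simp

lemma simple_polytope_cong:
  assumes "\<And>j. j \<in> J \<Longrightarrow> \<kappa> j = \<kappa>' j"
  shows "simple_polytope P J \<eta> \<kappa> \<longleftrightarrow> simple_polytope P J \<eta> \<kappa>'"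
proof -
  have fc: "facet P J \<eta> \<kappa> i = facet P J \<eta> \<kappa>' i" if "i \<in> J" for i
    by (rule facet_cong[OF assms that])
  have "polytope_at P J \<eta> \<kappa> = polytope_at P J \<eta> \<kappa>'" by (rule polytope_at_cong[OF assms])
  moreover have "{i \<in> J. v \<in> facet P J \<eta> \<kappa> i} = {i \<in> J. v \<in> facet P J \<eta> \<kappa>' i}" for v
    using fc by auto
  moreover have "(\<forall>i\<in>J. facet P J \<eta> \<kappa> i \<noteq> {} \<and> aff_dim (facet P J \<eta> \<kappa> i) = aff_dim P - 1) \<longleftrightarrow>
    (\<forall>i\<in>J. facet P J \<eta> \<kappa>' i \<noteq> {} \<and> aff_dim (facet P J \<eta> \<kappa>' i) = aff_dim P - 1)"
    using fc by auto
  ultimately show ?thesis unfolding simple_polytope_def by simp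
qed

lemma chamber_simple: "\<kappa>' \<in> chamber P J \<eta> \<kappa> \<Longrightarrow> simple_polytope P J \<eta> \<kappa>'"
  unfolding chamber_def using connected_component_subset by blast

lemma connected_chamber: "connected (chamber P J \<eta> \<kappa>)"
  unfolding chamber_def by (rule connected_connected_component)

lemma base_in_chamber: "simple_polytope P J \<eta> \<kappa> \<Longrightarrow> restrict \<kappa> J \<in> chamber P J \<eta> \<kappa>"
  using simple_polytope_cong[of J \<kappa> "restrict \<kappa> J" P \<eta>]
  unfolding chamber_def by (simp add: connected_component_refl)

lemma near_restrict: "near J \<epsilon> (restrict \<kappa> J) \<kappa>' \<longleftrightarrow> near J \<epsilon> \<kappa> \<kappa>'"
  unfolding near_def by simp

text \<open>The chamber is open: a ball of simple polytopes is joined to its centre by segments.\<close>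

lemma near_chamber:
  assumes k: "\<kappa>1 \<in> chamber P J \<eta> \<kappa>" and e: "\<And>\<kappa>'. near J \<epsilon> \<kappa>1 \<kappa>' \<Longrightarrow> simple_polytope P J \<eta> \<kappa>'"
    and n: "near J \<epsilon> \<kappa>1 \<kappa>'"
  shows "restrict \<kappa>' J \<in> chamber P J \<eta> \<kappa>"
proof -
  let ?S = "{\<kappa>' \<in> J \<rightarrow>\<^sub>E UNIV. simple_polytope P J \<eta> \<kappa>'}"
  define g where "g t = (\<lambda>j\<in>J. \<kappa>1 j + t * (\<kappa>' j - \<kappa>1 j))" for t :: real
  have k1: "\<kappa>1 \<in> ?S" using k unfolding chamber_def using connected_component_subset by blast
  have "continuous_on {0..1} g"
  proof (rule continuous_on_coordinatewise_then_product)
    show "continuous_on {0..1} (\<lambda>t. g t j)" for j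
      by (cases "j \<in> J") (auto simp: g_def intro!: continuous_intros)
  qed
  then have "connected (g ` {0..1})"
    by (rule connected_continuous_image) simp
  moreover have "g ` {0..1} \<subseteq> ?S"
  proof clarify
    fix t :: real assume t: "t \<in> {0..1}"
    have "near J \<epsilon> \<kappa>1 (g t)"
      unfolding near_def
    proof
      fix j assume j: "j \<in> J"
      have "\<bar>g t j - \<kappa>1 j\<bar> = t * \<bar>\<kappa>' j - \<kappa>1 j\<bar>" using t j by (simp add: g_def abs_mult)
      also have "\<dots> \<le> 1 * \<bar>\<kappa>' j - \<kappa>1 j\<bar>" using t by (intro mult_right_mono) auto
      also have "\<dots> < \<epsilon>" using n j by (simp add: near_def)
      finally show "\<bar>g t j - \<kappa>1 j\<bar> < \<epsilon>" .
    qed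
    then show "g t \<in> J \<rightarrow>\<^sub>E UNIV \<and> simple_polytope P J \<eta> (g t)"
      using e by (simp add: g_def)
  qed
  moreover have "g 0 = \<kappa>1" using k1 by (auto simp: g_def fun_eq_iff PiE_def extensional_def)
  moreover have "g 1 = restrict \<kappa>' J" by (auto simp: g_def)
  ultimately have "connected_component ?S \<kappa>1 (restrict \<kappa>' J)"
    unfolding connected_component_def
    by (intro exI[of _ "g ` {0..1}"]) (force intro: image_eqI[of _ g 0] image_eqI[of _ g 1])
  moreover have "connected_component ?S (restrict \<kappa> J) \<kappa>1"
    using k unfolding chamber_def by simp
  ultimately show ?thesis
    unfolding chamber_def using connected_component_trans by fastforce
qed

lemma mass_linear_with_near:
  assumes s: "simple_polytope P J \<eta> \<kappa>" and P: "P \<noteq> {}" and J: "finite J"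
    and m: "mass_linear_with P J \<eta> \<kappa> H \<gamma> C"
  shows "\<exists>\<epsilon>>0. \<forall>\<kappa>'. near J \<epsilon> \<kappa> \<kappa>' \<longrightarrow> restrict \<kappa>' J \<in> chamber P J \<eta> \<kappa> \<and>
    simple_polytope P J \<eta> \<kappa>' \<and> (\<forall>I\<subseteq>J. face P J \<eta> \<kappa>' I \<noteq> {} \<longleftrightarrow> face P J \<eta> \<kappa> I \<noteq> {}) \<and>
    H \<bullet> center_of_mass P (polytope_at P J \<eta> \<kappa>') = (\<Sum>j\<in>J. \<gamma> j * \<kappa>' j) + C"
proof -
  obtain \<epsilon> where e: "\<epsilon> > 0" "\<And>\<kappa>'. near J \<epsilon> \<kappa> \<kappa>' \<Longrightarrow> simple_polytope P J \<eta> \<kappa>' \<and>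
    (\<forall>I\<subseteq>J. face P J \<eta> \<kappa>' I \<noteq> {} \<longleftrightarrow> face P J \<eta> \<kappa> I \<noteq> {})"
    using simple_polytope_stable[OF s P J] by blast
  have ch: "restrict \<kappa>' J \<in> chamber P J \<eta> \<kappa>" if "near J \<epsilon> \<kappa> \<kappa>'" for \<kappa>'
    using near_chamber[OF base_in_chamber[OF s], where \<epsilon> = \<epsilon>] e(2) that
    unfolding near_restrict by blast
  have "H \<bullet> center_of_mass P (polytope_at P J \<eta> \<kappa>') = (\<Sum>j\<in>J. \<gamma> j * \<kappa>' j) + C"
    if "near J \<epsilon> \<kappa> \<kappa>'" for \<kappa>'
  proof -
    have "polytope_at P J \<eta> (restrict \<kappa>' J) = polytope_at P J \<eta> \<kappa>'"
      by (rule polytope_at_cong) simp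
    then show ?thesis
      using m[unfolded mass_linear_with_def, rule_format, OF ch[OF that]] by simp
  qed
  then show ?thesis using e ch by blast
qed

lemma near_open_ball:
  assumes "finite J" "near J \<epsilon> \<kappa> \<kappa>'"
  shows "\<exists>\<delta>>0. \<forall>\<kappa>''. near J \<delta> \<kappa>' \<kappa>'' \<longrightarrow> near J \<epsilon> \<kappa> \<kappa>''"
proof -
  have "\<exists>\<delta>>0. \<forall>j\<in>J. \<forall>t. t \<le> \<delta> \<longrightarrow> \<bar>\<kappa>' j - \<kappa> j\<bar> + t \<le> \<epsilon>"
  proof (rule finite_common_radius[OF assms(1)])
    fix j assume "j \<in> J"
    then have "\<bar>\<kappa>' j - \<kappa> j\<bar> < \<epsilon>" using assms(2) by (simp add: near_def)
    then show "\<exists>\<delta>>0. \<forall>t\<le>\<delta>. \<bar>\<kappa>' j - \<kappa> j\<bar> + t \<le> \<epsilon>"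
      by (intro exI[of _ "\<epsilon> - \<bar>\<kappa>' j - \<kappa> j\<bar>"]) auto
  qed
  then obtain \<delta> where d: "\<delta> > 0" "\<And>j. j \<in> J \<Longrightarrow> \<bar>\<kappa>' j - \<kappa> j\<bar> + \<delta> \<le> \<epsilon>" by blast
  have "near J \<epsilon> \<kappa> \<kappa>''" if "near J \<delta> \<kappa>' \<kappa>''" for \<kappa>''
    unfolding near_def
  proof
    fix j assume "j \<in> J"
    then show "\<bar>\<kappa>'' j - \<kappa> j\<bar> < \<epsilon>"
      using that d(2)[of j] unfolding near_def by fastforce
  qed
  then show ?thesis using d(1) by blast
qed

lemma open_near:
  assumes "finite J"
  shows "open {\<kappa>' :: 'i \<Rightarrow> real. near J \<epsilon> \<kappa> \<kappa>'}"
proof -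
  have "open {\<kappa>' :: 'i \<Rightarrow> real. \<bar>\<kappa>' j - \<kappa> j\<bar> < \<epsilon>}" for j
    by (intro open_Collect_less continuous_intros continuous_on_product_coordinates)
  then have "open (\<Inter>j\<in>J. {\<kappa>' :: 'i \<Rightarrow> real. \<bar>\<kappa>' j - \<kappa> j\<bar> < \<epsilon>})"
    using assms by (intro open_INT) auto
  moreover have "(\<Inter>j\<in>J. {\<kappa>' :: 'i \<Rightarrow> real. \<bar>\<kappa>' j - \<kappa> j\<bar> < \<epsilon>}) = {\<kappa>'. near J \<epsilon> \<kappa> \<kappa>'}"
    by (auto simp: near_def)
  ultimately show ?thesis by simp
qed

text \<open>Mass linearity near one point of the chamber propagates to the whole chamber, by the
  identity theorem for locally polynomial functions on a connected set.\<close>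

lemma mass_linear_with_from_near:
  fixes P :: "'a::euclidean_space set" and J :: "'i set"
  assumes s: "simple_polytope P J \<eta> \<kappa>" and P: "P \<noteq> {}" and J: "finite J" and e: "\<epsilon> > 0"
    and loc: "\<And>\<kappa>'. near J \<epsilon> \<kappa> \<kappa>' \<Longrightarrow>
      H \<bullet> center_of_mass P (polytope_at P J \<eta> \<kappa>') = (\<Sum>j\<in>J. \<gamma> j * \<kappa>' j) + C"
  shows "mass_linear_with P J \<eta> \<kappa> H \<gamma> C"
  unfolding mass_linear_with_def
proof
  fix \<kappa>' assume k': "\<kappa>' \<in> chamber P J \<eta> \<kappa>"
  have aff: "affine P" using simple_polytope_affine[OF s] .
  define L where "L \<kappa>' = (\<Sum>j\<in>J. \<gamma> j * \<kappa>' j) + C" for \<kappa>'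
  have L: "polyfun L"
    unfolding L_def by (intro polyfun_add polyfun_sum polyfun_cmult polyfun_coord polyfun_const)
  define G where "G \<kappa>' = affine_moment P H (- L \<kappa>') (polytope_at P J \<eta> \<kappa>')" for \<kappa>'
  define Z where "Z \<kappa>1 \<longleftrightarrow> (\<exists>\<delta>>0. \<forall>\<kappa>'. near J \<delta> \<kappa>1 \<kappa>' \<longrightarrow> G \<kappa>' = 0)" for \<kappa>1
  have local_poly: "locally_polynomial J \<kappa>1 G"
    if s1: "simple_polytope P J \<eta> \<kappa>1" for \<kappa>1
  proof -
    obtain e0 where e0: "e0 > 0" "\<And>\<kappa>'. near J e0 \<kappa>1 \<kappa>' \<Longrightarrow> simple_polytope P J \<eta> \<kappa>'"
      using simple_polytope_stable[OF s1 P J] by blast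
    obtain e1 Q1 where Q1: "e1 > 0" "polyfun Q1" "\<And>\<kappa>'. near J e1 \<kappa>1 \<kappa>' \<Longrightarrow>
      affine_moment P H 0 (polytope_at P J \<eta> \<kappa>') = Q1 \<kappa>'"
      using moment_locally_polynomial[OF s1 P J, of H 0] by blast
    obtain e2 Q2 where Q2: "e2 > 0" "polyfun Q2" "\<And>\<kappa>'. near J e2 \<kappa>1 \<kappa>' \<Longrightarrow>
      affine_moment P 0 1 (polytope_at P J \<eta> \<kappa>') = Q2 \<kappa>'"
      using moment_locally_polynomial[OF s1 P J, of 0 1] by blast
    have "G \<kappa>' = Q1 \<kappa>' - L \<kappa>' * Q2 \<kappa>'" if k: "near J (min e0 (min e1 e2)) \<kappa>1 \<kappa>'" for \<kappa>'
    proof -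
      have n: "near J e0 \<kappa>1 \<kappa>'" "near J e1 \<kappa>1 \<kappa>'" "near J e2 \<kappa>1 \<kappa>'"
        using near_mono[OF k] by auto
      then have "bounded (polytope_at P J \<eta> \<kappa>')"
        using e0(2) by (simp add: simple_polytope_def)
      from moment_affine[OF aff P this polytope_at_borel[OF aff], of H 0 "- L \<kappa>'"]
      show ?thesis unfolding G_def using Q1(3)[OF n(2)] Q2(3)[OF n(3)] by simp
    qed
    moreover have "polyfun (\<lambda>\<kappa>'. Q1 \<kappa>' - L \<kappa>' * Q2 \<kappa>')"
      by (intro polyfun_diff polyfun_mult Q1 Q2 L)
    moreover have "min e0 (min e1 e2) > 0" using e0 Q1 Q2 by simp
    ultimately show ?thesis by blast
  qed
  have "Z \<kappa>'"
  proof (rule connected_induction_simple[OF connected_chamber base_in_chamber[OF s] k'])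
    obtain e0 where e0: "e0 > 0" "\<And>\<kappa>'. near J e0 \<kappa> \<kappa>' \<Longrightarrow> simple_polytope P J \<eta> \<kappa>'"
      using simple_polytope_stable[OF s P J] by blast
    have "G \<kappa>' = 0" if k: "near J (min e0 \<epsilon>) \<kappa> \<kappa>'" for \<kappa>'
    proof -
      have "simple_polytope P J \<eta> \<kappa>'" using e0(2) near_mono[OF k] by simp
      moreover have "H \<bullet> center_of_mass P (polytope_at P J \<eta> \<kappa>') = L \<kappa>'"
        unfolding L_def using loc near_mono[OF k] by simp
      ultimately show ?thesis unfolding G_def using center_of_mass_eq_iff[OF _ P] by blast
    qed
    then show "Z (restrict \<kappa> J)"
      unfolding Z_def near_restrict using e0 e by (intro exI[of _ "min e0 \<epsilon>"]) simp
  next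
    fix a assume a: "a \<in> chamber P J \<eta> \<kappa>"
    obtain e1 Q where Q: "e1 > 0" "polyfun Q" "\<And>\<kappa>'. near J e1 a \<kappa>' \<Longrightarrow> G \<kappa>' = Q \<kappa>'"
      using local_poly[OF chamber_simple[OF a]] by blast
    define T where "T = chamber P J \<eta> \<kappa> \<inter> {\<kappa>'. near J e1 a \<kappa>'}"
    have "Z y" if x: "x \<in> T" and y: "y \<in> T" and zx: "Z x" for x y
    proof -
      obtain d1 where d1: "d1 > 0" "\<And>\<kappa>'. near J d1 x \<kappa>' \<Longrightarrow> G \<kappa>' = 0"
        using zx unfolding Z_def by blast
      obtain d2 where d2: "d2 > 0" "\<And>\<kappa>'. near J d2 x \<kappa>' \<Longrightarrow> near J e1 a \<kappa>'"
        using near_open_ball[OF J, of e1 a x] x unfolding T_def by blast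
      have "Q \<kappa>' = 0" if k: "near J (min d1 d2) x \<kappa>'" for \<kappa>'
        using d1(2) d2(2) Q(3) near_mono[OF k, of d1] near_mono[OF k, of d2] by force
      then have Q0: "Q \<kappa>' = 0" for \<kappa>'
        using polyfun_zero_if_zero_near[OF Q(2) J, of "min d1 d2" x \<kappa>'] d1(1) d2(1) by simp
      obtain d3 where "d3 > 0" "\<And>\<kappa>'. near J d3 y \<kappa>' \<Longrightarrow> near J e1 a \<kappa>'"
        using near_open_ball[OF J, of e1 a y] y unfolding T_def by blast
      then show "Z y" unfolding Z_def using Q(3) Q0 by metis
    qed
    moreover have "openin (top_of_set (chamber P J \<eta> \<kappa>)) T"
      unfolding T_def using open_near[OF J] by (intro openin_open_Int)
    moreover have "a \<in> T" using a near_refl[OF Q(1)] by (simp add: T_def)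
    ultimately show "\<exists>T. openin (top_of_set (chamber P J \<eta> \<kappa>)) T \<and> a \<in> T \<and> (\<forall>x\<in>T. \<forall>y\<in>T. Z x \<longrightarrow> Z y)"
      by blast
  qed
  then have "G \<kappa>' = 0" unfolding Z_def using near_refl by blast
  then have "H \<bullet> center_of_mass P (polytope_at P J \<eta> \<kappa>') = L \<kappa>'"
    unfolding G_def using center_of_mass_eq_iff[OF chamber_simple[OF k'] P] by blast
  then show "H \<bullet> center_of_mass P (polytope_at P J \<eta> \<kappa>') = (\<Sum>j\<in>J. \<gamma> j * \<kappa>' j) + C"
    unfolding L_def .
qed

section \<open>Coefficients and symmetric facets\<close>

lemma sum_coord_update:
  assumes "finite J" "i \<in> J"
  shows "(\<Sum>j\<in>J. \<gamma> j * (\<kappa>(i := t)) j) = (\<Sum>j\<in>J. \<gamma> j * \<kappa> j) + \<gamma> i * (t - \<kappa> i :: real)"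
proof -
  have "(\<Sum>j\<in>J. \<gamma> j * (\<kappa>(i := t)) j) = (\<Sum>j\<in>J. \<gamma> j * \<kappa> j + (if j = i then \<gamma> i * (t - \<kappa> i) else 0))"
    by (intro sum.cong) (auto simp: algebra_simps)
  then show ?thesis using assms by (simp add: sum.distrib)
qed

lemma near_single_update: "0 < \<epsilon> \<Longrightarrow> near J \<epsilon> \<kappa> (\<kappa>(i := \<kappa> i + \<epsilon> / 2))"
  unfolding near_def by auto

lemma mass_linear_coefficients_unique:
  assumes s: "simple_polytope P J \<eta> \<kappa>" and P: "P \<noteq> {}" and J: "finite J"
    and m: "mass_linear_with P J \<eta> \<kappa> H \<gamma> C" and m': "mass_linear_with P J \<eta> \<kappa> H \<gamma>' C'"
    and i: "i \<in> J"
  shows "\<gamma> i = \<gamma>' i"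
proof -
  obtain e1 where e1: "e1 > 0" "\<And>\<kappa>'. near J e1 \<kappa> \<kappa>' \<Longrightarrow>
    H \<bullet> center_of_mass P (polytope_at P J \<eta> \<kappa>') = (\<Sum>j\<in>J. \<gamma> j * \<kappa>' j) + C"
    using mass_linear_with_near[OF s P J m] by blast
  obtain e2 where e2: "e2 > 0" "\<And>\<kappa>'. near J e2 \<kappa> \<kappa>' \<Longrightarrow>
    H \<bullet> center_of_mass P (polytope_at P J \<eta> \<kappa>') = (\<Sum>j\<in>J. \<gamma>' j * \<kappa>' j) + C'"
    using mass_linear_with_near[OF s P J m'] by blast
  define e where "e = min e1 e2"
  have e: "e > 0" using e1 e2 by (simp add: e_def)
  have eq: "(\<Sum>j\<in>J. \<gamma> j * \<kappa>' j) + C = (\<Sum>j\<in>J. \<gamma>' j * \<kappa>' j) + C'" if n: "near J e \<kappa> \<kappa>'" for \<kappa>'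
    using e1(2)[of \<kappa>'] e2(2)[of \<kappa>'] near_mono[OF n, of e1] near_mono[OF n, of e2]
    by (simp add: e_def)
  have "\<gamma> i * (e / 2) = \<gamma>' i * (e / 2)"
    using eq[OF near_refl[OF e]] eq[OF near_single_update[OF e, of J \<kappa> i]]
    unfolding sum_coord_update[OF J i] add_diff_cancel_left' by linarith
  then show ?thesis using e by simp
qed

lemma symmetric_index_iff:
  assumes s: "simple_polytope P J \<eta> \<kappa>" and P: "P \<noteq> {}" and J: "finite J"
    and m: "mass_linear_with P J \<eta> \<kappa> H \<gamma> C" and i: "i \<in> J"
  shows "symmetric_index P J \<eta> \<kappa> H i \<longleftrightarrow> \<gamma> i = 0"
proof
  assume sym: "symmetric_index P J \<eta> \<kappa> H i"
  obtain e where e: "e > 0" and n: "\<And>\<kappa>'. near J e \<kappa> \<kappa>' \<Longrightarrow> restrict \<kappa>' J \<in> chamber P J \<eta> \<kappa> \<and>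
    H \<bullet> center_of_mass P (polytope_at P J \<eta> \<kappa>') = (\<Sum>j\<in>J. \<gamma> j * \<kappa>' j) + C"
    using mass_linear_with_near[OF s P J m] by blast
  let ?k = "\<kappa>(i := \<kappa> i + e / 2)"
  note n0 = n[OF near_refl[OF e]] and n1 = n[OF near_single_update[OF e, of J \<kappa> i]]
  have r: "polytope_at P J \<eta> (restrict \<kappa>' J) = polytope_at P J \<eta> \<kappa>'" for \<kappa>'
    by (rule polytope_at_cong) simp
  have "\<forall>j\<in>J - {i}. restrict \<kappa> J j = restrict ?k J j" by auto
  with sym n0 n1 have "H \<bullet> center_of_mass P (polytope_at P J \<eta> (restrict \<kappa> J))
    = H \<bullet> center_of_mass P (polytope_at P J \<eta> (restrict ?k J))"
    unfolding symmetric_index_def by blast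
  then have "\<gamma> i * (e / 2) = 0"
    using n0 n1 unfolding r sum_coord_update[OF J i] by simp
  then show "\<gamma> i = 0" using e by simp
next
  assume 0: "\<gamma> i = 0"
  show "symmetric_index P J \<eta> \<kappa> H i"
    unfolding symmetric_index_def
  proof (intro ballI impI)
    fix \<kappa>' \<kappa>'' assume k: "\<kappa>' \<in> chamber P J \<eta> \<kappa>" "\<kappa>'' \<in> chamber P J \<eta> \<kappa>" "\<forall>j\<in>J - {i}. \<kappa>' j = \<kappa>'' j"
    have "(\<Sum>j\<in>J. \<gamma> j * \<kappa>' j) = (\<Sum>j\<in>J. \<gamma> j * \<kappa>'' j)"
      using k(3) 0 by (intro sum.cong) auto
    then show "H \<bullet> center_of_mass P (polytope_at P J \<eta> \<kappa>') = H \<bullet> center_of_mass P (polytope_at P J \<eta> \<kappa>'')"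
      using m k(1,2) unfolding mass_linear_with_def by simp
  qed
qed

section \<open>Restriction of mass linear functions to symmetric faces\<close>

lemma face_indices_facet_stable:
  assumes i: "i \<in> J" and st: "\<And>I. I \<subseteq> J \<Longrightarrow> face P J \<eta> \<kappa>' I \<noteq> {} \<longleftrightarrow> face P J \<eta> \<kappa> I \<noteq> {}"
  shows "face_indices P J \<eta> \<kappa>' {i} = face_indices P J \<eta> \<kappa> {i}"
proof -
  have eq: "facet P J \<eta> c j \<inter> face P J \<eta> c {i} = face P J \<eta> c {j, i}" for c j
    by (auto simp: face_def facet_def)
  have "j \<in> face_indices P J \<eta> \<kappa>' {i} \<longleftrightarrow> j \<in> face_indices P J \<eta> \<kappa> {i}" for j
    using st[of "{j, i}"] i by (cases "j \<in> J") (simp_all add: face_indices_def eq)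
  then show ?thesis by blast
qed

text \<open>Nearby polytopes with the same \<open>i\<close>-th support number have their \<open>i\<close>-th facet in the same
  hyperplane, and all sufficiently small variations of the facet arise in this way.\<close>

lemma mass_linear_facet:
  fixes P :: "'a::euclidean_space set"
  assumes s: "simple_polytope P J \<eta> \<kappa>" and P: "P \<noteq> {}" and J: "finite J"
    and m: "mass_linear_with P J \<eta> \<kappa> H \<gamma> C" and i: "i \<in> J" and \<gamma>: "\<gamma> i = 0"
  shows "mass_linear_with (face_space P \<eta> \<kappa> {i}) (face_indices P J \<eta> \<kappa> {i}) \<eta> \<kappa> H \<gamma> C"
    and "\<And>j. j \<in> J - face_indices P J \<eta> \<kappa> {i} \<Longrightarrow> \<gamma> j = 0"
proof -
  let ?S = "face_space P \<eta> \<kappa> {i}" and ?K = "face_indices P J \<eta> \<kappa> {i}"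
  have aff: "affine P" using simple_polytope_affine[OF s] .
  have iJ: "{i} \<subseteq> J" using i by simp
  have fne: "face P J \<eta> \<kappa> {i} \<noteq> {}" using simple_polytope_facts(3)[OF s P J i] .
  have Sne: "?S \<noteq> {}" using fne face_subset_face_space[OF iJ] by blast
  have K: "finite ?K" "?K \<subseteq> J" "i \<notin> ?K" using J by (auto simp: face_indices_def)
  obtain e where e: "e > 0" and n': "\<forall>\<kappa>'. near J e \<kappa> \<kappa>' \<longrightarrow> restrict \<kappa>' J \<in> chamber P J \<eta> \<kappa> \<and>
    simple_polytope P J \<eta> \<kappa>' \<and> (\<forall>I\<subseteq>J. face P J \<eta> \<kappa>' I \<noteq> {} \<longleftrightarrow> face P J \<eta> \<kappa> I \<noteq> {}) \<and>
    H \<bullet> center_of_mass P (polytope_at P J \<eta> \<kappa>') = (\<Sum>j\<in>J. \<gamma> j * \<kappa>' j) + C"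
    using mass_linear_with_near[OF s P J m] by (elim exE conjE) (rule that)
  note n = n'[THEN spec, THEN mp, THEN conjunct2]
  have mean: "H \<bullet> center_of_mass ?S (polytope_at ?S ?K \<eta> \<kappa>') = (\<Sum>j\<in>J. \<gamma> j * \<kappa>' j) + C"
    if k: "near J e \<kappa> \<kappa>'" and ki: "\<kappa>' i = \<kappa> i" for \<kappa>'
  proof -
    obtain d where d: "d > 0" "\<And>\<kappa>''. near J d \<kappa>' \<kappa>'' \<Longrightarrow> near J e \<kappa> \<kappa>''"
      using near_open_ball[OF J k] by blast
    have "H \<bullet> center_of_mass (face_space P \<eta> \<kappa>' {i}) (facet P J \<eta> \<kappa>' i) = (\<Sum>j\<in>J. \<gamma> j * \<kappa>' j) + C"
    proof (rule facet_mean[OF _ P J i d(1)])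
      show "simple_polytope P J \<eta> \<kappa>'" using n[OF k] by blast
      fix t assume "\<bar>t - \<kappa>' i\<bar> < d"
      then have "near J d \<kappa>' (\<kappa>'(i := t))" using d(1) by (simp add: near_def)
      from n[OF d(2)[OF this]]
      show "simple_polytope P J \<eta> (\<kappa>'(i := t)) \<and>
        H \<bullet> center_of_mass P (polytope_at P J \<eta> (\<kappa>'(i := t))) = (\<Sum>j\<in>J. \<gamma> j * \<kappa>' j) + C"
        using sum_coord_update[OF J i, of \<gamma> \<kappa>' t] \<gamma> by simp
    qed
    moreover have "face_space P \<eta> \<kappa>' {i} = ?S" using ki by (simp add: face_space_def)
    moreover have "facet P J \<eta> \<kappa>' i = polytope_at (face_space P \<eta> \<kappa>' {i}) ?K \<eta> \<kappa>'"
    proof -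
      have st: "\<And>I. I \<subseteq> J \<Longrightarrow> face P J \<eta> \<kappa>' I \<noteq> {} \<longleftrightarrow> face P J \<eta> \<kappa> I \<noteq> {}" using n[OF k] by blast
      have "face P J \<eta> \<kappa>' {i} \<noteq> {}" using st[OF iJ] fne by blast
      moreover have "face_indices P J \<eta> \<kappa>' {i} = ?K"
        by (rule face_indices_facet_stable[OF i st])
      ultimately show ?thesis
        using polytope_at_face[OF aff J iJ, of \<eta> \<kappa>'] facet_eq_face by simp
    qed
    ultimately show ?thesis by simp
  qed
  show \<gamma>0: "\<gamma> j = 0" if j: "j \<in> J - ?K" for j
  proof (cases "j = i")
    case False
    let ?k = "\<kappa>(j := \<kappa> j + e / 2)"
    have "polytope_at ?S ?K \<eta> ?k = polytope_at ?S ?K \<eta> \<kappa>"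
      using j by (intro polytope_at_cong) auto
    then have "(\<Sum>j\<in>J. \<gamma> j * ?k j) + C = (\<Sum>j\<in>J. \<gamma> j * \<kappa> j) + C"
      using mean[OF near_refl[OF e]] mean[OF near_single_update[OF e, of J \<kappa> j]] False by simp
    then have "\<gamma> j * (e / 2) = 0"
      using sum_coord_update[OF J, of j \<gamma> \<kappa> "\<kappa> j + e / 2"] j by simp
    then show ?thesis using e by simp
  qed (simp add: \<gamma>)
  show "mass_linear_with ?S ?K \<eta> \<kappa> H \<gamma> C"
  proof (rule mass_linear_with_from_near[OF simple_polytope_face[OF s J iJ fne] Sne K(1) e])
    fix \<kappa>' assume k: "near ?K e \<kappa> \<kappa>'"
    define \<kappa>'' where "\<kappa>'' j = (if j \<in> ?K then \<kappa>' j else \<kappa> j)" for j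
    have "near J e \<kappa> \<kappa>''" using k e by (auto simp: near_def \<kappa>''_def)
    moreover have "\<kappa>'' i = \<kappa> i" using K(3) by (simp add: \<kappa>''_def)
    moreover have "polytope_at ?S ?K \<eta> \<kappa>'' = polytope_at ?S ?K \<eta> \<kappa>'"
      by (rule polytope_at_cong) (simp add: \<kappa>''_def)
    moreover have "(\<Sum>j\<in>J. \<gamma> j * \<kappa>'' j) = (\<Sum>j\<in>?K. \<gamma> j * \<kappa>' j)"
    proof -
      have "(\<Sum>j\<in>J. \<gamma> j * \<kappa>'' j) = (\<Sum>j\<in>?K. \<gamma> j * \<kappa>'' j)"
        using \<gamma>0 by (intro sum.mono_neutral_right[OF J K(2)]) simp
      then show ?thesis by (simp add: \<kappa>''_def)
    qed
    ultimately show "H \<bullet> center_of_mass ?S (polytope_at ?S ?K \<eta> \<kappa>') = (\<Sum>j\<in>?K. \<gamma> j * \<kappa>' j) + C"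
      using mean[of \<kappa>''] by simp
  qed
qed

text \<open>Induction on the number of facets cutting out the face, which is a face of its first facet.\<close>

lemma mass_linear_face:
  fixes P :: "'a::euclidean_space set"
  assumes "finite I" "simple_polytope P J \<eta> \<kappa>" "P \<noteq> {}" "finite J"
    "mass_linear_with P J \<eta> \<kappa> H \<gamma> C" "I \<subseteq> J" "\<forall>i\<in>I. \<gamma> i = 0" "face P J \<eta> \<kappa> I \<noteq> {}"
  shows "mass_linear_with (face_space P \<eta> \<kappa> I) (face_indices P J \<eta> \<kappa> I) \<eta> \<kappa> H \<gamma> C \<and>
    (\<forall>j\<in>J - face_indices P J \<eta> \<kappa> I. \<gamma> j = 0)"
  using assms
proof (induction I arbitrary: P J rule: finite_induct)
  case empty
  have "facet P J \<eta> \<kappa> j \<inter> polytope_at P J \<eta> \<kappa> = face P J \<eta> \<kappa> {j}" for j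
    by (auto simp: face_def facet_def)
  then have "face_indices P J \<eta> \<kappa> {} = J"
    using simple_polytope_facts(3)[OF empty(1,2,3)] by (auto simp: face_indices_def)
  then show ?case using empty by simp
next
  case (insert i I)
  note s = insert.prems(1) and P = insert.prems(2) and J = insert.prems(3)
  let ?S = "face_space P \<eta> \<kappa> {i}" and ?K = "face_indices P J \<eta> \<kappa> {i}"
  have aff: "affine P" using simple_polytope_affine[OF s] .
  have i: "i \<in> J" "{i} \<subseteq> J" using insert.prems by auto
  have fne: "face P J \<eta> \<kappa> {i} \<noteq> {}" using simple_polytope_facts(3)[OF s P J i(1)] .
  note comp = face_of_face[OF aff J i(2) fne, of I] face_space_face_space[of P \<eta> \<kappa> "{i}" I]
    face_indices_of_face[OF aff J i(2) fne, of I]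
  note facet = mass_linear_facet[OF s P J insert.prems(4) i(1)]
  have \<gamma>i: "\<gamma> i = 0" using insert.prems by simp
  have IK: "I \<subseteq> ?K"
  proof
    fix j assume j: "j \<in> I"
    have "face P J \<eta> \<kappa> (insert i I) \<subseteq> facet P J \<eta> \<kappa> j \<inter> face P J \<eta> \<kappa> {i}"
      using j by (auto simp: face_def)
    then show "j \<in> ?K"
      using j insert.prems(5,7) insert.hyps(2) by (auto simp: face_indices_def)
  qed
  have "mass_linear_with (face_space ?S \<eta> \<kappa> I) (face_indices ?S ?K \<eta> \<kappa> I) \<eta> \<kappa> H \<gamma> C \<and>
    (\<forall>j\<in>?K - face_indices ?S ?K \<eta> \<kappa> I. \<gamma> j = 0)"
  proof (rule insert.IH)
    show "simple_polytope ?S ?K \<eta> \<kappa>" using simple_polytope_face[OF s J i(2) fne] .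
    show "?S \<noteq> {}" using fne face_subset_face_space[OF i(2)] by blast
    show "finite ?K" using J by (simp add: face_indices_def)
    show "mass_linear_with ?S ?K \<eta> \<kappa> H \<gamma> C" using facet(1)[OF \<gamma>i] .
    show "I \<subseteq> ?K" by (fact IK)
    show "\<forall>i\<in>I. \<gamma> i = 0" using insert.prems(6) by simp
    show "face ?S ?K \<eta> \<kappa> I \<noteq> {}" using comp(1) insert.prems(7) by simp
  qed
  moreover have "\<forall>j\<in>J - ?K. \<gamma> j = 0"
    using facet(2)[OF \<gamma>i] by blast
  ultimately show ?case
    unfolding comp(2,3) insert_is_Un[of i I] by blast
qed

lemma facet_inj:
  assumes s: "simple_polytope P J \<eta> \<kappa>" and P: "P \<noteq> {}" and J: "finite J"
  shows "inj_on (facet P J \<eta> \<kappa>) J"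
proof (rule inj_onI, rule ccontr)
  fix j k assume j: "j \<in> J" and k: "k \<in> J" and eq: "facet P J \<eta> \<kappa> j = facet P J \<eta> \<kappa> k" and ne: "j \<noteq> k"
  have aff: "affine P" using simple_polytope_affine[OF s] .
  have jJ: "{j} \<subseteq> J" using j by simp
  obtain v w where v: "v \<in> face P J \<eta> \<kappa> {j}" and w: "\<forall>i\<in>active J \<eta> \<kappa> v. w i \<in> directions P"
    and dual: "dual_on (active J \<eta> \<kappa> v) \<eta> w"
    using simple_polytope_vertex[OF s P J jJ simple_polytope_facts(3)[OF s P J j]] by metis
  let ?A = "active J \<eta> \<kappa> v"
  have vD: "v \<in> polytope_at P J \<eta> \<kappa>" using v by (simp add: face_def)
  have jA: "j \<in> ?A" using v mem_face_iff[OF jJ, of v P \<eta> \<kappa>] by simp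
  have kA: "k \<in> ?A"
    using v k eq unfolding facet_eq_face[symmetric] by (auto simp: facet_def active_def)
  obtain e where e: "e > 0" and corner: "\<And>t. (\<forall>i\<in>?A. 0 \<le> t i \<and> t i \<le> e) \<Longrightarrow>
    v - (\<Sum>i\<in>?A. t i *\<^sub>R w i) \<in> polytope_at P J \<eta> \<kappa> \<and>
    active J \<eta> \<kappa> (v - (\<Sum>i\<in>?A. t i *\<^sub>R w i)) = {i \<in> ?A. t i = 0}"
    using corner_at_vertex[OF aff J vD w dual] by auto
  \<comment> \<open>Leave the facet \<open>k\<close> along the edge contained in all other facets at the vertex.\<close>
  define t where "t i = (if i = k then e else 0)" for i
  define x where "x = v - (\<Sum>i\<in>?A. t i *\<^sub>R w i)"
  have x: "x \<in> polytope_at P J \<eta> \<kappa>" "active J \<eta> \<kappa> x = {i \<in> ?A. t i = 0}"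
    using corner[of t] e by (auto simp: t_def x_def)
  then have "j \<in> active J \<eta> \<kappa> x" "k \<notin> active J \<eta> \<kappa> x"
    using jA kA ne e by (auto simp: t_def)
  then show False
    using x(1) eq k by (auto simp: facet_def active_def)
qed

theorem proposition2p9:
  fixes V :: "'a::euclidean_space set" and N :: nat and \<eta> :: "nat \<Rightarrow> 'a"
    and \<kappa> :: "nat \<Rightarrow> real" and H :: 'a and I :: "nat set" and f P\<^sub>f :: "'a set" and I\<^sub>f :: "nat set"
  assumes "subspace V"
    and "simple_polytope V {..<N} \<eta> \<kappa>"
    and "mass_linear V {..<N} \<eta> \<kappa> H"
    and "I \<subseteq> {..<N}"
    and "\<forall>i\<in>I. symmetric_index V {..<N} \<eta> \<kappa> H i"
    and "f = face V {..<N} \<eta> \<kappa> I"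
    and "f \<noteq> {}"
    and "P\<^sub>f = face_space V \<eta> \<kappa> I"
    and "I\<^sub>f = face_indices V {..<N} \<eta> \<kappa> I"
  shows "mass_linear P\<^sub>f I\<^sub>f \<eta> \<kappa> H
    \<and> bij_betw (\<lambda>F. F \<inter> f) (asymmetric_facets V {..<N} \<eta> \<kappa> H) (asymmetric_facets P\<^sub>f I\<^sub>f \<eta> \<kappa> H)
    \<and> (\<forall>\<gamma> C \<gamma>' C'. mass_linear_with V {..<N} \<eta> \<kappa> H \<gamma> C \<longrightarrow> mass_linear_with P\<^sub>f I\<^sub>f \<eta> \<kappa> H \<gamma>' C' \<longrightarrow>
        (\<forall>i<N. \<not> symmetric_index V {..<N} \<eta> \<kappa> H i \<longrightarrow> i \<in> I\<^sub>f \<and> \<gamma>' i = \<gamma> i))"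
proof -
  let ?J = "{..<N}"
  note s = assms(2)
  have J: "finite ?J" by simp
  have V: "V \<noteq> {}" using subspace_0[OF assms(1)] by blast
  have aff: "affine V" using simple_polytope_affine[OF s] .
  have fne: "face V ?J \<eta> \<kappa> I \<noteq> {}" using assms by simp
  have fI: "finite I" using finite_subset[OF assms(4) J] .
  have sf: "simple_polytope P\<^sub>f I\<^sub>f \<eta> \<kappa>"
    using simple_polytope_face[OF s J assms(4) fne] assms by simp
  have Pf: "P\<^sub>f \<noteq> {}"
    using fne face_subset_face_space[OF assms(4), of V \<eta> \<kappa>] assms(8) by blast
  have If: "finite I\<^sub>f" "I\<^sub>f \<subseteq> ?J" using assms(9) by (auto simp: face_indices_def)
  have sym: "symmetric_index V ?J \<eta> \<kappa> H i \<longleftrightarrow> \<gamma> i = 0"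
    if "mass_linear_with V ?J \<eta> \<kappa> H \<gamma> C" "i < N" for \<gamma> C i
    using symmetric_index_iff[OF s V J that(1)] that(2) by simp
  have main: "mass_linear_with P\<^sub>f I\<^sub>f \<eta> \<kappa> H \<gamma> C \<and> (\<forall>j\<in>?J - I\<^sub>f. \<gamma> j = 0)"
    if m: "mass_linear_with V ?J \<eta> \<kappa> H \<gamma> C" for \<gamma> C
  proof -
    have "\<forall>i\<in>I. \<gamma> i = 0" using sym[OF m] assms(4,5) by auto
    then show ?thesis
      using mass_linear_face[OF fI s V J m assms(4) _ fne] assms(8,9) by simp
  qed
  obtain \<gamma> C where m: "mass_linear_with V ?J \<eta> \<kappa> H \<gamma> C"
    using assms(3) unfolding mass_linear_def by blast
  define A where "A = {i \<in> I\<^sub>f. \<gamma> i \<noteq> 0}"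
  have idx: "{i \<in> ?J. \<not> symmetric_index V ?J \<eta> \<kappa> H i} = A"
    using sym[OF m] main[OF m] If(2) by (auto simp: A_def)
  have idxf: "{i \<in> I\<^sub>f. \<not> symmetric_index P\<^sub>f I\<^sub>f \<eta> \<kappa> H i} = A"
    using symmetric_index_iff[OF sf Pf If(1) conjunct1[OF main[OF m]]] by (auto simp: A_def)
  have ff: "facet P\<^sub>f I\<^sub>f \<eta> \<kappa> j = facet V ?J \<eta> \<kappa> j \<inter> f" for j
    using facet_of_face[OF aff J assms(4) fne] assms by simp
  have inj: "inj_on (facet P\<^sub>f I\<^sub>f \<eta> \<kappa>) A"
    using facet_inj[OF sf Pf If(1)] by (rule inj_on_subset) (auto simp: A_def)
  have bij: "bij_betw (\<lambda>F. F \<inter> f) (asymmetric_facets V ?J \<eta> \<kappa> H) (asymmetric_facets P\<^sub>f I\<^sub>f \<eta> \<kappa> H)"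
    unfolding asymmetric_facets_def idx idxf bij_betw_def
  proof
    show "inj_on (\<lambda>F. F \<inter> f) (facet V ?J \<eta> \<kappa> ` A)"
      using inj unfolding ff inj_on_def by blast
    show "(\<lambda>F. F \<inter> f) ` facet V ?J \<eta> \<kappa> ` A = facet P\<^sub>f I\<^sub>f \<eta> \<kappa> ` A"
      by (simp add: image_image ff)
  qed
  have coeff: "i \<in> I\<^sub>f \<and> \<gamma>' i = \<gamma> i"
    if "mass_linear_with V ?J \<eta> \<kappa> H \<gamma> C" "mass_linear_with P\<^sub>f I\<^sub>f \<eta> \<kappa> H \<gamma>' C'" "i < N"
      "\<not> symmetric_index V ?J \<eta> \<kappa> H i" for \<gamma> C \<gamma>' C' i
  proof -
    have "i \<in> I\<^sub>f" using main[OF that(1)] sym[OF that(1,3)] that(3,4) by auto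
    then show ?thesis
      using mass_linear_coefficients_unique[OF sf Pf If(1) that(2) conjunct1[OF main[OF that(1)]]] by simp
  qed
  show ?thesis
    using main[OF m] bij coeff unfolding mass_linear_def by blast
qed

end
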